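(* Fix $\mu>0$. Assume that $V:\mathbf{R}\to\mathbf{R}$ is $C^5$, $V'(0)=0$, and $c\neq 0$ is a $(1+\mu)^{-1}V$-admissible wave speed; let $\beta>0$ and $\sigma\in E^2_\beta$ be the corresponding exponent and function furnished by the definition of admissibility for the potential $(1+\mu)^{-1}V$. For $n\in\mathbf{N}$ set $$\kappa=\kappa_n:=\frac{4\pi^2c^2n^2\mu}{1+\mu},$$ so that $\sqrt{\kappa(1+\mu)/(c^2\mu)}=2n\pi$. Then there exist $C>0$ and $N\in\mathbf{N}$ such that $n\ge N$ implies the existence of unique functions $\rho_1,\rho_2\in H^2_\beta$ with the following properties: (i) $\rho_1$ and $\rho_2$ solve (with $\kappa=\kappa_n$) $$c^2\rho_1''-\delta^2V'(\rho_1)-\kappa\,\delta\rho_2=0,\qquad c^2\mu\rho_2''+\kappa(1+\mu)\rho_2+\mu\,\delta V'(\rho_1)=0.$$ (ii) $\rho_1$ is even and $\rho_2$ is odd. (iii) $\|\sigma-\rho_1\|_{2,\beta}+\|\rho_2\|_{2,\beta}\le C/n$. Moreover, if $V$ is smooth ($C^\infty$), then so are $\rho_1$ and $\rho_2$, and the estimate in (iii) improves to: for any $s\ge 0$ there is a constant $C>0$ (which may depend on $s$ but not on $n$) such that $\|\sigma-\rho_1\|_{s,\beta}+\|\rho_2\|_{s,\beta}\le C/n^2$ for all $n\ge N$.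
   Context: $\mathbf{N}=\{1,2,3,\dots\}$. The operator $\delta$ is $\delta f(x):=f(x+1/2)-f(x-1/2)$, and $\delta^2=\delta\circ\delta$. For a function $f$, $V'(f)$ denotes the composition $V'\circ f$. Function spaces (functions on $\mathbf{R}$): $H^s=H^s(\mathbf{R})$ is the usual Sobolev space; for $b\ge 0$, $$H^s_b:=\{f\in H^s:\cosh(\cdot)^bf\in H^s\},\qquad \|f\|_{s,b}:=\|\cosh(\cdot)^bf\|_{H^s},$$ $E^s_b:=H^s_b\cap\{\text{even functions}\}$, and $E^s_{b,0}:=E^s_b\cap\{f:\int_{\mathbf{R}}f(x)\,dx=0\}$. Definition. For a potential $W$, $c\in\mathbf{R}$ is a $W$-admissible wave speed if there exist $\beta>0$ and a nonzero function $\sigma\in E^2_\beta$ such that (i) $c^2\sigma''-\delta^2W'(\sigma)=0$, and (ii) the operator $\mathcal{H}f:=c^2f''-\delta^2W''(\sigma)f$ (i.e. $\delta^2$ is applied to the pointwise product $W''(\sigma)f$) is a homeomorphism from $E^2_\beta$ onto $E^0_{\beta,0}$. Moreover, if $W$ is smooth then so is $\sigma$, and $\mathcal{H}$ is a homeomorphism from $E^{s+2}_\beta$ to $E^s_{\beta,0}$ for all $s\ge 0$ (this is part of the definition). In the claim this is used with $W=(1+\mu)^{-1}V$. *)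

theory Defs
  imports "HOL-Analysis.Analysis"
begin

text \<open>
  Elements of the function spaces are represented by Borel measurable functions; two functions
  that agree almost everywhere represent the same element. Accordingly, equations between them,
  evenness, injectivity and uniqueness are all read almost everywhere.
\<close>

abbreviation ae_eq :: "(real \<Rightarrow> real) \<Rightarrow> (real \<Rightarrow> real) \<Rightarrow> bool" where
  "ae_eq f g \<equiv> (AE x in lborel. f x = g x)"

definition C_k :: "nat \<Rightarrow> (real \<Rightarrow> real) \<Rightarrow> bool" where
  "C_k k f \<longleftrightarrow> (\<forall>j<k. \<forall>x. (deriv ^^ j) f differentiable at x) \<and> continuous_on UNIV ((deriv ^^ k) f)"

definition smooth :: "(real \<Rightarrow> real) \<Rightarrow> bool" where
  "smooth f \<longleftrightarrow> (\<forall>k. C_k k f)"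

definition cdiff :: "(real \<Rightarrow> real) \<Rightarrow> real \<Rightarrow> real" where
  "cdiff f = (\<lambda>x. f (x + 1/2) - f (x - 1/2))"

definition L2 :: "(real \<Rightarrow> real) set" where
  "L2 = {f. f \<in> borel_measurable lborel \<and> integrable lborel (\<lambda>x. (f x)\<^sup>2)}"

definition loc_integrable :: "(real \<Rightarrow> real) \<Rightarrow> bool" where
  "loc_integrable f \<longleftrightarrow>
     f \<in> borel_measurable lborel \<and> (\<forall>a b. set_integrable lborel {a..b} f)"

definition test_fun :: "(real \<Rightarrow> real) \<Rightarrow> bool" where
  "test_fun \<phi> \<longleftrightarrow> smooth \<phi> \<and> (\<exists>R. \<forall>x. \<bar>x\<bar> > R \<longrightarrow> \<phi> x = 0)"

definition has_weak_deriv :: "nat \<Rightarrow> (real \<Rightarrow> real) \<Rightarrow> (real \<Rightarrow> real) \<Rightarrow> bool" where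
  "has_weak_deriv k f g \<longleftrightarrow> loc_integrable f \<and> loc_integrable g \<and>
     (\<forall>\<phi>. test_fun \<phi> \<longrightarrow>
        (LINT x|lborel. f x * (deriv ^^ k) \<phi> x) = (-1) ^ k * (LINT x|lborel. g x * \<phi> x))"

text \<open>The weak derivative is determined almost everywhere; \<open>wderiv\<close> picks a representative.\<close>

definition wderiv :: "nat \<Rightarrow> (real \<Rightarrow> real) \<Rightarrow> real \<Rightarrow> real" where
  "wderiv k f = (SOME g. has_weak_deriv k f g)"

text \<open>
  The Sobolev space of real order \<open>s \<ge> 0\<close>: weak derivatives up to order \<open>\<lfloor>s\<rfloor>\<close> in \<open>L2\<close> and, for
  non-integer \<open>s\<close>, a finite Gagliardo--Slobodeckij seminorm, of order the fractional part of \<open>s\<close>,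
  of the top derivative. At coinciding points the quotient is \<open>0 / 0 = 0\<close>, which is irrelevant
  since the diagonal is a null set.
\<close>

definition gagliardo_quotient :: "real \<Rightarrow> (real \<Rightarrow> real) \<Rightarrow> real \<times> real \<Rightarrow> real" where
  "gagliardo_quotient \<theta> g = (\<lambda>(x, y). (g x - g y)\<^sup>2 / \<bar>x - y\<bar> powr (1 + 2 * \<theta>))"

definition H_space :: "real \<Rightarrow> (real \<Rightarrow> real) set" where
  "H_space s = {f. (\<forall>k \<le> nat \<lfloor>s\<rfloor>. \<exists>g \<in> L2. has_weak_deriv k f g) \<and> f \<in> L2 \<and>
     (frac s \<noteq> 0 \<longrightarrow>
        integrable (lborel \<Otimes>\<^sub>M lborel) (gagliardo_quotient (frac s) (wderiv (nat \<lfloor>s\<rfloor>) f)))}"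

definition H_norm :: "real \<Rightarrow> (real \<Rightarrow> real) \<Rightarrow> real" where
  "H_norm s f = sqrt ((\<Sum>k \<le> nat \<lfloor>s\<rfloor>. LINT x|lborel. (wderiv k f x)\<^sup>2) +
     (if frac s = 0 then 0
      else LINT z|(lborel \<Otimes>\<^sub>M lborel). gagliardo_quotient (frac s) (wderiv (nat \<lfloor>s\<rfloor>) f) z))"

definition Hw_space :: "real \<Rightarrow> real \<Rightarrow> (real \<Rightarrow> real) set" where
  "Hw_space s b = {f \<in> H_space s. (\<lambda>x. cosh x powr b * f x) \<in> H_space s}"

definition Hw_norm :: "real \<Rightarrow> real \<Rightarrow> (real \<Rightarrow> real) \<Rightarrow> real" where
  "Hw_norm s b f = H_norm s (\<lambda>x. cosh x powr b * f x)"

definition even_ae :: "(real \<Rightarrow> real) \<Rightarrow> bool" where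
  "even_ae f \<longleftrightarrow> (AE x in lborel. f (- x) = f x)"

definition odd_ae :: "(real \<Rightarrow> real) \<Rightarrow> bool" where
  "odd_ae f \<longleftrightarrow> (AE x in lborel. f (- x) = - f x)"

definition E_space :: "real \<Rightarrow> real \<Rightarrow> (real \<Rightarrow> real) set" where
  "E_space s b = {f \<in> Hw_space s b. even_ae f}"

definition E0_space :: "real \<Rightarrow> real \<Rightarrow> (real \<Rightarrow> real) set" where
  "E0_space s b = {f \<in> E_space s b. integrable lborel f \<and> (LINT x|lborel. f x) = 0}"

text \<open>
  A homeomorphism from \<open>X\<close> (norm \<open>p\<close>) onto \<open>Y\<close> (norm \<open>q\<close>), elements being taken modulo
  almost-everywhere equality: a well-defined bijection of the classes, continuous with
  continuous inverse.
\<close>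

definition homeomorphism_ae ::
  "(real \<Rightarrow> real) set \<Rightarrow> ((real \<Rightarrow> real) \<Rightarrow> real) \<Rightarrow>
   (real \<Rightarrow> real) set \<Rightarrow> ((real \<Rightarrow> real) \<Rightarrow> real) \<Rightarrow>
   ((real \<Rightarrow> real) \<Rightarrow> (real \<Rightarrow> real)) \<Rightarrow> bool" where
  "homeomorphism_ae X p Y q T \<longleftrightarrow>
     (\<forall>f\<in>X. T f \<in> Y) \<and>
     (\<forall>f\<in>X. \<forall>g\<in>X. ae_eq (T f) (T g) \<longleftrightarrow> ae_eq f g) \<and>
     (\<forall>h\<in>Y. \<exists>f\<in>X. ae_eq (T f) h) \<and>
     (\<forall>f\<in>X. \<forall>\<epsilon>>0. \<exists>d>0. \<forall>g\<in>X.
        p (\<lambda>x. g x - f x) < d \<longrightarrow> q (\<lambda>x. T g x - T f x) < \<epsilon>) \<and>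
     (\<forall>f\<in>X. \<forall>\<epsilon>>0. \<exists>d>0. \<forall>g\<in>X.
        q (\<lambda>x. T g x - T f x) < d \<longrightarrow> p (\<lambda>x. g x - f x) < \<epsilon>)"

definition lin_op :: "(real \<Rightarrow> real) \<Rightarrow> real \<Rightarrow> (real \<Rightarrow> real) \<Rightarrow> (real \<Rightarrow> real) \<Rightarrow> real \<Rightarrow> real" where
  "lin_op W c \<sigma> f =
     (\<lambda>x. c\<^sup>2 * wderiv 2 f x - cdiff (cdiff (\<lambda>y. (deriv ^^ 2) W (\<sigma> y) * f y)) x)"

text \<open>
  \<open>admissible_via W c \<beta> \<sigma>\<close>: the exponent \<open>\<beta>\<close> and the function \<open>\<sigma>\<close> witness that \<open>c\<close> is a
  \<open>W\<close>-admissible wave speed.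
\<close>

definition admissible_via ::
  "(real \<Rightarrow> real) \<Rightarrow> real \<Rightarrow> real \<Rightarrow> (real \<Rightarrow> real) \<Rightarrow> bool" where
  "admissible_via W c \<beta> \<sigma> \<longleftrightarrow>
     \<beta> > 0 \<and> \<sigma> \<in> E_space 2 \<beta> \<and> \<not> ae_eq \<sigma> (\<lambda>_. 0) \<and>
     (AE x in lborel. c\<^sup>2 * wderiv 2 \<sigma> x - cdiff (cdiff (\<lambda>y. deriv W (\<sigma> y))) x = 0) \<and>
     homeomorphism_ae (E_space 2 \<beta>) (Hw_norm 2 \<beta>) (E0_space 0 \<beta>) (Hw_norm 0 \<beta>) (lin_op W c \<sigma>) \<and>
     (smooth W \<longrightarrow>
        (\<exists>\<sigma>'. smooth \<sigma>' \<and> ae_eq \<sigma> \<sigma>') \<and>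
        (\<forall>s\<ge>0. homeomorphism_ae (E_space (s + 2) \<beta>) (Hw_norm (s + 2) \<beta>)
                 (E0_space s \<beta>) (Hw_norm s \<beta>) (lin_op W c \<sigma>)))"

definition admissible :: "(real \<Rightarrow> real) \<Rightarrow> real \<Rightarrow> bool" where
  "admissible W c \<longleftrightarrow> (\<exists>\<beta> \<sigma>. admissible_via W c \<beta> \<sigma>)"

definition kappa :: "real \<Rightarrow> real \<Rightarrow> nat \<Rightarrow> real" where
  "kappa \<mu> c n = 4 * pi\<^sup>2 * c\<^sup>2 * (real n)\<^sup>2 * \<mu> / (1 + \<mu>)"

lemma sqrt_kappa:
  assumes "\<mu> > 0" "c \<noteq> 0"
  shows "sqrt (kappa \<mu> c n * (1 + \<mu>) / (c\<^sup>2 * \<mu>)) = 2 * real n * pi"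
proof -
  have "kappa \<mu> c n * (1 + \<mu>) = 4 * pi\<^sup>2 * c\<^sup>2 * (real n)\<^sup>2 * \<mu>"
    using assms by (simp add: kappa_def)
  then have "kappa \<mu> c n * (1 + \<mu>) / (c\<^sup>2 * \<mu>) = (2 * real n * pi)\<^sup>2"
    using assms by (simp add: power_mult_distrib)
  then show ?thesis by simp
qed

definition travelling_wave ::
  "(real \<Rightarrow> real) \<Rightarrow> real \<Rightarrow> real \<Rightarrow> real \<Rightarrow> (real \<Rightarrow> real) \<Rightarrow> (real \<Rightarrow> real) \<Rightarrow> bool" where
  "travelling_wave V \<mu> c \<kappa> \<rho>1 \<rho>2 \<longleftrightarrow>
     (AE x in lborel. c\<^sup>2 * wderiv 2 \<rho>1 x - cdiff (cdiff (\<lambda>y. deriv V (\<rho>1 y))) x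
                        - \<kappa> * cdiff \<rho>2 x = 0) \<and>
     (AE x in lborel. c\<^sup>2 * \<mu> * wderiv 2 \<rho>2 x + \<kappa> * (1 + \<mu>) * \<rho>2 x
                        + \<mu> * cdiff (\<lambda>y. deriv V (\<rho>1 y)) x = 0)"

definition wave_near ::
  "(real \<Rightarrow> real) \<Rightarrow> real \<Rightarrow> real \<Rightarrow> real \<Rightarrow> (real \<Rightarrow> real) \<Rightarrow> real \<Rightarrow> nat \<Rightarrow>
   (real \<Rightarrow> real) \<Rightarrow> (real \<Rightarrow> real) \<Rightarrow> bool" where
  "wave_near V \<mu> c \<beta> \<sigma> C n \<rho>1 \<rho>2 \<longleftrightarrow>
     \<rho>1 \<in> Hw_space 2 \<beta> \<and> \<rho>2 \<in> Hw_space 2 \<beta> \<and>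
     travelling_wave V \<mu> c (kappa \<mu> c n) \<rho>1 \<rho>2 \<and>
     even_ae \<rho>1 \<and> odd_ae \<rho>2 \<and>
     Hw_norm 2 \<beta> (\<lambda>x. \<sigma> x - \<rho>1 x) + Hw_norm 2 \<beta> \<rho>2 \<le> C / real n"

end

theory Submission
  imports Defs
begin

text \<open>
  Let \<open>\<omega> = 2 n \<pi>\<close>, \<open>g = V' \<circ> \<rho>\<^sub>1\<close> and \<open>W = V / (1 + \<mu>)\<close>. Since the symbol of \<open>\<delta>\<close> vanishes at \<open>\<omega>\<close>, the
  operator \<open>T = (\<partial>\<^sup>2 + \<omega>\<^sup>2)\<^sup>-\<^sup>1 \<delta>\<close> is convolution with a kernel of size \<open>1 / n\<close> supported in
  \<open>[-1/2, 1/2]\<close>, hence harmless for the weights, and the second equation forces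
  \<open>\<rho>\<^sub>2 = - T g / c\<^sup>2\<close>: the difference of the two sides is 1-periodic and decays. The first
  equation then reads \<open>c\<^sup>2 \<rho>\<^sub>1'' = \<delta>\<^sup>2 W'(\<rho>\<^sub>1) + \<mu> \<delta> T \<partial>\<^sup>2 W'(\<rho>\<^sub>1)\<close>. With \<open>\<rho>\<^sub>1 = \<sigma> + \<xi>\<close> it becomes
  \<open>\<H> \<xi> = \<delta>\<^sup>2 (W'(\<sigma> + \<xi>) - W'(\<sigma>) - W''(\<sigma>) \<xi>) + \<mu> \<delta> T \<partial>\<^sup>2 W'(\<sigma> + \<xi>)\<close>, and applying \<open>\<H>\<^sup>-\<^sup>1\<close> yields a
  contraction on a ball of radius \<open>O(1/n)\<close>.

  Completeness of the Sobolev space is not needed: the iterates converge pointwise and, by Fatou's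
  lemma, in the weighted \<open>L\<^sup>2\<close> norm; as \<open>T \<partial>\<^sup>2 = \<delta> - \<omega>\<^sup>2 T\<close>, the right-hand side is continuous
  in that norm, and \<open>\<H>\<^sup>-\<^sup>1\<close> lifts the convergence to \<open>H\<^sup>2\<close>.

  For smooth \<open>V\<close>, the bound \<open>T \<partial> = O(1)\<close> bootstraps \<open>\<rho>\<^sub>1\<close> to all orders uniformly in \<open>n\<close>, and
  \<open>T = (\<delta> - T \<partial>\<^sup>2) / \<omega>\<^sup>2\<close> trades derivatives for the factor \<open>1 / n\<^sup>2\<close>.
\<close>

section \<open>Smooth functions and test functions\<close>

text \<open>The orders balance as follows. T itself contributes only a factor 1/n, so T with two
  derivatives is small from H2 to L2; the inverse of \<H>, bounded from L2 to H2, restores exactly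
  these two derivatives. From L2 to L2 the same term has a constant of order n^2, harmless because
  that estimate is used only at fixed n. The Taylor remainder contracts with a factor proportional
  to the radius r, the T term with a factor 1/n; for r of order 1/n both are absorbed when n is
  large. Uniqueness is proved in the ball of radius C/n for every C, since passing between the given
  norms and the bounds used inside the proof changes the constant. Admissibility supplies only a
  homeomorphism; a linear bound for the inverse comes from its continuity at zero and rescaling.
  Norms rarely appear as numbers: what is propagated are statements that a norm is at most K, with K
  > 0 (\<open>L2_le\<close>, \<open>wl2\<close>, \<open>sob\<close>). Norms of fractional order are
  dominated by the next integer order, so only integer orders are estimated.\<close>

primrec Cd :: "nat \<Rightarrow> (real \<Rightarrow> real) \<Rightarrow> bool" where
  "Cd 0 f \<longleftrightarrow> continuous_on UNIV f"
| "Cd (Suc k) f \<longleftrightarrow> (\<exists>f'. (\<forall>x. (f has_real_derivative f' x) (at x)) \<and> Cd k f')"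

lemma Cd_continuous: "Cd k f \<Longrightarrow> continuous_on UNIV f"
  by (cases k) (auto intro!: continuous_at_imp_continuous_on intro: DERIV_isCont)

lemma Cd_SucI: "(\<And>x. (f has_real_derivative f' x) (at x)) \<Longrightarrow> Cd k f' \<Longrightarrow> Cd (Suc k) f"
  by auto

lemma Cd_SucD: "Cd (Suc k) f \<Longrightarrow> Cd k f"
proof (induction k arbitrary: f)
  case 0 then show ?case by (metis Cd.simps(1) Cd_continuous)
next
  case (Suc k) then show ?case by (metis Cd.simps(2))
qed

lemma Cd_mono: "Cd k f \<Longrightarrow> j \<le> k \<Longrightarrow> Cd j f"
proof (induction k)
  case (Suc k)
  then show ?case using Cd_SucD[of k f] by (auto simp del: Cd.simps simp: le_Suc_eq)
qed simp

lemma Cd_add: "Cd k f \<Longrightarrow> Cd k g \<Longrightarrow> Cd k (\<lambda>x. f x + g x)"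
proof (induction k arbitrary: f g)
  case 0 then show ?case by (simp add: continuous_on_add continuous_on_mult)
next
  case (Suc k)
  then obtain f' g' where "\<And>x. (f has_real_derivative f' x) (at x)" "Cd k f'"
      "\<And>x. (g has_real_derivative g' x) (at x)" "Cd k g'" by auto
  with Suc.IH show ?case by (auto intro!: exI[of _ "\<lambda>x. f' x + g' x"] derivative_eq_intros)
qed

lemma Cd_const: "Cd k (\<lambda>x. c)"
  by (induction k arbitrary: c) (auto intro!: exI[of _ "\<lambda>x. 0"] derivative_eq_intros)

lemma Cd_mult: "Cd k f \<Longrightarrow> Cd k g \<Longrightarrow> Cd k (\<lambda>x. f x * g x)"
proof (induction k arbitrary: f g)
  case 0 then show ?case by (simp add: continuous_on_add continuous_on_mult)
next
  case (Suc k)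
  then obtain f' g' where d: "\<And>x. (f has_real_derivative f' x) (at x)" "Cd k f'"
      "\<And>x. (g has_real_derivative g' x) (at x)" "Cd k g'" by auto
  have "Cd k (\<lambda>x. f' x * g x + f x * g' x)"
    using Suc.prems[THEN Cd_SucD] by (intro Cd_add Suc.IH d)
  moreover have "((\<lambda>x. f x * g x) has_real_derivative f' x * g x + f x * g' x) (at x)" for x
    using d by (auto intro!: derivative_eq_intros)
  ultimately show ?case by (intro Cd_SucI) auto
qed

lemma Cd_cmult: "Cd k f \<Longrightarrow> Cd k (\<lambda>x. c * f x)"
  using Cd_mult[OF Cd_const] .

lemma Cd_affine: "Cd k f \<Longrightarrow> Cd k (\<lambda>x. f (a * x + b))"
proof (induction k arbitrary: f)
  case 0
  then have "continuous_on UNIV f" by simp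
  then have "continuous_on UNIV (\<lambda>x. f (a * x + b))"
    by (rule continuous_on_compose2) (auto intro!: continuous_on_add continuous_on_mult)
  then show ?case by simp
next
  case (Suc k)
  then obtain f' where d: "\<And>x. (f has_real_derivative f' x) (at x)" "Cd k f'" by auto
  have "((\<lambda>x. f (a * x + b)) has_real_derivative a * f' (a * x + b)) (at x)" for x
    by (rule DERIV_cong[OF DERIV_chain2[OF d(1)]]) (auto intro!: derivative_eq_intros)
  then show ?case by (rule Cd_SucI) (intro Cd_cmult Suc.IH d)
qed

lemma C_k_Suc: "C_k (Suc k) f \<longleftrightarrow> (\<forall>x. f differentiable at x) \<and> C_k k (deriv f)"
  unfolding C_k_def by (auto simp: less_Suc_eq_0_disj funpow_Suc_right simp del: funpow.simps)

text \<open>Carrying the derivative as a witness lets inductions on the order run over arbitrary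
  functions without iterating \<open>deriv\<close>; this equivalence is the bridge back to the given
  definition.\<close>

lemma C_k_iff_Cd: "C_k k f \<longleftrightarrow> Cd k f"
proof (induction k arbitrary: f)
  case 0 show ?case by (simp add: C_k_def)
next
  case (Suc k)
  show ?case
  proof
    assume "C_k (Suc k) f"
    then show "Cd (Suc k) f" unfolding C_k_Suc
      by (auto simp: Suc[symmetric] intro!: exI[of _ "deriv f"] DERIV_deriv_iff_real_differentiable[THEN iffD2])
  next
    assume "Cd (Suc k) f"
    then obtain f' where d: "\<And>x. (f has_real_derivative f' x) (at x)" "Cd k f'" by auto
    have "deriv f = f'" using d by (auto intro: DERIV_imp_deriv)
    then show "C_k (Suc k) f" unfolding C_k_Suc using d
      by (auto simp: Suc real_differentiable_def)
  qed
qed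

lemma smooth_iff_Cd: "smooth f \<longleftrightarrow> (\<forall>k. Cd k f)"
  by (simp add: smooth_def C_k_iff_Cd)

section \<open>Bump functions built from the flat exponential\<close>

lemma power_div_fact_le_exp: "0 \<le> y \<Longrightarrow> y ^ k / fact k \<le> exp (y::real)"
proof -
  assume y: "0 \<le> y"
  have "(\<Sum>n\<in>{k}. y ^ n /\<^sub>R fact n) \<le> (\<Sum>n. y ^ n /\<^sub>R fact n)"
    by (rule sum_le_suminf) (use y summable_exp_generic[of y] in auto)
  then show ?thesis by (simp add: exp_def field_simps)
qed

text \<open>The classical function exp(-1/x), extended by zero, divided by powers of x. Those powers
  make the family closed under differentiation, so smoothness of all members follows from one
  induction on the order.\<close>

definition flat :: "nat \<Rightarrow> real \<Rightarrow> real" where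
  "flat n x = (if x \<le> 0 then 0 else exp (- 1 / x) / x ^ n)"

text \<open>A single term of the exponential series, taken at 1/x, beats the power in the
  denominator. The two spare powers of x give the derivative zero at the origin in
  \<open>flat_deriv\<close>.\<close>

lemma flat_bound: "\<bar>flat n x\<bar> \<le> fact (n + 2) * x\<^sup>2"
proof (cases "x \<le> 0")
  case False
  then have x: "x > 0" by simp
  have "(1 / x) ^ (n + 2) / fact (n + 2) \<le> exp (1 / x)"
    using x by (intro power_div_fact_le_exp) auto
  then have "exp (- (1 / x)) * ((1 / x) ^ (n + 2) / fact (n + 2)) \<le> exp (- (1 / x)) * exp (1 / x)"
    by (intro mult_left_mono) auto
  also have "\<dots> = 1" by (simp flip: exp_add)
  finally have "exp (- (1 / x)) \<le> fact (n + 2) * x ^ (n + 2)"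
    using x by (simp add: power_divide divide_simps mult_ac del: fact_Suc fact_2)
  then show ?thesis using x
    by (simp add: flat_def divide_simps power_add mult_ac power2_eq_square del: fact_Suc)
qed (simp add: flat_def)

lemma flat_deriv: "(flat n has_real_derivative flat (n + 2) x - n * flat (n + 1) x) (at x)"
proof -
  consider "x < 0" | "x = 0" | "x > 0" by linarith
  then show ?thesis
  proof cases
    case 1
    have "((\<lambda>x. 0) has_real_derivative 0) (at x)" by simp
    then have "(flat n has_real_derivative 0) (at x)"
      by (rule has_field_derivative_transform_within_open[of _ _ _ "{..<0}"])
         (use 1 in \<open>auto simp: flat_def\<close>)
    then show ?thesis using 1 by (simp add: flat_def)
  next
    case 2
    have "((\<lambda>h. flat n h / h) \<longlongrightarrow> 0) (at 0)"
    proof (rule Lim_null_comparison)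
      have "norm (flat n h / h) \<le> fact (n + 2) * \<bar>h\<bar>" for h
      proof (cases "h = 0")
        case False
        have "\<bar>flat n h\<bar> \<le> (fact (n + 2) * \<bar>h\<bar>) * \<bar>h\<bar>"
          using flat_bound[of n h] by (simp add: power2_eq_square mult.assoc del: fact_Suc)
        with False show ?thesis by (simp add: abs_divide pos_divide_le_eq del: fact_Suc)
      qed (simp del: fact_Suc)
      then show "\<forall>\<^sub>F h in at 0. norm (flat n h / h) \<le> fact (n + 2) * \<bar>h\<bar>"
        by (intro always_eventually allI)
      show "((\<lambda>h. fact (n + 2) * \<bar>h\<bar>) \<longlongrightarrow> (0::real)) (at 0)"
        by (auto intro!: tendsto_eq_intros)
    qed
    then show ?thesis using 2 by (simp add: has_field_derivative_iff flat_def)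
  next
    case 3
    have p: "real n * x ^ (n - 1) * x = real n * x ^ n" by (cases n) auto
    have "((\<lambda>x. exp (- 1 / x) / x ^ n) has_real_derivative
        (exp (- 1 / x) * (1 / x\<^sup>2) * x ^ n - exp (- 1 / x) * (real n * x ^ (n - 1))) / (x ^ n * x ^ n)) (at x)"
      using 3 by (auto intro!: derivative_eq_intros simp: power2_eq_square)
    also have "(exp (- 1 / x) * (1 / x\<^sup>2) * x ^ n - exp (- 1 / x) * (real n * x ^ (n - 1))) / (x ^ n * x ^ n)
        = exp (- 1 / x) * (x ^ n - (real n * x ^ (n - 1) * x) * x) / (x\<^sup>2 * (x ^ n * x ^ n))"
      using 3 by (simp add: field_simps power2_eq_square)
    also have "\<dots> = flat (n + 2) x - n * flat (n + 1) x"
      unfolding p using 3 by (simp add: flat_def field_simps power2_eq_square)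
    finally have "((\<lambda>x. exp (- 1 / x) / x ^ n) has_real_derivative flat (n + 2) x - n * flat (n + 1) x) (at x)" .
    then show ?thesis
      by (rule has_field_derivative_transform_within_open[of _ _ _ "{0<..}"])
         (use 3 in \<open>auto simp: flat_def\<close>)
  qed
qed

lemma Cd_flat: "Cd k (flat n)"
proof (induction k arbitrary: n)
  case 0
  show ?case using flat_deriv by (auto intro!: continuous_at_imp_continuous_on DERIV_isCont)
next
  case (Suc k)
  have "Cd k (\<lambda>x. flat (n + 2) x + (- real n) * flat (n + 1) x)"
    by (intro Cd_add Cd_cmult Suc)
  with flat_deriv[of n] show ?case by (intro Cd_SucI) auto
qed

text \<open>The factor \<open>k\<close> is a sharpness parameter: exp(-1/(k y)) tends to 1 for every
  y > 0, so large \<open>k\<close> turns the bump into the indicator of the open interval.\<close>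

definition bump :: "real \<Rightarrow> real \<Rightarrow> real \<Rightarrow> real \<Rightarrow> real" where
  "bump k a b x = flat 0 (k * (x - a)) * flat 0 (k * (b - x))"

lemma test_fun_bump: assumes "k > 0" shows "test_fun (bump k a b)"
proof -
  have "Cd j (bump k a b)" for j
  proof -
    have "Cd j (\<lambda>x. flat 0 (k * x + (- k * a)) * flat 0 ((- k) * x + k * b))"
      by (intro Cd_mult Cd_affine Cd_flat)
    then show ?thesis by (simp add: bump_def[abs_def] algebra_simps)
  qed
  moreover have "bump k a b x = 0" if "\<bar>x\<bar> > max \<bar>a\<bar> \<bar>b\<bar>" for x
  proof -
    have "x - a \<le> 0 \<or> b - x \<le> 0" using that by auto
    then have "k * (x - a) \<le> 0 \<or> k * (b - x) \<le> 0"
      using assms by (auto simp: mult_le_0_iff)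
    then show ?thesis by (auto simp: bump_def flat_def)
  qed
  ultimately show ?thesis unfolding test_fun_def smooth_iff_Cd by blast
qed

lemma bump_bounds: "0 \<le> bump k a b x" "bump k a b x \<le> 1"
proof -
  have *: "0 \<le> flat 0 y" "flat 0 y \<le> 1" for y by (auto simp: flat_def)
  show "0 \<le> bump k a b x" "bump k a b x \<le> 1" unfolding bump_def
    using * by (auto intro: mult_le_one)
qed

lemma bump_eq_0: "k > 0 \<Longrightarrow> x \<notin> {a<..<b} \<Longrightarrow> bump k a b x = 0"
  by (auto simp: bump_def flat_def not_less mult_le_0_iff zero_less_mult_iff)

lemma bump_tendsto: "(\<lambda>k. bump (Suc k) a b x) \<longlonglongrightarrow> indicator {a<..<b} x"
proof (cases "x \<in> {a<..<b}")
  case True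
  have *: "(\<lambda>k. flat 0 (real (Suc k) * y)) \<longlonglongrightarrow> 1" if "y > 0" for y :: real
  proof -
    have "(\<lambda>k. exp (- (1 / real (Suc k) * (1 / y)))) \<longlonglongrightarrow> exp (- (0 * (1 / y)))"
      by (intro tendsto_intros LIMSEQ_Suc[OF lim_1_over_n])
    moreover have "flat 0 (real (Suc k) * y) = exp (- (1 / real (Suc k) * (1 / y)))" for k
    proof -
      have "real (Suc k) * y > 0" using that by (intro mult_pos_pos) auto
      then show ?thesis unfolding flat_def by (simp del: of_nat_Suc)
    qed
    ultimately show ?thesis by simp
  qed
  show ?thesis unfolding bump_def
    using tendsto_mult[OF *[of "x - a"] *[of "b - x"]] True by simp
next
  case False
  then show ?thesis using bump_eq_0[of "Suc _" x a b] by simp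
qed

lemma test_fun_cmult_add:
  assumes "test_fun f" "test_fun g" shows "test_fun (\<lambda>x. f x + c * g x)"
proof -
  obtain R S where "\<And>x. \<bar>x\<bar> > R \<Longrightarrow> f x = 0" "\<And>x. \<bar>x\<bar> > S \<Longrightarrow> g x = 0"
    using assms unfolding test_fun_def by auto
  then have "\<forall>x. \<bar>x\<bar> > max R S \<longrightarrow> f x + c * g x = 0" by auto
  moreover have "smooth (\<lambda>x. f x + c * g x)"
    using assms unfolding test_fun_def smooth_iff_Cd by (auto intro!: Cd_add Cd_cmult)
  ultimately show ?thesis unfolding test_fun_def by blast
qed

section \<open>Indefinite integrals and weak derivatives\<close>

lemma loc_integrableD:
  assumes "loc_integrable f"
  shows "f \<in> borel_measurable borel" "set_integrable lborel {a..b} f"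
  using assms by (auto simp: loc_integrable_def)

lemma loc_integrable_add:
  assumes "loc_integrable f" "loc_integrable g" shows "loc_integrable (\<lambda>x. f x + g x)"
  using assms unfolding loc_integrable_def by auto

lemma loc_integrable_cmult:
  assumes "loc_integrable f" shows "loc_integrable (\<lambda>x. c * f x)"
  using assms unfolding loc_integrable_def by auto

lemma loc_integrable_diff:
  assumes "loc_integrable f" "loc_integrable g" shows "loc_integrable (\<lambda>x. f x - g x)"
  using loc_integrable_add[OF assms(1) loc_integrable_cmult[OF assms(2), of "-1"]] by simp

lemma loc_integrable_continuous:
  assumes "continuous_on UNIV f" shows "loc_integrable f"
proof -
  have "set_integrable lborel {a..b} f" for a b
    using borel_integrable_atLeastAtMost' continuous_on_subset[OF assms] by blast
  moreover have "f \<in> borel_measurable borel"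
    using assms by (rule borel_measurable_continuous_onI)
  ultimately show ?thesis by (simp add: loc_integrable_def)
qed

lemma loc_integrable_mult_continuous:
  assumes f: "continuous_on UNIV f" and g: "loc_integrable g"
  shows "loc_integrable (\<lambda>x. f x * g x)"
proof -
  note [measurable] = loc_integrableD(1)[OF g] borel_measurable_continuous_onI[OF f]
  have "set_integrable lborel {a..b} (\<lambda>x. f x * g x)" for a b
  proof -
    have "compact (f ` {a..b})"
      by (intro compact_continuous_image continuous_on_subset[OF f]) auto
    then obtain B where B: "\<And>x. x \<in> {a..b} \<Longrightarrow> \<bar>f x\<bar> \<le> B"
      using compact_imp_bounded bounded_iff by (metis imageI real_norm_def)
    have "set_integrable lborel {a..b} (\<lambda>x. B * g x)"
      using loc_integrableD(2)[OF g] by auto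
    then show ?thesis
    proof (rule set_integrable_bound)
      have "norm (f x * g x) \<le> norm (B * g x)" if "x \<in> {a..b}" for x
        using B[OF that] by (auto simp: abs_mult intro!: mult_right_mono)
      then show "AE x in lborel. x \<in> {a..b} \<longrightarrow> norm (f x * g x) \<le> norm (B * g x)" by auto
    qed (simp add: set_borel_measurable_def)
  qed
  then show ?thesis by (auto simp: loc_integrable_def)
qed

lemma loc_integrable_cong_AE:
  assumes "loc_integrable g" "g' \<in> borel_measurable borel" "ae_eq g g'"
  shows "loc_integrable g'"
proof -
  note [measurable] = loc_integrableD(1)[OF assms(1)] assms(2)
  have "set_integrable lborel {a..b} g \<longleftrightarrow> set_integrable lborel {a..b} g'" for a b
    by (rule set_integrable_cong_AE) (use assms(3) in auto)
  with assms show ?thesis by (auto simp: loc_integrable_def)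
qed

lemma loc_integrable_compact_support:
  assumes h: "loc_integrable h" and supp: "\<And>x. \<bar>x\<bar> > R \<Longrightarrow> h x = 0"
  shows "integrable lborel h" "(LINT x|lborel. h x) = (LINT x:{-R..R}|lborel. h x)"
proof -
  have *: "(\<lambda>x. indicator {-R..R} x *\<^sub>R h x) = h"
    using supp by (force simp: fun_eq_iff indicator_def)
  show "integrable lborel h" using loc_integrableD(2)[OF h, of "-R" R]
    unfolding set_integrable_def * .
  show "(LINT x|lborel. h x) = (LINT x:{-R..R}|lborel. h x)"
    unfolding set_lebesgue_integral_def * ..
qed

text \<open>Compact intervals form an intersection-stable generator of the Borel sets, and the sets
  over which a fixed integrable function integrates to zero form a Dynkin system. Truncation to
  [-N, N] supplies the integrability.\<close>

lemma AE_zero_of_interval_integrals: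
  assumes h: "loc_integrable h"
    and 0: "\<And>a b. a \<le> b \<Longrightarrow> (LINT x:{a..b}|lborel. h x) = 0"
  shows "AE x in lborel. h x = 0"
proof -
  note [measurable] = loc_integrableD(1)[OF h]
  have "AE x in lborel. indicator {- real N..real N} x * h x = 0" for N :: nat
  proof -
    let ?g = "\<lambda>x. indicator {- real N..real N} x * h x"
    have int: "integrable lborel ?g"
      using loc_integrableD(2)[OF h, of "-real N" "real N"] by (simp add: set_integrable_def)
    have set_int: "set_integrable lborel A ?g" if "A \<in> sets borel" for A
      unfolding set_integrable_def by (rule integrable_mult_indicator) (use that int in auto)
    have I: "(LINT x:{a..b}|lborel. ?g x) = 0" for a b
    proof -
      have "(LINT x:{a..b}|lborel. ?g x) = (LINT x:{max a (-real N)..min b (real N)}|lborel. h x)"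
        unfolding set_lebesgue_integral_def
        by (rule Bochner_Integration.integral_cong) (auto simp: indicator_def)
      also have "\<dots> = 0"
        using 0[of "max a (-real N)" "min b (real N)"]
        by (cases "max a (-real N) \<le> min b (real N)") (auto simp: set_lebesgue_integral_def)
      finally show ?thesis .
    qed
    have "(LINT x:A|lborel. ?g x) = 0" if "A \<in> sets lborel" for A
    proof -
      let ?G = "range (\<lambda>(a,b). {a..b} :: real set)"
      have "Int_stable ?G" by (auto simp: Int_stable_def)
      moreover have "?G \<subseteq> Pow UNIV" by auto
      moreover have "A \<in> sigma_sets UNIV ?G"
        using that unfolding sets_lborel borel_eq_atLeastAtMost by simp
      ultimately show ?thesis
      proof (induction rule: sigma_sets_induct_disjoint)
        case (basic A) then show ?case using I by auto
      next
        case empty show ?case by (simp add: set_lebesgue_integral_def)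
      next
        case (compl A)
        then have A: "A \<in> sets borel" unfolding borel_eq_atLeastAtMost by simp
        have "(LINT x:A \<union> (UNIV - A)|lborel. ?g x) = (LINT x:A|lborel. ?g x) + (LINT x:UNIV - A|lborel. ?g x)"
          by (rule set_integral_Un) (use A set_int in auto)
        moreover have "(LINT x:A \<union> (UNIV - A)|lborel. ?g x) = (LINT x:{-real N..real N}|lborel. ?g x)"
          unfolding set_lebesgue_integral_def
          by (rule Bochner_Integration.integral_cong) (auto simp: indicator_def)
        ultimately show ?case using compl I by simp
      next
        case (union A)
        then have A: "\<And>i. A i \<in> sets borel" unfolding borel_eq_atLeastAtMost by auto
        have "(LINT x:(\<Union>i. A i)|lborel. ?g x) = (\<Sum>i. (LINT x:(A i)|lborel. ?g x))"
          by (rule lebesgue_integral_countable_add)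
             (use A union.hyps set_int in \<open>auto simp: disjoint_family_on_def\<close>)
        then show ?case using union by simp
      qed
    qed
    then show ?thesis using sigma_finite_measure.density_zero[OF lborel.sigma_finite_measure_axioms int] by simp
  qed
  then have "AE x in lborel. \<forall>N::nat. indicator {- real N..real N} x * h x = 0"
    unfolding AE_all_countable by blast
  then show ?thesis
  proof (rule AE_mp, intro AE_I2 impI)
    fix x :: real assume *: "\<forall>N::nat. indicator {- real N..real N} x * h x = 0"
    obtain N :: nat where "\<bar>x\<bar> \<le> real N" using real_arch_simple by blast
    with *[rule_format, of N] show "h x = 0" by (simp add: indicator_def abs_le_iff split: if_splits)
  qed
qed

text \<open>Local absolute continuity with density \<open>g\<close>, read through the fundamental
  theorem of calculus for the Lebesgue integral. The density matters only almost everywhere, while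
  \<open>f\<close> is a genuine continuous function.\<close>

definition ac :: "(real \<Rightarrow> real) \<Rightarrow> (real \<Rightarrow> real) \<Rightarrow> bool" where
  "ac f g \<longleftrightarrow> loc_integrable g \<and> (\<forall>a b. a \<le> b \<longrightarrow> f b - f a = (LINT x:{a..b}|lborel. g x))"

lemma acD: assumes "ac f g"
  shows "loc_integrable g" "a \<le> b \<Longrightarrow> f b - f a = (LINT x:{a..b}|lborel. g x)"
    "g integrable_on {a..b}" "a \<le> b \<Longrightarrow> f b = f a + integral {a..b} g"
  using assms set_borel_integral_eq_integral[OF loc_integrableD(2)[of g a b]]
  by (auto simp: ac_def algebra_simps)

lemma ac_continuous: assumes "ac f g" shows "continuous_on UNIV f"
proof -
  have "isCont f x" for x
  proof -
    have "continuous_on {x-1..x+1} (\<lambda>y. f (x-1) + integral {x-1..y} g)"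
      by (intro continuous_intros indefinite_integral_continuous_1 acD[OF assms])
    then have "continuous_on {x-1..x+1} f"
      by (rule continuous_on_eq) (use acD(4)[OF assms] in auto)
    then have "continuous_on {x-1<..<x+1} f" by (rule continuous_on_subset) auto
    then show ?thesis by (subst (asm) continuous_on_eq_continuous_at) auto
  qed
  then show ?thesis by (simp add: continuous_at_imp_continuous_on)
qed

lemma ac_DERIV: assumes "ac f g" "continuous_on UNIV g" shows "(f has_real_derivative g x) (at x)"
proof -
  have "((\<lambda>y. integral {x-1..y} g) has_real_derivative g x) (at x within {x-1..x+1})"
    by (rule integral_has_real_derivative) (auto intro: continuous_on_subset[OF assms(2)])
  then have "((\<lambda>y. integral {x-1..y} g) has_real_derivative g x) (at x)"
    by (simp add: at_within_Icc_at)
  then have D: "((\<lambda>y. f (x-1) + integral {x-1..y} g) has_real_derivative g x) (at x)"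
    by (auto intro!: derivative_eq_intros)
  have E: "f (x-1) + integral {x-1..y} g = f y" if "y \<in> {x-1<..<x+1}" for y
    by (rule acD(4)[OF assms(1), symmetric]) (use that in auto)
  show ?thesis
    by (rule has_field_derivative_transform_within_open[OF D, of "{x-1<..<x+1}"]) (auto intro: E)
qed

lemma DERIV_ac:
  assumes "\<And>x. (f has_real_derivative g x) (at x)" "continuous_on UNIV g" shows "ac f g"
proof -
  have "f b - f a = (LINT x:{a..b}|lborel. g x)" if "a \<le> b" for a b
    unfolding set_lebesgue_integral_def
    by (rule integral_FTC_atLeastAtMost[symmetric, OF that])
       (use assms in \<open>auto simp: has_real_derivative_iff_has_vector_derivative
          intro: has_vector_derivative_at_within continuous_on_subset\<close>)
  then show ?thesis unfolding ac_def using loc_integrable_continuous[OF assms(2)] by auto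
qed

lemma ac_cong_AE:
  assumes "ac f g" "g' \<in> borel_measurable borel" "ae_eq g g'" shows "ac f g'"
proof -
  note [measurable] = loc_integrableD(1)[OF acD(1)[OF assms(1)]] assms(2)
  have "(LINT x:{a..b}|lborel. g x) = (LINT x:{a..b}|lborel. g' x)" for a b
    by (rule set_lebesgue_integral_cong_AE) (use assms(3) in auto)
  with assms loc_integrable_cong_AE[OF acD(1)[OF assms(1)] assms(2,3)]
  show ?thesis by (auto simp: ac_def)
qed

lemma ac_add: assumes "ac f f'" "ac g g'" shows "ac (\<lambda>x. f x + g x) (\<lambda>x. f' x + g' x)"
proof -
  have "(LINT x:{a..b}|lborel. f' x + g' x) = (f b + g b) - (f a + g a)" if "a \<le> b" for a b
    using acD(2)[OF assms(1) that] acD(2)[OF assms(2) that]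
    by (subst set_integral_add) (auto intro: loc_integrableD acD assms)
  then show ?thesis using assms by (auto simp: ac_def loc_integrable_add)
qed

lemma ac_cmult: assumes "ac f f'" shows "ac (\<lambda>x. c * f x) (\<lambda>x. c * f' x)"
  using assms by (auto simp: ac_def loc_integrable_cmult simp flip: right_diff_distrib)

lemma ac_diff: assumes "ac f f'" "ac g g'" shows "ac (\<lambda>x. f x - g x) (\<lambda>x. f' x - g' x)"
  using ac_add[OF assms(1) ac_cmult[OF assms(2), of "-1"]] by simp

lemma ac_const: "ac (\<lambda>x. c) (\<lambda>x. 0)"
  by (rule DERIV_ac) auto

lemma ac_shift: assumes "ac f g" shows "ac (\<lambda>x. f (x + t)) (\<lambda>x. g (x + t))"
proof -
  have *: "indicator {a..b} x *\<^sub>R g (x + t) = indicator {a+t..b+t} (t + 1 * x) *\<^sub>R g (t + 1 * x)" for a b x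
    by (auto simp: indicator_def add.commute)
  have S: "set_integrable lborel {a..b} (\<lambda>x. g (x + t))" for a b
    unfolding set_integrable_def *
    by (subst lborel_integrable_real_affine_iff)
       (use loc_integrableD(2)[OF acD(1)[OF assms]] in \<open>auto simp: set_integrable_def\<close>)
  have I: "(LINT x:{a..b}|lborel. g (x + t)) = (LINT x:{a+t..b+t}|lborel. g x)" for a b
    unfolding set_lebesgue_integral_def *
    by (subst (2) lborel_integral_real_affine[of 1 _ t]) auto
  note [measurable] = loc_integrableD(1)[OF acD(1)[OF assms]]
  show ?thesis unfolding ac_def loc_integrable_def
    using S I acD(2)[OF assms] by auto
qed

lemma ac_exists: assumes "loc_integrable g" shows "\<exists>G. ac G g"
proof -
  define G where "G x = (if 0 \<le> x then integral {0..x} g else - integral {x..0} g)" for x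
  have i: "g integrable_on {a..b}" for a b
    using set_borel_integral_eq_integral(1)[OF loc_integrableD(2)[OF assms]] .
  have "G b - G a = (LINT x:{a..b}|lborel. g x)" if "a \<le> b" for a b
  proof -
    have "G b - G a = integral {a..b} g"
    proof -
      consider "0 \<le> a" | "b < 0" | "a < 0" "0 \<le> b" using that by linarith
      then show ?thesis
      proof cases
        case 1
        then show ?thesis using Henstock_Kurzweil_Integration.integral_combine[OF 1 that i] that by (simp add: G_def)
      next
        case 2
        then show ?thesis using Henstock_Kurzweil_Integration.integral_combine[OF that _ i, of 0] that by (simp add: G_def)
      next
        case 3
        then show ?thesis using Henstock_Kurzweil_Integration.integral_combine[OF _ _ i, of a 0 b] by (simp add: G_def)
      qed
    qed
    then show ?thesis
      using set_borel_integral_eq_integral(2)[OF loc_integrableD(2)[OF assms]] by simp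
  qed
  then show ?thesis using assms by (auto simp: ac_def)
qed

lemma ac_unique: assumes "ac f g" "ac f g'" shows "ae_eq g g'"
proof -
  have "AE x in lborel. g x - g' x = 0"
  proof (rule AE_zero_of_interval_integrals)
    show "loc_integrable (\<lambda>x. g x - g' x)" using acD(1)[OF assms(1)] acD(1)[OF assms(2)]
      by (rule loc_integrable_diff)
    show "(LINT x:{a..b}|lborel. g x - g' x) = 0" if "a \<le> b" for a b
      using acD(2)[OF assms(1) that] acD(2)[OF assms(2) that]
      by (subst set_integral_diff)
        (auto intro: loc_integrableD acD(1)[OF assms(1)] acD(1)[OF assms(2)])
  qed
  then show ?thesis by simp
qed


text \<open>Integrate \<open>f' x * g' y\<close> over the triangle \<open>a \<le> x \<le> y \<le> b\<close> in both orders.\<close>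

lemma ac_mult:
  assumes f: "ac f f'" and g: "ac g g'"
  shows "ac (\<lambda>x. f x * g x) (\<lambda>x. f' x * g x + f x * g' x)"
proof -
  have lf: "loc_integrable f'" and lg: "loc_integrable g'" using acD(1) f g by auto
  note [measurable] = loc_integrableD(1)[OF lf] loc_integrableD(1)[OF lg]
  have cf: "continuous_on UNIV f" and cg: "continuous_on UNIV g" using ac_continuous f g by auto
  have l1: "loc_integrable (\<lambda>x. f' x * g x)"
    using loc_integrable_mult_continuous[OF cg lf] by (simp add: mult.commute)
  have l2: "loc_integrable (\<lambda>x. f x * g' x)"
    by (rule loc_integrable_mult_continuous[OF cf lg])
  have "f b * g b - f a * g a = (LINT x:{a..b}|lborel. f' x * g x + f x * g' x)" if ab: "a \<le> b" for a b
  proof -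
    define F where "F x = indicator {a..b} x * f' x" for x
    define G where "G x = indicator {a..b} x * g' x" for x
    have [measurable]: "F \<in> borel_measurable borel" "G \<in> borel_measurable borel"
      by (auto simp: F_def[abs_def] G_def[abs_def])
    have iF: "integrable lborel F" and iG: "integrable lborel G"
      using loc_integrableD(2)[OF lf, of a b] loc_integrableD(2)[OF lg, of a b]
      by (auto simp: set_integrable_def F_def[abs_def] G_def[abs_def])
    have FF: "integral\<^sup>L lborel F = f b - f a" and GG: "integral\<^sup>L lborel G = g b - g a"
      using acD(2)[OF f ab] acD(2)[OF g ab]
      by (auto simp: set_lebesgue_integral_def F_def[abs_def] G_def[abs_def])
    have int: "integrable (lborel \<Otimes>\<^sub>M lborel) (\<lambda>(x, y). F x * G y * indicator {p. fst p \<le> snd p} (x, y))"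
    proof (rule lborel_pair.Fubini_integrable)
      have "(\<lambda>p. F (fst p) * G (snd p) * indicator {p. fst p \<le> snd p} p) \<in> borel_measurable (borel \<Otimes>\<^sub>M borel)"
        by measurable
      then show "(\<lambda>(x, y). F x * G y * indicator {p. fst p \<le> snd p} (x, y)) \<in> borel_measurable (lborel \<Otimes>\<^sub>M lborel)"
        by (simp add: case_prod_beta')
      have le0: "integrable lborel (\<lambda>y. F x * G y * indicator {p. fst p \<le> snd p} (x, y))" for x
      proof (rule Bochner_Integration.integrable_bound[of _ "\<lambda>y. F x * G y"])
        show "(\<lambda>y. F x * G y * indicator {p. fst p \<le> snd p} (x, y)) \<in> borel_measurable lborel"
          by (simp add: indicator_def)
      qed (use iG in \<open>auto simp: indicator_def\<close>)
      then have le: "integrable lborel (\<lambda>y. norm (F x * G y * indicator {p. fst p \<le> snd p} (x, y)))" for x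
        by (rule integrable_norm)
      show "AE x in lborel. integrable lborel (\<lambda>y. case (x, y) of (x, y) \<Rightarrow> F x * G y * indicator {p. fst p \<le> snd p} (x, y))"
        using le0 by simp
      show "integrable lborel (\<lambda>x. LINT y|lborel. norm (case (x, y) of (x, y) \<Rightarrow> F x * G y * indicator {p. fst p \<le> snd p} (x, y)))"
      proof (rule Bochner_Integration.integrable_bound[of _ "\<lambda>x. F x * (LINT y|lborel. norm (G y))"])
        show "integrable lborel (\<lambda>x. F x * (LINT y|lborel. norm (G y)))" using iF by simp
        have "(\<lambda>p. norm (F (fst p) * G (snd p) * indicator {p. fst p \<le> snd p} p)) \<in> borel_measurable (borel \<Otimes>\<^sub>M lborel)"
          by measurable
        from lborel.borel_measurable_lebesgue_integral[of "\<lambda>x y. norm (F x * G y * indicator {p. fst p \<le> snd p} (x, y))" borel]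
        show "(\<lambda>x. LINT y|lborel. norm (case (x, y) of (x, y) \<Rightarrow> F x * G y * indicator {p. fst p \<le> snd p} (x, y)))
            \<in> borel_measurable lborel"
          using \<open>_ \<in> borel_measurable (borel \<Otimes>\<^sub>M lborel)\<close> by (simp add: case_prod_beta')
        have "(LINT y|lborel. norm (F x * G y * indicator {p. fst p \<le> snd p} (x, y))) \<le>
            (LINT y|lborel. norm (F x) * norm (G y))" for x
          by (rule integral_mono) (use le iG in \<open>auto simp: indicator_def abs_mult\<close>)
        then show "AE x in lborel. norm (LINT y|lborel. norm (case (x, y) of (x, y) \<Rightarrow> F x * G y * indicator {p. fst p \<le> snd p} (x, y)))
            \<le> norm (F x * (LINT y|lborel. norm (G y)))"
          by (simp add: abs_mult)
      qed
    qed
    have "(LINT y|lborel. LINT x|lborel. F x * G y * indicator {p. fst p \<le> snd p} (x, y)) =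
        (LINT x|lborel. LINT y|lborel. F x * G y * indicator {p. fst p \<le> snd p} (x, y))"
      using lborel_pair.Fubini_integral[OF int] .
    moreover have "(LINT x|lborel. F x * G y * indicator {p. fst p \<le> snd p} (x, y)) =
        indicator {a..b} y * (f y * g' y) - f a * G y" for y
    proof (cases "y \<in> {a..b}")
      case True
      have "(LINT x|lborel. F x * G y * indicator {p. fst p \<le> snd p} (x, y)) = (LINT x|lborel. G y * (indicator {a..y} x * f' x))"
        by (rule Bochner_Integration.integral_cong) (use True in \<open>auto simp: F_def indicator_def\<close>)
      also have "\<dots> = G y * (f y - f a)"
        using acD(2)[OF f, of a y] True by (simp add: set_lebesgue_integral_def)
      finally show ?thesis using True by (simp add: G_def algebra_simps)
    qed (simp add: G_def)
    moreover have "(LINT y|lborel. F x * G y * indicator {p. fst p \<le> snd p} (x, y)) =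
        g b * F x - indicator {a..b} x * (f' x * g x)" for x
    proof (cases "x \<in> {a..b}")
      case True
      have "(LINT y|lborel. F x * G y * indicator {p. fst p \<le> snd p} (x, y)) = (LINT y|lborel. F x * (indicator {x..b} y * g' y))"
        by (rule Bochner_Integration.integral_cong) (use True in \<open>auto simp: G_def indicator_def\<close>)
      also have "\<dots> = F x * (g b - g x)"
        using acD(2)[OF g, of x b] True by (simp add: set_lebesgue_integral_def)
      finally show ?thesis using True by (simp add: F_def algebra_simps)
    qed (simp add: F_def)
    ultimately have "(LINT y|lborel. indicator {a..b} y * (f y * g' y) - f a * G y) =
        (LINT x|lborel. g b * F x - indicator {a..b} x * (f' x * g x))"
      by simp
    moreover have "(LINT y|lborel. indicator {a..b} y * (f y * g' y) - f a * G y) =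
        (LINT y:{a..b}|lborel. f y * g' y) - f a * (g b - g a)"
      using loc_integrableD(2)[OF l2, of a b] iG GG
      by (subst Bochner_Integration.integral_diff) (auto simp: set_integrable_def set_lebesgue_integral_def)
    moreover have "(LINT x|lborel. g b * F x - indicator {a..b} x * (f' x * g x)) =
        g b * (f b - f a) - (LINT y:{a..b}|lborel. f' y * g y)"
      using loc_integrableD(2)[OF l1, of a b] iF FF
      by (subst Bochner_Integration.integral_diff) (auto simp: set_integrable_def set_lebesgue_integral_def)
    moreover have "(LINT x:{a..b}|lborel. f' x * g x + f x * g' x) =
        (LINT y:{a..b}|lborel. f' y * g y) + (LINT y:{a..b}|lborel. f y * g' y)"
      by (intro set_integral_add loc_integrableD l1 l2)
    ultimately show ?thesis by (simp add: algebra_simps)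
  qed
  then show ?thesis using loc_integrable_add[OF l1 l2] by (auto simp: ac_def)
qed

section \<open>Weak derivatives and the du Bois-Reymond lemma\<close>

lemma test_fun_loc_integrable_mult:
  assumes "loc_integrable h" "test_fun \<phi>"
  shows "loc_integrable (\<lambda>x. h x * \<phi> x)" "integrable lborel (\<lambda>x. h x * \<phi> x)"
proof -
  have "continuous_on UNIV \<phi>" using assms(2) Cd_continuous unfolding test_fun_def smooth_iff_Cd by blast
  from loc_integrable_mult_continuous[OF this assms(1)]
  show *: "loc_integrable (\<lambda>x. h x * \<phi> x)" by (simp add: mult.commute)
  obtain R where "\<And>x. \<bar>x\<bar> > R \<Longrightarrow> \<phi> x = 0" using assms(2) unfolding test_fun_def by auto
  then show "integrable lborel (\<lambda>x. h x * \<phi> x)"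
    by (intro loc_integrable_compact_support[OF *, of R]) auto
qed

lemma test_fun_deriv:
  assumes "test_fun \<phi>"
  shows "test_fun (deriv \<phi>)" "(\<phi> has_real_derivative deriv \<phi> x) (at x)" "continuous_on UNIV (deriv \<phi>)"
proof -
  have S: "C_k k \<phi>" for k using assms unfolding test_fun_def smooth_def by blast
  have C: "C_k k (deriv \<phi>)" for k using S[of "Suc k"] C_k_Suc by blast
  show D: "(\<phi> has_real_derivative deriv \<phi> x) (at x)" for x
    using S[of 1] by (simp add: C_k_def DERIV_deriv_iff_real_differentiable)
  obtain R where R: "\<And>x. \<bar>x\<bar> > R \<Longrightarrow> \<phi> x = 0" using assms unfolding test_fun_def by auto
  have "deriv \<phi> x = 0" if "\<bar>x\<bar> > R" for x
  proof -
    have "((\<lambda>_. 0) has_real_derivative deriv \<phi> x) (at x)"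
      by (rule has_field_derivative_transform_within_open[OF D, of "{x. \<bar>x\<bar> > R}"])
         (use that R in \<open>auto intro!: open_Collect_less continuous_intros\<close>)
    then show ?thesis using DERIV_const[of 0 "at x"] DERIV_unique by blast
  qed
  then show "test_fun (deriv \<phi>)" unfolding test_fun_def smooth_def using C by blast
  show "continuous_on UNIV (deriv \<phi>)" using C[of 0] by (simp add: C_k_def)
qed

lemma test_fun_iterated_deriv: "test_fun \<phi> \<Longrightarrow> test_fun ((deriv ^^ k) \<phi>)"
  by (induction k) (auto intro: test_fun_deriv)

lemma ac_integral_by_parts:
  assumes "ac u v" "test_fun \<phi>"
  shows "(LINT x|lborel. u x * deriv \<phi> x) = - (LINT x|lborel. v x * \<phi> x)"
proof -
  obtain R where R: "\<And>x. \<bar>x\<bar> > R \<Longrightarrow> \<phi> x = 0" using assms unfolding test_fun_def by auto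
  define S where "S = \<bar>R\<bar> + 1"
  have a: "ac (\<lambda>x. u x * \<phi> x) (\<lambda>x. v x * \<phi> x + u x * deriv \<phi> x)"
    by (intro ac_mult assms DERIV_ac test_fun_deriv)
  have t: "test_fun (deriv \<phi>)" using assms test_fun_deriv by blast
  obtain R' where R': "\<And>x. \<bar>x\<bar> > R' \<Longrightarrow> deriv \<phi> x = 0" using t unfolding test_fun_def by auto
  \<comment> \<open>Beyond \<open>T\<close> both \<phi> and its derivative vanish, so the integral
    reduces to [-T, T] and the boundary terms there are zero.\<close>
  define T where "T = max (\<bar>R\<bar> + 1) R'"
  have i1: "integrable lborel (\<lambda>x. v x * \<phi> x)"
    using test_fun_loc_integrable_mult acD(1) assms by blast
  have i2: "integrable lborel (\<lambda>x. u x * deriv \<phi> x)"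
    using test_fun_loc_integrable_mult[OF loc_integrable_continuous t] ac_continuous assms by blast
  have "(LINT x|lborel. v x * \<phi> x) + (LINT x|lborel. u x * deriv \<phi> x) =
      (LINT x|lborel. v x * \<phi> x + u x * deriv \<phi> x)"
    using i1 i2 by simp
  also have "\<dots> = (LINT x:{-T..T}|lborel. v x * \<phi> x + u x * deriv \<phi> x)"
    by (rule loc_integrable_compact_support(2)[OF acD(1)[OF a]]) (use R R' in \<open>auto simp: T_def\<close>)
  also have "\<dots> = u T * \<phi> T - u (-T) * \<phi> (-T)"
    by (rule acD(2)[OF a, symmetric]) (auto simp: T_def)
  also have "\<dots> = 0" using R[of T] R[of "-T"] by (auto simp: T_def)
  finally show ?thesis by simp
qed

lemma has_weak_deriv_ac:
  assumes "ac u v" "has_weak_deriv k v g"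
  shows "has_weak_deriv (Suc k) u g"
proof -
  have "(LINT x|lborel. u x * (deriv ^^ Suc k) \<phi> x) = (-1) ^ Suc k * (LINT x|lborel. g x * \<phi> x)"
    if "test_fun \<phi>" for \<phi>
    using ac_integral_by_parts[OF assms(1) test_fun_iterated_deriv[OF that, of k]]
      assms(2) that by (auto simp: has_weak_deriv_def)
  then show ?thesis using assms loc_integrable_continuous ac_continuous
    unfolding has_weak_deriv_def by blast
qed

lemma has_weak_deriv_0: "loc_integrable f \<Longrightarrow> has_weak_deriv 0 f f"
  by (simp add: has_weak_deriv_def)

lemma has_weak_deriv_cong_AE:
  assumes "has_weak_deriv k f g" "f' \<in> borel_measurable borel" "g' \<in> borel_measurable borel"
    "ae_eq f f'" "ae_eq g g'"
  shows "has_weak_deriv k f' g'"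
proof -
  have l: "loc_integrable f" "loc_integrable g" using assms by (auto simp: has_weak_deriv_def)
  have l': "loc_integrable f'" "loc_integrable g'" using loc_integrable_cong_AE l assms by blast+
  note [measurable] = loc_integrableD(1)[OF l(1)] loc_integrableD(1)[OF l(2)] assms(2,3)
  have "(LINT x|lborel. f' x * (deriv ^^ k) \<phi> x) = (- 1) ^ k * (LINT x|lborel. g' x * \<phi> x)" if t: "test_fun \<phi>" for \<phi>
  proof -
    have [measurable]: "\<psi> \<in> borel_measurable borel" if "test_fun \<psi>" for \<psi>
      using that Cd_continuous unfolding test_fun_def smooth_iff_Cd
      by (blast intro: borel_measurable_continuous_onI)
    have [measurable]: "\<phi> \<in> borel_measurable borel" "(deriv ^^ k) \<phi> \<in> borel_measurable borel"
      using t test_fun_iterated_deriv by auto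
    have "(LINT x|lborel. f' x * (deriv ^^ k) \<phi> x) = (LINT x|lborel. f x * (deriv ^^ k) \<phi> x)"
      by (rule integral_cong_AE) (use assms(4) in auto)
    moreover have "(LINT x|lborel. g' x * \<phi> x) = (LINT x|lborel. g x * \<phi> x)"
      by (rule integral_cong_AE) (use assms(5) in auto)
    ultimately show ?thesis using assms(1) t by (simp add: has_weak_deriv_def)
  qed
  with l' show ?thesis by (simp add: has_weak_deriv_def)
qed

text \<open>Bumps converge pointwise to the indicator of (a, b) and stay below that of [a, b], so
  dominated convergence transfers the vanishing from test functions to intervals.\<close>

lemma AE_zero_of_test_integrals:
  assumes h: "loc_integrable h"
    and 0: "\<And>\<eta>. test_fun \<eta> \<Longrightarrow> (LINT x|lborel. h x * \<eta> x) = 0"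
  shows "AE x in lborel. h x = 0"
proof (rule AE_zero_of_interval_integrals[OF h])
  fix a b :: real assume "a \<le> b"
  note [measurable] = loc_integrableD(1)[OF h]
  have [measurable]: "bump (real (Suc k)) a b \<in> borel_measurable borel" for k
    using test_fun_bump[of "real (Suc k)" a b] Cd_continuous
    unfolding test_fun_def smooth_iff_Cd by (auto intro!: borel_measurable_continuous_onI)
  have "(\<lambda>k. LINT x|lborel. h x * bump (real (Suc k)) a b x) \<longlonglongrightarrow>
      (LINT x|lborel. h x * indicator {a<..<b} x)"
  proof (rule integral_dominated_convergence)
    show "integrable lborel (\<lambda>x. indicator {a..b} x * \<bar>h x\<bar>)"
      using set_integrable_abs[OF loc_integrableD(2)[OF h, of a b]]
      by (simp add: set_integrable_def)
    show "AE x in lborel. (\<lambda>k. h x * bump (real (Suc k)) a b x) \<longlonglongrightarrow> h x * indicator {a<..<b} x"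
      by (intro AE_I2 tendsto_mult_left bump_tendsto)
    show "AE x in lborel. norm (h x * bump (real (Suc k)) a b x) \<le> indicator {a..b} x * \<bar>h x\<bar>" for k
    proof (intro AE_I2)
      fix x show "norm (h x * bump (real (Suc k)) a b x) \<le> indicator {a..b} x * \<bar>h x\<bar>"
      proof (cases "x \<in> {a<..<b}")
        case True
        then show ?thesis using bump_bounds[of "real (Suc k)" a b x]
          by (auto simp: abs_mult mult_left_le simp del: of_nat_Suc)
      next
        case False
        then show ?thesis using bump_eq_0[of "real (Suc k)" x a b] by simp
      qed
    qed
  qed measurable
  moreover have "(LINT x|lborel. h x * bump (real (Suc k)) a b x) = 0" for k
    by (rule 0, rule test_fun_bump) simp
  ultimately have "(LINT x|lborel. h x * indicator {a<..<b} x) = 0"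
    by (simp add: LIMSEQ_const_iff)
  moreover have "(LINT x|lborel. h x * indicator {a<..<b} x) = (LINT x:{a..b}|lborel. h x)"
    unfolding set_lebesgue_integral_def
  proof (rule integral_cong_AE)
    have "AE x in lborel. x \<noteq> a \<and> x \<noteq> b"
      using AE_lborel_singleton[of a] AE_lborel_singleton[of b] by eventually_elim auto
    then show "AE x in lborel. h x * indicator {a<..<b} x = indicator {a..b} x *\<^sub>R h x"
      by eventually_elim (auto simp: indicator_def)
  qed measurable
  ultimately show "(LINT x:{a..b}|lborel. h x) = 0" by simp
qed

lemma test_fun_continuous: "test_fun \<phi> \<Longrightarrow> continuous_on UNIV \<phi>"
  using Cd_continuous unfolding test_fun_def smooth_iff_Cd by blast

lemma test_fun_integrable: "test_fun \<phi> \<Longrightarrow> integrable lborel \<phi>"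
  using test_fun_loc_integrable_mult(2)[of "\<lambda>_. 1" \<phi>] loc_integrable_continuous[of "\<lambda>_. 1"] by simp

text \<open>The antiderivative that vanishes to the left of the support is constant to its right,
  with the total integral as value; zero mean is what keeps it compactly supported.\<close>

lemma test_fun_antiderivative:
  assumes t: "test_fun \<psi>" and 0: "(LINT x|lborel. \<psi> x) = 0"
  obtains \<phi> where "test_fun \<phi>" "deriv \<phi> = \<psi>"
proof -
  note c = test_fun_continuous[OF t]
  obtain F where F: "ac F \<psi>" using ac_exists[OF loc_integrable_continuous[OF c]] by blast
  obtain R where R: "\<And>x. \<bar>x\<bar> > R \<Longrightarrow> \<psi> x = 0" using t unfolding test_fun_def by auto
  define S where "S = \<bar>R\<bar> + 1"
  define \<phi> where "\<phi> x = F x - F (-S)" for x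
  have D: "(\<phi> has_real_derivative \<psi> x) (at x)" for x
    unfolding \<phi>_def[abs_def] using ac_DERIV[OF F c] by (auto intro!: derivative_eq_intros)
  have "Cd k \<phi>" for k
    using t D Cd_SucI[of \<phi> \<psi>] Cd_SucD unfolding test_fun_def smooth_iff_Cd by blast
  moreover have "\<phi> x = 0" if "\<bar>x\<bar> > S" for x
  proof (cases "x < 0")
    case True
    then have x: "x \<le> - S" using that by simp
    have "F (-S) - F x = (LINT y:{x..-S}|lborel. \<psi> y)" by (rule acD(2)[OF F x])
    also have "\<dots> = (LINT y:{x..-S}|lborel. 0)"
      by (rule set_lebesgue_integral_cong) (use R in \<open>auto simp: S_def\<close>)
    finally show ?thesis by (simp add: \<phi>_def)
  next
    case False
    then have x: "S < x" using that by simp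
    then have "- S \<le> x" by (auto simp: S_def)
    then have "F x - F (-S) = (LINT y:{-S..x}|lborel. \<psi> y)" by (rule acD(2)[OF F])
    also have "\<dots> = (LINT y|lborel. \<psi> y)"
      unfolding set_lebesgue_integral_def
      by (rule Bochner_Integration.integral_cong) (use R x in \<open>force simp: S_def indicator_def\<close>)+
    finally show ?thesis using 0 by (simp add: \<phi>_def)
  qed
  ultimately have "test_fun \<phi>" unfolding test_fun_def smooth_iff_Cd by blast
  moreover have "deriv \<phi> = \<psi>" using D by (auto intro: DERIV_imp_deriv)
  ultimately show ?thesis using that by blast
qed

text \<open>A test function minus the multiple of a fixed bump \<theta> with the same mean is the
  derivative of a test function. This forces \<open>h\<close> to be the quotient of the integrals of
  h \<theta> and \<theta>.\<close>

lemma du_Bois_Reymond: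
  assumes h: "loc_integrable h"
    and 0: "\<And>\<phi>. test_fun \<phi> \<Longrightarrow> (LINT x|lborel. h x * deriv \<phi> x) = 0"
  shows "\<exists>c. AE x in lborel. h x = c"
proof -
  define \<theta> where "\<theta> = bump 1 0 1"
  have t: "test_fun \<theta>" unfolding \<theta>_def by (rule test_fun_bump) simp
  define I where "I = (LINT x|lborel. \<theta> x)"
  have "I \<noteq> 0"
  proof
    assume "I = 0"
    then have "AE x in lborel. \<theta> x = 0"
      using integral_nonneg_eq_0_iff_AE[OF test_fun_integrable[OF t]] bump_bounds
      by (simp add: I_def \<theta>_def)
    moreover have "\<theta> x \<noteq> 0" if "x \<in> {0<..<1}" for x
      using that by (auto simp: \<theta>_def bump_def flat_def)
    ultimately have "AE x in lborel. x \<notin> {0<..<1::real}" by (auto elim: eventually_mono)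
    then have "emeasure lborel {0<..<1::real} = 0"
      by (subst (asm) AE_iff_measurable[of "{0<..<1}"]) auto
    then show False by simp
  qed
  define c where "c = (LINT x|lborel. h x * \<theta> x) / I"
  have "AE x in lborel. h x - c = 0"
  proof (rule AE_zero_of_test_integrals)
    show l: "loc_integrable (\<lambda>x. h x - c)"
      by (intro loc_integrable_diff h loc_integrable_continuous continuous_intros)
    fix \<eta> assume x: "test_fun \<eta>"
    define J where "J = (LINT x|lborel. \<eta> x)"
    have "test_fun (\<lambda>x. \<eta> x + (- J / I) * \<theta> x)" by (rule test_fun_cmult_add[OF x t])
    moreover have "(LINT z|lborel. \<eta> z + (- J / I) * \<theta> z) = 0"
      using test_fun_integrable[OF x] test_fun_integrable[OF t] \<open>I \<noteq> 0\<close>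
      by (subst Bochner_Integration.integral_add) (auto simp: I_def J_def)
    ultimately obtain \<phi> where "test_fun \<phi>" "deriv \<phi> = (\<lambda>x. \<eta> x + (- J / I) * \<theta> x)"
      by (rule test_fun_antiderivative)
    then have "(LINT x|lborel. h x * (\<eta> x + (- J / I) * \<theta> x)) = 0" using 0 by metis
    moreover have "(LINT x|lborel. h x * (\<eta> x + (- J / I) * \<theta> x)) =
        (LINT x|lborel. h x * \<eta> x + (- J / I) * (h x * \<theta> x))"
      by (simp add: algebra_simps)
    moreover have "\<dots> = (LINT x|lborel. h x * \<eta> x) + (- J / I) * (LINT x|lborel. h x * \<theta> x)"
      using test_fun_loc_integrable_mult[OF h x] test_fun_loc_integrable_mult[OF h t]
      by (subst Bochner_Integration.integral_add) auto
    ultimately have "(LINT x|lborel. h x * \<eta> x) = J * c" by (simp add: c_def)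
    moreover have "(LINT x|lborel. (h x - c) * \<eta> x) = (LINT x|lborel. h x * \<eta> x) - c * J"
      using test_fun_loc_integrable_mult[OF h x] test_fun_integrable[OF x]
      by (simp add: J_def left_diff_distrib)
    ultimately show "(LINT x|lborel. (h x - c) * \<eta> x) = 0" by simp
  qed
  then show ?thesis by auto
qed

lemma has_weak_deriv_unique:
  assumes "has_weak_deriv k f g" "has_weak_deriv k f g'" shows "ae_eq g g'"
proof -
  have l: "loc_integrable g" "loc_integrable g'" using assms by (auto simp: has_weak_deriv_def)
  have "AE x in lborel. g x - g' x = 0"
  proof (rule AE_zero_of_test_integrals)
    fix \<eta> assume x: "test_fun \<eta>"
    have "(-1) ^ k * (LINT x|lborel. g x * \<eta> x) = (-1) ^ k * (LINT x|lborel. g' x * \<eta> x)"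
      using assms x unfolding has_weak_deriv_def by metis
    then show "(LINT x|lborel. (g x - g' x) * \<eta> x) = 0"
      using test_fun_loc_integrable_mult[OF l(1) x] test_fun_loc_integrable_mult[OF l(2) x]
      by (simp add: left_diff_distrib)
  qed (intro loc_integrable_diff l)
  then show ?thesis by simp
qed

text \<open>An antiderivative \<open>G\<close> of \<open>g\<close> has the same weak derivative as
  \<open>f\<close>, so f - G is almost everywhere constant; adding that constant to \<open>G\<close>
  gives the continuous representative.\<close>

lemma has_weak_deriv_1_ac:
  assumes "has_weak_deriv 1 f g" obtains u where "ae_eq f u" "ac u g"
proof -
  have l: "loc_integrable f" "loc_integrable g" using assms by (auto simp: has_weak_deriv_def)
  obtain G where G: "ac G g" using ac_exists[OF l(2)] by blast
  have lG: "loc_integrable G" using loc_integrable_continuous ac_continuous G by blast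
  have "\<exists>c. AE x in lborel. f x - G x = c"
  proof (rule du_Bois_Reymond)
    fix \<phi> assume t: "test_fun \<phi>"
    have "(LINT x|lborel. f x * deriv \<phi> x) = (LINT x|lborel. G x * deriv \<phi> x)"
      using ac_integral_by_parts[OF G t] assms t by (simp add: has_weak_deriv_def)
    then show "(LINT x|lborel. (f x - G x) * deriv \<phi> x) = 0"
      using test_fun_loc_integrable_mult[OF l(1) test_fun_deriv(1)[OF t]]
        test_fun_loc_integrable_mult[OF lG test_fun_deriv(1)[OF t]]
      by (simp add: left_diff_distrib)
  qed (intro loc_integrable_diff l lG)
  then obtain c where c: "AE x in lborel. f x - G x = c" by blast
  show ?thesis
  proof (rule that)
    show "ae_eq f (\<lambda>x. G x + c)" using c by eventually_elim auto
    show "ac (\<lambda>x. G x + c) g" using ac_add[OF G ac_const, of c] by simp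
  qed
qed

text \<open>The set where two continuous functions differ is open, and a nonempty open set is not
  null.\<close>

lemma continuous_AE_eq_imp_eq:
  fixes f g :: "real \<Rightarrow> real"
  assumes "continuous_on UNIV f" "continuous_on UNIV g" "ae_eq f g"
  shows "f = g"
proof (rule ext, rule ccontr)
  fix x assume "f x \<noteq> g x"
  have "open {x. f x \<noteq> g x}" by (rule open_Collect_neq[OF assms(1,2)])
  then obtain e where e: "e > 0" "ball x e \<subseteq> {x. f x \<noteq> g x}"
    using \<open>f x \<noteq> g x\<close> openE by blast
  have "AE y in lborel. y \<notin> ball x e" using assms(3) e by (auto elim!: eventually_mono)
  then have "emeasure lborel (ball x e) = 0"
    by (subst (asm) AE_iff_measurable[of "ball x e"]) auto
  then show False using e by (simp add: ball_eq_greaterThanLessThan)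
qed

section \<open>Weighted square-integrable functions\<close>

text \<open>The strict bound \<open>0 < K\<close> lets estimates be divided by \<open>K\<close> without a case distinction.\<close>

definition L2_le :: "real \<Rightarrow> (real \<Rightarrow> real) \<Rightarrow> bool" where
  "L2_le K f \<longleftrightarrow> 0 < K \<and> f \<in> borel_measurable borel \<and> (\<integral>\<^sup>+x. ennreal ((f x)\<^sup>2) \<partial>lborel) \<le> ennreal (K\<^sup>2)"

lemma L2_leD: "L2_le K f \<Longrightarrow> f \<in> borel_measurable borel" "L2_le K f \<Longrightarrow> 0 < K"
  "L2_le K f \<Longrightarrow> (\<integral>\<^sup>+x. ennreal ((f x)\<^sup>2) \<partial>lborel) \<le> ennreal (K\<^sup>2)"
  by (auto simp: L2_le_def)

lemma L2_le_iff: "L2_le K f \<longleftrightarrow> 0 < K \<and> f \<in> L2 \<and> (LINT x|lborel. (f x)\<^sup>2) \<le> K\<^sup>2"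
proof (cases "0 < K \<and> f \<in> borel_measurable borel")
  case True
  then have [measurable]: "f \<in> borel_measurable borel" by simp
  have "(\<integral>\<^sup>+x. ennreal ((f x)\<^sup>2) \<partial>lborel) \<le> ennreal (K\<^sup>2) \<longleftrightarrow>
      integrable lborel (\<lambda>x. (f x)\<^sup>2) \<and> (LINT x|lborel. (f x)\<^sup>2) \<le> K\<^sup>2"
  proof
    assume *: "(\<integral>\<^sup>+x. ennreal ((f x)\<^sup>2) \<partial>lborel) \<le> ennreal (K\<^sup>2)"
    have i: "integrable lborel (\<lambda>x. (f x)\<^sup>2)"
      by (rule integrableI_nonneg) (use * in \<open>auto intro: le_less_trans\<close>)
    then have "ennreal (LINT x|lborel. (f x)\<^sup>2) \<le> ennreal (K\<^sup>2)"
      using * by (subst nn_integral_eq_integral[symmetric]) auto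
    then show "integrable lborel (\<lambda>x. (f x)\<^sup>2) \<and> (LINT x|lborel. (f x)\<^sup>2) \<le> K\<^sup>2"
      using i by (simp add: ennreal_le_iff)
  next
    assume "integrable lborel (\<lambda>x. (f x)\<^sup>2) \<and> (LINT x|lborel. (f x)\<^sup>2) \<le> K\<^sup>2"
    then show "(\<integral>\<^sup>+x. ennreal ((f x)\<^sup>2) \<partial>lborel) \<le> ennreal (K\<^sup>2)"
      by (subst nn_integral_eq_integral) (auto simp: ennreal_leI)
  qed
  with True show ?thesis by (auto simp: L2_le_def L2_def)
qed (auto simp: L2_le_def L2_def)

lemma L2_le_bound:
  assumes "L2_le K f" "g \<in> borel_measurable borel" "AE x in lborel. \<bar>g x\<bar> \<le> C * \<bar>f x\<bar>" "0 < C"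
  shows "L2_le (C * K) g"
proof -
  note [measurable] = L2_leD(1)[OF assms(1)] assms(2)
  have "(\<integral>\<^sup>+x. ennreal ((g x)\<^sup>2) \<partial>lborel) \<le> (\<integral>\<^sup>+x. ennreal (C\<^sup>2) * ennreal ((f x)\<^sup>2) \<partial>lborel)"
  proof (rule nn_integral_mono_AE)
    show "AE x in lborel. ennreal ((g x)\<^sup>2) \<le> ennreal (C\<^sup>2) * ennreal ((f x)\<^sup>2)"
      using assms(3)
    proof eventually_elim
      case (elim x)
      have "\<bar>g x\<bar>\<^sup>2 \<le> (C * \<bar>f x\<bar>)\<^sup>2" by (rule power_mono[OF elim]) simp
      then show ?case by (simp add: power_mult_distrib ennreal_mult[symmetric] ennreal_leI)
    qed
  qed
  also have "\<dots> = ennreal (C\<^sup>2) * (\<integral>\<^sup>+x. ennreal ((f x)\<^sup>2) \<partial>lborel)"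
    by (rule nn_integral_cmult) auto
  also have "\<dots> \<le> ennreal (C\<^sup>2) * ennreal (K\<^sup>2)"
    by (intro mult_left_mono L2_leD[OF assms(1)]) auto
  finally show ?thesis using assms L2_leD(2)[OF assms(1)]
    by (simp add: L2_le_def power_mult_distrib ennreal_mult)
qed

lemma L2_le_mono: "L2_le K f \<Longrightarrow> K \<le> K' \<Longrightarrow> L2_le K' f"
  unfolding L2_le_def by (auto intro: order_trans ennreal_leI power_mono)

lemma L2_le_cong_AE: "L2_le K f \<Longrightarrow> g \<in> borel_measurable borel \<Longrightarrow> ae_eq f g \<Longrightarrow> L2_le K g"
  using L2_le_bound[of K f g 1] eventually_mono[of "\<lambda>x. f x = g x" _ "\<lambda>x. \<bar>g x\<bar> \<le> 1 * \<bar>f x\<bar>"] by simp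

text \<open>Minkowski's inequality. The weights 1 + L/K and 1 + K/L in the pointwise Young
  inequality are the optimal ones: applied to K^2 and L^2 they add up to exactly (K + L)^2.\<close>

lemma L2_le_add:
  assumes "L2_le K f" "L2_le L g" shows "L2_le (K + L) (\<lambda>x. f x + g x)"
proof -
  note [measurable] = L2_leD(1)[OF assms(1)] L2_leD(1)[OF assms(2)]
  have K: "K > 0" "L > 0" using assms by (auto simp: L2_le_def)
  have "(\<integral>\<^sup>+x. ennreal ((f x + g x)\<^sup>2) \<partial>lborel) \<le>
     (\<integral>\<^sup>+x. ennreal (1 + L / K) * ennreal ((f x)\<^sup>2) + ennreal (1 + K / L) * ennreal ((g x)\<^sup>2) \<partial>lborel)"
  proof (rule nn_integral_mono)
    fix x
    have "0 \<le> (L * f x - K * g x)\<^sup>2 / (K * L)" using K by simp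
    also have "\<dots> = (1 + L / K) * (f x)\<^sup>2 + (1 + K / L) * (g x)\<^sup>2 - (f x + g x)\<^sup>2"
      using K by (simp add: field_simps power2_eq_square)
    finally show "ennreal ((f x + g x)\<^sup>2) \<le> ennreal (1 + L / K) * ennreal ((f x)\<^sup>2) + ennreal (1 + K / L) * ennreal ((g x)\<^sup>2)"
      using K by (simp add: ennreal_mult[symmetric] ennreal_plus[symmetric] ennreal_leI del: ennreal_plus)
  qed
  also have "\<dots> = ennreal (1 + L / K) * (\<integral>\<^sup>+x. ennreal ((f x)\<^sup>2) \<partial>lborel) + ennreal (1 + K / L) * (\<integral>\<^sup>+x. ennreal ((g x)\<^sup>2) \<partial>lborel)"
    by (subst nn_integral_add) (auto simp: nn_integral_cmult)
  also have "\<dots> \<le> ennreal (1 + L / K) * ennreal (K\<^sup>2) + ennreal (1 + K / L) * ennreal (L\<^sup>2)"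
    by (intro add_mono mult_left_mono L2_leD assms) auto
  also have "\<dots> = ennreal ((1 + L / K) * K\<^sup>2 + (1 + K / L) * L\<^sup>2)"
    using K by (simp add: ennreal_mult[symmetric] ennreal_plus[symmetric] del: ennreal_plus)
  also have "(1 + L / K) * K\<^sup>2 + (1 + K / L) * L\<^sup>2 = (K + L)\<^sup>2"
    using K by (simp add: field_simps power2_eq_square)
  finally show ?thesis using K by (simp add: L2_le_def)
qed

lemma L2_le_shift: assumes "L2_le K f" shows "L2_le K (\<lambda>x. f (x + t))"
proof -
  note [measurable] = L2_leD(1)[OF assms]
  have "(\<integral>\<^sup>+x. ennreal ((f x)\<^sup>2) \<partial>lborel) = (\<integral>\<^sup>+x. ennreal ((f (x + t))\<^sup>2) \<partial>lborel)"
    using nn_integral_real_affine[of "\<lambda>x. ennreal ((f x)\<^sup>2)" 1 t] by (simp add: add.commute)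
  then show ?thesis using assms by (simp add: L2_le_def)
qed

lemma L2_le_liminf:
  assumes "\<And>k. L2_le K (f k)" "\<And>x. (\<lambda>k. f k x) \<longlonglongrightarrow> g x"
  shows "L2_le K g"
proof -
  note [measurable] = L2_leD(1)[OF assms(1)]
  have [measurable]: "g \<in> borel_measurable borel"
    by (rule borel_measurable_LIMSEQ_real[OF assms(2)]) auto
  have "(\<integral>\<^sup>+x. ennreal ((g x)\<^sup>2) \<partial>lborel) = (\<integral>\<^sup>+x. liminf (\<lambda>k. ennreal ((f k x)\<^sup>2)) \<partial>lborel)"
  proof (rule nn_integral_cong)
    fix x
    have "(\<lambda>k. ennreal ((f k x)\<^sup>2)) \<longlonglongrightarrow> ennreal ((g x)\<^sup>2)"
      by (intro tendsto_ennrealI tendsto_intros assms)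
    then show "ennreal ((g x)\<^sup>2) = liminf (\<lambda>k. ennreal ((f k x)\<^sup>2))"
      by (rule lim_imp_Liminf[symmetric, rotated]) simp
  qed
  also have "\<dots> \<le> liminf (\<lambda>k. \<integral>\<^sup>+x. ennreal ((f k x)\<^sup>2) \<partial>lborel)"
    by (rule nn_integral_liminf) auto
  also have "\<dots> \<le> ennreal (K\<^sup>2)"
    by (rule Liminf_le) (use L2_leD(3)[OF assms(1)] in auto)
  finally show ?thesis using L2_leD(2)[OF assms(1)] by (auto simp: L2_le_def)
qed

lemma L2_loc_integrable: assumes "f \<in> L2" shows "loc_integrable f"
proof -
  have [measurable]: "f \<in> borel_measurable borel" using assms by (simp add: L2_def)
  have "set_integrable lborel {a..b} f" for a b
    unfolding set_integrable_def
  proof (rule Bochner_Integration.integrable_bound)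
    show "integrable lborel (\<lambda>x. indicator {a..b} x + (f x)\<^sup>2)"
      using assms integrable_real_indicator[of "{a..b}" lborel]
      by (intro Bochner_Integration.integrable_add) (auto simp: L2_def emeasure_lborel_Icc_eq)
    have "\<bar>f x\<bar> \<le> 1 + (f x)\<^sup>2" for x
      using zero_le_power2[of "\<bar>f x\<bar> - 1/2"] by (simp add: power2_diff power_divide)
    then show "AE x in lborel. norm (indicator {a..b} x *\<^sub>R f x) \<le> norm (indicator {a..b} x + (f x)\<^sup>2)"
      by (auto simp: indicator_def)
  qed auto
  then show ?thesis by (simp add: loc_integrable_def)
qed

lemma L2_le_loc_integrable: "L2_le K f \<Longrightarrow> loc_integrable f"
  using L2_le_iff L2_loc_integrable by blast

text \<open>Cauchy-Schwarz against the constant one, obtained from the nonnegative integral of (h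
  |f| - c)^2, where c is the integral of |f|.\<close>

lemma L2_interval_average:
  assumes f: "f \<in> L2" and h: "0 < h"
  shows "(LINT t:{a..a+h}|lborel. \<bar>f t\<bar>)\<^sup>2 \<le> h * (LINT t:{a..a+h}|lborel. (f t)\<^sup>2)"
proof -
  have l: "set_integrable lborel {a..a+h} f" using loc_integrableD(2)[OF L2_loc_integrable[OF f]] .
  have [measurable]: "f \<in> borel_measurable borel" using f by (simp add: L2_def)
  define c where "c = (LINT t:{a..a+h}|lborel. \<bar>f t\<bar>)"
  have i1: "set_integrable lborel {a..a+h} (\<lambda>t. (f t)\<^sup>2)"
    unfolding set_integrable_def by (rule integrable_mult_indicator) (use f in \<open>auto simp: L2_def\<close>)
  have i2: "set_integrable lborel {a..a+h} (\<lambda>t. \<bar>f t\<bar>)" by (rule set_integrable_abs[OF l])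
  have i3: "set_integrable lborel {a..a+h} (\<lambda>t. c\<^sup>2)" by (rule borel_integrable_atLeastAtMost') simp
  have "0 \<le> (LINT t:{a..a+h}|lborel. (h * \<bar>f t\<bar> - c)\<^sup>2)"
    unfolding set_lebesgue_integral_def by (rule integral_nonneg_AE) auto
  also have "\<dots> = (LINT t:{a..a+h}|lborel. (h\<^sup>2 * (f t)\<^sup>2 - (2 * h * c) * \<bar>f t\<bar>) + c\<^sup>2)"
    by (intro set_lebesgue_integral_cong) (auto simp: power2_diff power_mult_distrib mult_ac)
  also have "\<dots> = (LINT t:{a..a+h}|lborel. h\<^sup>2 * (f t)\<^sup>2 - (2 * h * c) * \<bar>f t\<bar>) + (LINT t:{a..a+h}|lborel. c\<^sup>2)"
    by (intro set_integral_add set_integral_diff set_integrable_mult_right i1 i2 i3)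
  also have "(LINT t:{a..a+h}|lborel. h\<^sup>2 * (f t)\<^sup>2 - (2 * h * c) * \<bar>f t\<bar>) =
      (LINT t:{a..a+h}|lborel. h\<^sup>2 * (f t)\<^sup>2) - (LINT t:{a..a+h}|lborel. (2 * h * c) * \<bar>f t\<bar>)"
    by (intro set_integral_diff set_integrable_mult_right i1 i2)
  also have "(LINT t:{a..a+h}|lborel. (2 * h * c) * \<bar>f t\<bar>) = (2 * h * c) * c"
    by (simp only: set_integral_mult_right c_def)
  also have "(LINT t:{a..a+h}|lborel. h\<^sup>2 * (f t)\<^sup>2) = h\<^sup>2 * (LINT t:{a..a+h}|lborel. (f t)\<^sup>2)"
    by (rule set_integral_mult_right)
  also have "(LINT t:{a..a+h}|lborel. c\<^sup>2) = h * c\<^sup>2"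
    using h by (simp add: set_lebesgue_integral_def)
  finally have "0 \<le> h * (h * (LINT t:{a..a+h}|lborel. (f t)\<^sup>2) - c\<^sup>2)"
    by (simp add: power2_eq_square algebra_simps)
  then show ?thesis using h by (simp add: zero_le_mult_iff c_def)
qed

lemma L2_unit_interval_average:
  "f \<in> L2 \<Longrightarrow> (LINT t:{a..a+1}|lborel. \<bar>f t\<bar>)\<^sup>2 \<le> (LINT t:{a..a+1}|lborel. (f t)\<^sup>2)"
  using L2_interval_average[of f 1 a] by simp

section \<open>The weights and weighted L2 bounds\<close>

definition wt :: "real \<Rightarrow> real \<Rightarrow> real" where "wt b x = cosh x powr b"

lemma wt_pos [simp]: "0 < wt b x" by (simp add: wt_def)
lemma wt_nonneg [simp]: "0 \<le> wt b x" by (simp add: wt_def)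
lemma wt_nonzero [simp]: "wt b x \<noteq> 0" by (simp add: wt_def)
lemma wt_0 [simp]: "wt 0 x = 1" by (simp add: wt_def)
lemma wt_add: "wt (a + b) x = wt a x * wt b x" by (simp add: wt_def powr_add)
lemma wt_uminus: "wt (- b) x * wt b x = 1" using wt_add[of "-b" b x] by simp
lemma wt_ge_1: "0 \<le> b \<Longrightarrow> 1 \<le> wt b x" by (simp add: wt_def cosh_real_ge_1 ge_one_powr_ge_zero)

lemma wt_DERIV: "(wt b has_real_derivative wt b x * (b * tanh x)) (at x)"
proof -
  have "((\<lambda>x. cosh x powr b) has_real_derivative b * cosh x powr (b - 1) * sinh x) (at x)"
    by (auto intro!: derivative_eq_intros)
  also have "b * cosh x powr (b - 1) * sinh x = wt b x * (b * tanh x)"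
    by (simp add: wt_def powr_diff tanh_def)
  finally show ?thesis by (simp add: wt_def[abs_def])
qed

lemma wt_continuous: "continuous_on A (wt b)"
  by (intro continuous_at_imp_continuous_on ballI DERIV_isCont[OF wt_DERIV])

lemma wt_measurable [measurable]: "wt b \<in> borel_measurable borel"
  by (rule borel_measurable_continuous_onI[OF wt_continuous])

lemma tanh_bounds: "\<bar>tanh x\<bar> \<le> (1::real)"
  using tanh_real_lt_1[of x] tanh_real_gt_neg1[of x] by simp

text \<open>The addition theorem gives cosh x <= cosh (x + t) exp |t|. Hence operators of range at
  most one, such as \<delta> and convolution over a short window, cost only the factor exp b in
  weighted norms.\<close>

lemma wt_shift:
  assumes "0 \<le> b" "\<bar>t\<bar> \<le> 1" shows "wt b x \<le> exp b * wt b (x + t)"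
proof -
  have "cosh x = cosh (x + t) * cosh t - sinh (x + t) * sinh t"
    using cosh_diff[of "x + t" t] by simp
  also have "\<dots> \<le> cosh (x + t) * cosh t + cosh (x + t) * \<bar>sinh t\<bar>"
  proof -
    have "\<bar>sinh y\<bar> \<le> cosh y" for y :: real
      using sinh_le_cosh_real[of y] sinh_le_cosh_real[of "- y"] by (simp add: abs_le_iff)
    then have "\<bar>sinh (x + t)\<bar> * \<bar>sinh t\<bar> \<le> cosh (x + t) * \<bar>sinh t\<bar>"
      by (rule mult_right_mono) simp
    then show ?thesis using abs_ge_minus_self[of "sinh (x + t) * sinh t"] by (simp add: abs_mult)
  qed
  also have "\<dots> = cosh (x + t) * exp \<bar>t\<bar>"
    using cosh_plus_sinh[of "\<bar>t\<bar>"] by (simp flip: distrib_left add: sinh_real_abs)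
  also have "\<dots> \<le> cosh (x + t) * exp 1"
    using assms by (intro mult_left_mono) auto
  finally have "cosh x powr b \<le> (cosh (x + t) * exp 1) powr b"
    using assms by (intro powr_mono2) auto
  then show ?thesis by (simp add: wt_def powr_mult exp_powr_real mult_ac)
qed

lemma wt_tendsto: assumes "0 < b" shows "filterlim (wt b) at_top at_top"
proof -
  have "filterlim (\<lambda>x. b * ln (cosh x :: real)) at_top at_top"
    by (rule filterlim_tendsto_pos_mult_at_top[OF tendsto_const assms
          filterlim_compose[OF ln_at_top cosh_real_at_top]])
  then have "filterlim (\<lambda>x. exp (b * ln (cosh x :: real))) at_top at_top"
    by (rule filterlim_compose[OF exp_at_top])
  then show ?thesis by (simp add: wt_def[abs_def] powr_def)
qed

text \<open>Since cosh x >= exp |x| / 2, the squared inverse weight is dominated by a two-sided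
  exponential, which is integrated on each half line.\<close>

lemma wt_neg_L2: assumes "0 < b" shows "wt (- b) \<in> L2"
proof -
  have *: "(wt (-b) x)\<^sup>2 \<le> 2 powr (2*b) * exp (- (2*b) * \<bar>x\<bar>)" for x
  proof -
    have "exp \<bar>x\<bar> / 2 \<le> cosh \<bar>x\<bar>" by (simp add: cosh_field_def)
    then have "exp \<bar>x\<bar> / 2 \<le> cosh x" by simp
    then have "cosh x powr (-(2*b)) \<le> (exp \<bar>x\<bar> / 2) powr (-(2*b))"
      using assms by (intro powr_mono2') auto
    also have "\<dots> = 2 powr (2*b) * exp (- (2*b) * \<bar>x\<bar>)"
      by (simp add: powr_divide powr_minus exp_powr_real exp_minus field_simps)
    also have "cosh x powr (-(2*b)) = (wt (-b) x)\<^sup>2"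
      by (simp add: wt_def power2_eq_square flip: powr_add)
    finally show ?thesis .
  qed
  have lim: "((\<lambda>x. - exp (- (2*b) * x) / (2*b)) \<longlongrightarrow> - 0 / (2*b)) at_top"
  proof (intro tendsto_intros)
    have "filterlim (\<lambda>x. (2*b) * x) at_top at_top"
      using assms by (intro filterlim_tendsto_pos_mult_at_top[OF tendsto_const _ filterlim_ident]) auto
    then have "filterlim (\<lambda>x. - (2*b) * x) at_bot at_top"
      by (simp add: filterlim_uminus_at_bot)
    then show "((\<lambda>x. exp (- (2*b) * x)) \<longlongrightarrow> 0) at_top"
      by (rule filterlim_compose[OF exp_at_bot])
  qed (use assms in auto)
  have half: "(\<integral>\<^sup>+x. ennreal (exp (- (2*b) * x)) * indicator {0..} x \<partial>lborel) < \<infinity>"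
    using assms by (subst nn_integral_FTC_atLeast[OF _ _ _ lim]) (auto intro!: derivative_eq_intros)
  have "(\<integral>\<^sup>+x. ennreal ((wt (-b) x)\<^sup>2) \<partial>lborel) \<le>
      (\<integral>\<^sup>+x. ennreal (2 powr (2*b)) * (ennreal (exp (- (2*b) * x)) * indicator {0..} x
         + ennreal (exp (- (2*b) * (-x))) * indicator {0..} (-x)) \<partial>lborel)"
  proof (rule nn_integral_mono)
    fix x
    have "ennreal ((wt (-b) x)\<^sup>2) \<le> ennreal (2 powr (2*b)) * ennreal (exp (- (2*b) * \<bar>x\<bar>))"
      using * by (simp add: ennreal_mult[symmetric] ennreal_leI)
    also have "\<dots> \<le> ennreal (2 powr (2*b)) * (ennreal (exp (- (2*b) * x)) * indicator {0..} x
         + ennreal (exp (- (2*b) * (-x))) * indicator {0..} (-x))"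
      by (intro mult_left_mono) (auto simp: indicator_def)
    finally show "ennreal ((wt (-b) x)\<^sup>2) \<le> ennreal (2 powr (2*b)) * (ennreal (exp (- (2*b) * x)) * indicator {0..} x
         + ennreal (exp (- (2*b) * (-x))) * indicator {0..} (-x))" .
  qed
  also have "\<dots> = ennreal (2 powr (2*b)) * ((\<integral>\<^sup>+x. ennreal (exp (- (2*b) * x)) * indicator {0..} x \<partial>lborel)
      + (\<integral>\<^sup>+x. ennreal (exp (- (2*b) * (-x))) * indicator {0..} (-x) \<partial>lborel))"
    by (simp add: nn_integral_cmult nn_integral_add)
  also have "(\<integral>\<^sup>+x. ennreal (exp (- (2*b) * (-x))) * indicator {0..} (-x) \<partial>lborel) =
      (\<integral>\<^sup>+x. ennreal (exp (- (2*b) * x)) * indicator {0..} x \<partial>lborel)"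
    using nn_integral_real_affine[of "\<lambda>x. ennreal (exp (- (2*b) * x)) * indicator {0..} x" "-1" 0] by simp
  also have "ennreal (2 powr (2*b)) * ((\<integral>\<^sup>+x. ennreal (exp (- (2*b) * x)) * indicator {0..} x \<partial>lborel)
      + (\<integral>\<^sup>+x. ennreal (exp (- (2*b) * x)) * indicator {0..} x \<partial>lborel)) < \<infinity>"
    using half by (simp add: ennreal_mult_less_top)
  finally have "integrable lborel (\<lambda>x. (wt (-b) x)\<^sup>2)"
    by (intro integrableI_nonneg) auto
  then show ?thesis by (simp add: L2_def)
qed

definition wl2 :: "real \<Rightarrow> real \<Rightarrow> (real \<Rightarrow> real) \<Rightarrow> bool" where
  "wl2 b K f \<longleftrightarrow> L2_le K (\<lambda>x. wt b x * f x)"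

lemma wl2_measurable: assumes "wl2 b K f" shows "f \<in> borel_measurable borel"
proof -
  have [measurable]: "(\<lambda>x. wt b x * f x) \<in> borel_measurable borel"
    using assms L2_leD by (auto simp: wl2_def)
  have "(\<lambda>x. wt (-b) x * (wt b x * f x)) \<in> borel_measurable borel" by measurable
  then show ?thesis using wt_uminus[of b] by (simp flip: mult.assoc)
qed

lemma wl2_pos: "wl2 b K f \<Longrightarrow> 0 < K" by (simp add: wl2_def L2_le_def)

lemma wl2_add: "wl2 b K f \<Longrightarrow> wl2 b L g \<Longrightarrow> wl2 b (K + L) (\<lambda>x. f x + g x)"
  unfolding wl2_def using L2_le_add[of K "\<lambda>x. wt b x * f x" L "\<lambda>x. wt b x * g x"]
  by (simp add: distrib_left)

lemma wl2_bound:
  assumes "wl2 b K f" "g \<in> borel_measurable borel" "AE x in lborel. \<bar>g x\<bar> \<le> C * \<bar>f x\<bar>" "0 < C"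
  shows "wl2 b (C * K) g"
  unfolding wl2_def
proof (rule L2_le_bound[OF assms(1)[unfolded wl2_def] _ _ assms(4)])
  note [measurable] = assms(2)
  show "(\<lambda>x. wt b x * g x) \<in> borel_measurable borel" by simp
  show "AE x in lborel. \<bar>wt b x * g x\<bar> \<le> C * \<bar>wt b x * f x\<bar>"
    using assms(3)
  proof eventually_elim
    case (elim x)
    then have "wt b x * \<bar>g x\<bar> \<le> wt b x * (C * \<bar>f x\<bar>)" by (intro mult_left_mono) auto
    then show ?case by (simp add: abs_mult mult_ac)
  qed
qed

lemma wl2_mono: "wl2 b K f \<Longrightarrow> K \<le> K' \<Longrightarrow> wl2 b K' f"
  unfolding wl2_def by (rule L2_le_mono)

lemma wl2_cong_AE: "wl2 b K f \<Longrightarrow> g \<in> borel_measurable borel \<Longrightarrow> ae_eq f g \<Longrightarrow> wl2 b K g"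
  using wl2_bound[of b K f g 1] eventually_mono[of "\<lambda>x. f x = g x" _ "\<lambda>x. \<bar>g x\<bar> \<le> 1 * \<bar>f x\<bar>"] by simp

text \<open>The summand 1 keeps the bound positive when c = 0.\<close>

lemma wl2_cmult: "wl2 b K f \<Longrightarrow> wl2 b ((\<bar>c\<bar> + 1) * K) (\<lambda>x. c * f x)"
  by (rule wl2_bound) (auto simp: abs_mult intro!: mult_right_mono dest: wl2_measurable)

lemma wl2_minus: "wl2 b K f \<Longrightarrow> wl2 b K (\<lambda>x. - f x)"
  using wl2_bound[of b K f "\<lambda>x. - f x" 1] by (auto dest: wl2_measurable)

lemma wl2_diff: "wl2 b K f \<Longrightarrow> wl2 b L g \<Longrightarrow> wl2 b (K + L) (\<lambda>x. f x - g x)"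
  using wl2_add[OF _ wl2_minus] by simp

lemma wl2_L2_le: assumes "wl2 b K f" "0 \<le> b" shows "L2_le K f"
proof -
  have "L2_le (1 * K) f"
  proof (rule L2_le_bound[OF assms(1)[unfolded wl2_def]])
    have "\<bar>f x\<bar> \<le> \<bar>wt b x * f x\<bar>" for x
      using mult_right_mono[OF wt_ge_1[OF assms(2), of x], of "\<bar>f x\<bar>"] by (simp add: abs_mult)
    then show "AE x in lborel. \<bar>f x\<bar> \<le> 1 * \<bar>wt b x * f x\<bar>" by simp
  qed (use assms wl2_measurable in auto)
  then show ?thesis by simp
qed

lemma wl2_loc_integrable: "wl2 b K f \<Longrightarrow> loc_integrable f"
proof -
  assume f: "wl2 b K f"
  have "loc_integrable (\<lambda>x. wt (-b) x * (wt b x * f x))"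
    by (rule loc_integrable_mult_continuous[OF wt_continuous L2_le_loc_integrable[OF f[unfolded wl2_def]]])
  then show ?thesis using wt_uminus[of b] by (simp flip: mult.assoc)
qed

lemma wl2_shift:
  assumes "0 \<le> b" "wl2 b K f" "\<bar>t\<bar> \<le> 1" shows "wl2 b (exp b * K) (\<lambda>x. f (x + t))"
  unfolding wl2_def
proof (rule L2_le_bound[OF L2_le_shift[OF assms(2)[unfolded wl2_def], of t]])
  note [measurable] = wl2_measurable[OF assms(2)]
  show "(\<lambda>x. wt b x * f (x + t)) \<in> borel_measurable borel" by simp
  have "\<bar>wt b x * f (x + t)\<bar> \<le> exp b * \<bar>wt b (x + t) * f (x + t)\<bar>" for x
    using mult_right_mono[OF wt_shift[OF assms(1,3), of x], of "\<bar>f (x + t)\<bar>"] by (simp add: abs_mult)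
  then show "AE x in lborel. \<bar>wt b x * f (x + t)\<bar> \<le> exp b * \<bar>wt b (x + t) * f (x + t)\<bar>" by simp
qed simp

lemma wl2_cdiff:
  assumes "0 \<le> b" "wl2 b K f" shows "wl2 b (2 * exp b * K) (cdiff f)"
  using wl2_diff[OF wl2_shift[OF assms, of "1/2"] wl2_shift[OF assms, of "-1/2"]]
  by (simp add: cdiff_def[abs_def] mult_ac)

lemma wl2_liminf:
  assumes "\<And>k. wl2 b K (f k)" "\<And>x. (\<lambda>k. f k x) \<longlonglongrightarrow> g x"
  shows "wl2 b K g"
  unfolding wl2_def
  by (rule L2_le_liminf[OF assms(1)[unfolded wl2_def] tendsto_mult_left[OF assms(2)]])

text \<open>The inequality between geometric and arithmetic mean bounds |f|, the product of the
  inverse weight and the weighted function, by a sum of two integrable squares. Strict positivity of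
  \<open>b\<close> makes the inverse weight square integrable.\<close>

lemma wl2_integrable:
  assumes "0 < b" "wl2 b K f" shows "integrable lborel f"
proof (rule Bochner_Integration.integrable_bound)
  have "(\<lambda>x. wt b x * f x) \<in> L2" using assms(2) by (simp add: wl2_def L2_le_iff)
  then show "integrable lborel (\<lambda>x. (wt b x * f x)\<^sup>2 + (wt (-b) x)\<^sup>2)"
    using wt_neg_L2[OF assms(1)] by (auto simp: L2_def)
  show "f \<in> borel_measurable lborel" using wl2_measurable assms by simp
  have "\<bar>f x\<bar> \<le> (wt b x * f x)\<^sup>2 + (wt (-b) x)\<^sup>2" for x
  proof -
    define A where "A = \<bar>wt b x * f x\<bar>"
    define B where "B = wt (-b) x"
    have "\<bar>f x\<bar> = B * A" using wt_uminus[of b x]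
      by (simp add: abs_mult A_def B_def flip: mult.assoc)
    moreover have "2 * (B * A) \<le> A\<^sup>2 + B\<^sup>2"
      using zero_le_power2[of "A - B"] by (simp add: power2_diff mult_ac)
    then have "B * A \<le> A\<^sup>2 + B\<^sup>2"
      using zero_le_power2[of A] zero_le_power2[of B] by linarith
    ultimately show ?thesis by (simp add: A_def B_def)
  qed
  then show "AE x in lborel. norm (f x) \<le> norm ((wt b x * f x)\<^sup>2 + (wt (-b) x)\<^sup>2)" by simp
qed

section \<open>Convolution with a kernel on a window of length one\<close>

definition conv :: "(real \<Rightarrow> real) \<Rightarrow> (real \<Rightarrow> real) \<Rightarrow> real \<Rightarrow> real" where
  "conv k f x = (LINT t:{-1/2..1/2}|lborel. k t * f (x - t))"

lemma conv_measurable [measurable]: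
  assumes [measurable]: "k \<in> borel_measurable borel" "f \<in> borel_measurable borel"
  shows "conv k f \<in> borel_measurable borel"
  unfolding conv_def[abs_def] set_lebesgue_integral_def by measurable

lemma L2_reflect:
  assumes "f \<in> L2" shows "(\<lambda>t. f (x - t)) \<in> L2"
proof -
  have [measurable]: "f \<in> borel_measurable borel" using assms by (simp add: L2_def)
  have "integrable lborel (\<lambda>t. (f (x + (-1) * t))\<^sup>2)"
    by (rule lborel_integrable_real_affine) (use assms in \<open>auto simp: L2_def\<close>)
  then show ?thesis by (simp add: L2_def)
qed

text \<open>Cauchy-Schwarz on the window, then Tonelli and translation invariance. The window has
  length exactly one, which is why the bound \<open>K\<close> does not grow.\<close>

lemma L2_le_window:
  assumes f: "L2_le K f" shows "L2_le K (\<lambda>x. LINT t:{-1/2..1/2}|lborel. \<bar>f (x - t)\<bar>)"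
proof -
  note [measurable] = L2_leD(1)[OF f]
  have L: "f \<in> L2" using f by (simp add: L2_le_iff)
  have m: "(\<lambda>x. LINT t:{-1/2..1/2}|lborel. \<bar>f (x - t)\<bar>) \<in> borel_measurable borel"
    unfolding set_lebesgue_integral_def by measurable
  have "(\<integral>\<^sup>+x. ennreal ((LINT t:{-1/2..1/2}|lborel. \<bar>f (x - t)\<bar>)\<^sup>2) \<partial>lborel) \<le>
      (\<integral>\<^sup>+x. (\<integral>\<^sup>+t. indicator {-1/2..1/2} t * ennreal ((f (x - t))\<^sup>2) \<partial>lborel) \<partial>lborel)"
  proof (rule nn_integral_mono)
    fix x :: real
    have L': "(\<lambda>t. f (x - t)) \<in> L2" using L by (rule L2_reflect)
    have i: "integrable lborel (\<lambda>t. indicator {-1/2..1/2} t *\<^sub>R (f (x - t))\<^sup>2)"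
      by (rule integrable_mult_indicator) (use L' in \<open>auto simp: L2_def\<close>)
    have "ennreal ((LINT t:{-1/2..1/2}|lborel. \<bar>f (x - t)\<bar>)\<^sup>2) \<le> ennreal (LINT t:{-1/2..1/2}|lborel. (f (x - t))\<^sup>2)"
      using L2_unit_interval_average[OF L', of "-1/2"] by (intro ennreal_leI) simp
    also have "\<dots> = (\<integral>\<^sup>+t. ennreal (indicator {-1/2..1/2} t *\<^sub>R (f (x - t))\<^sup>2) \<partial>lborel)"
      unfolding set_lebesgue_integral_def by (rule nn_integral_eq_integral[symmetric, OF i]) auto
    also have "\<dots> = (\<integral>\<^sup>+t. indicator {-1/2..1/2} t * ennreal ((f (x - t))\<^sup>2) \<partial>lborel)"
      by (intro nn_integral_cong) (auto simp: indicator_def)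
    finally show "ennreal ((LINT t:{-1/2..1/2}|lborel. \<bar>f (x - t)\<bar>)\<^sup>2) \<le>
      (\<integral>\<^sup>+t. indicator {-1/2..1/2} t * ennreal ((f (x - t))\<^sup>2) \<partial>lborel)" .
  qed
  also have "\<dots> = (\<integral>\<^sup>+t. (\<integral>\<^sup>+x. indicator {-1/2..1/2} t * ennreal ((f (x - t))\<^sup>2) \<partial>lborel) \<partial>lborel)"
    by (rule lborel_pair.Fubini'[symmetric]) measurable
  also have "\<dots> = (\<integral>\<^sup>+t. indicator {-1/2..1/2} t * (\<integral>\<^sup>+x. ennreal ((f (x - t))\<^sup>2) \<partial>lborel) \<partial>lborel)"
    by (intro nn_integral_cong nn_integral_cmult) auto
  also have "\<dots> \<le> (\<integral>\<^sup>+t. indicator {-1/2..1/2::real} t * ennreal (K\<^sup>2) \<partial>lborel)"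
    using L2_leD(3)[OF L2_le_shift[OF f]] by (intro nn_integral_mono mult_left_mono) (auto simp flip: add_uminus_conv_diff)
  also have "\<dots> = ennreal (K\<^sup>2)"
    by (subst nn_integral_multc) auto
  finally show ?thesis using m L2_leD(2)[OF f] by (simp add: L2_le_def)
qed

text \<open>The weight moves under the integral by \<open>wt_shift\<close>, as |t| <= 1/2 there, and
  the kernel is replaced by its supremum; what is left is the window average of the weighted
  function.\<close>

lemma wl2_conv:
  assumes b: "0 \<le> b" and f: "wl2 b K f" and [measurable]: "k \<in> borel_measurable borel"
    and M: "\<And>t. \<bar>t\<bar> \<le> 1/2 \<Longrightarrow> \<bar>k t\<bar> \<le> M" and "0 < M"
  shows "wl2 b (exp b * M * K) (conv k f)"
proof -
  note [measurable] = wl2_measurable[OF f]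
  let ?F = "\<lambda>x. LINT t:{-1/2..1/2}|lborel. \<bar>wt b (x - t) * f (x - t)\<bar>"
  have F: "L2_le K ?F"
    using L2_le_window[OF f[unfolded wl2_def]] .
  have "\<bar>wt b x * conv k f x\<bar> \<le> exp b * M * \<bar>?F x\<bar>" for x
  proof -
    have L: "(\<lambda>t. wt b (x - t) * f (x - t)) \<in> L2"
      using f L2_reflect[of "\<lambda>x. wt b x * f x"] by (simp add: wl2_def L2_le_iff)
    have i: "set_integrable lborel {-1/2..1/2} (\<lambda>t. \<bar>wt b (x - t) * f (x - t)\<bar>)"
      using L2_loc_integrable[OF L] by (auto intro: loc_integrableD set_integrable_abs)
    have i2: "set_integrable lborel {-1/2..1/2} (\<lambda>t. (exp b * M) * \<bar>wt b (x - t) * f (x - t)\<bar>)"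
      using i by (rule set_integrable_mult_right)
    have le: "\<bar>wt b x * (k t * f (x - t))\<bar> \<le> (exp b * M) * \<bar>wt b (x - t) * f (x - t)\<bar>"
      if "t \<in> {-1/2..1/2}" for t
    proof -
      have "wt b x * \<bar>k t\<bar> \<le> (exp b * wt b (x - t)) * M"
        using wt_shift[OF b, of "-t" x] M[of t] that by (intro mult_mono) (auto simp: abs_le_iff)
      from mult_right_mono[OF this, of "\<bar>f (x - t)\<bar>"] show ?thesis by (simp add: abs_mult mult_ac)
    qed
    have i3: "set_integrable lborel {-1/2..1/2} (\<lambda>t. wt b x * (k t * f (x - t)))"
      by (rule set_integrable_bound[OF i2])
         (use le in \<open>auto simp: set_borel_measurable_def abs_mult \<open>0 < M\<close>[THEN less_imp_le]\<close>)
    have "\<bar>wt b x * conv k f x\<bar> = \<bar>LINT t:{-1/2..1/2}|lborel. wt b x * (k t * f (x - t))\<bar>"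
      by (simp only: conv_def set_integral_mult_right)
    also have "\<dots> \<le> (LINT t:{-1/2..1/2}|lborel. \<bar>wt b x * (k t * f (x - t))\<bar>)"
      using set_integral_norm_bound[OF i3] by simp
    also have "\<dots> \<le> (LINT t:{-1/2..1/2}|lborel. (exp b * M) * \<bar>wt b (x - t) * f (x - t)\<bar>)"
      by (rule set_integral_mono[OF set_integrable_abs[OF i3] i2 le])
    also have "\<dots> = exp b * M * ?F x" by (rule set_integral_mult_right)
    also have "\<dots> \<le> exp b * M * \<bar>?F x\<bar>" using \<open>0 < M\<close> by (intro mult_left_mono) auto
    finally show ?thesis .
  qed
  then show ?thesis unfolding wl2_def
    by (intro L2_le_bound[OF F]) (use \<open>0 < M\<close> in auto)
qed

section \<open>Weighted Sobolev classes\<close>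

text \<open>The derivative falls on \<open>f\<close>, so continuity of the kernel suffices. Fubini
  for k(t) f'(y - t) over the window and [a, b] exchanges the convolution with the integral that
  defines \<open>ac\<close>.\<close>

lemma conv_ac:
  assumes k: "continuous_on UNIV k" and f: "ac f f'"
  shows "ac (conv k f) (conv k f')"
proof -
  let ?I = "{-1/2..1/2::real}"
  have lf: "loc_integrable f'" and cf: "continuous_on UNIV f" using acD(1) ac_continuous f by auto
  note [measurable] = loc_integrableD(1)[OF lf] borel_measurable_continuous_onI[OF k]
    borel_measurable_continuous_onI[OF cf]
  have lr: "set_integrable lborel {a..b} (\<lambda>y. f' (y - t))" for a b t
  proof -
    have "ac (\<lambda>x. f (x + (-t))) (\<lambda>x. f' (x + (-t)))" by (rule ac_shift[OF f])
    from loc_integrableD(2)[OF acD(1)[OF this], of a b] show ?thesis by simp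
  qed
  have "compact (k ` ?I)" by (intro compact_continuous_image continuous_on_subset[OF k]) auto
  then obtain M where M: "\<And>t. t \<in> ?I \<Longrightarrow> \<bar>k t\<bar> \<le> M"
    using compact_imp_bounded bounded_iff by (metis imageI real_norm_def)
  have M0: "0 \<le> M" using M[of 0] by auto
  define H where "H a b = (\<lambda>(t, y). (indicator ?I t * k t) * (indicator {a..b} y * f' (y - t)))" for a b :: real
  have mH: "H a b \<in> borel_measurable (lborel \<Otimes>\<^sub>M lborel)" for a b
  proof -
    have "(\<lambda>p. (indicator ?I (fst p) * k (fst p)) * (indicator {a..b} (snd p) * f' (snd p - fst p)))
        \<in> borel_measurable (lborel \<Otimes>\<^sub>M lborel)"
      by measurable
    then show ?thesis by (simp add: H_def case_prod_beta')
  qed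
  have H1: "integrable lborel (\<lambda>y. H a b (t, y))" for a b t
    unfolding H_def prod.case by (rule integrable_mult_right) (use lr[of a b t] in \<open>simp add: set_integrable_def\<close>)
  have HI: "integrable (lborel \<Otimes>\<^sub>M lborel) (H a b)" for a b
  proof (rule lborel_pair.Fubini_integrable[OF mH])
    show "AE x in lborel. integrable lborel (\<lambda>y. H a b (x, y))" using H1 by simp
    define C where "C = (LINT y:{a-1/2..b+1/2}|lborel. \<bar>f' y\<bar>)"
    have i: "set_integrable lborel {c..d} (\<lambda>y. \<bar>f' y\<bar>)" for c d
      by (intro set_integrable_abs loc_integrableD lf)
    have bd: "(LINT y|lborel. norm (H a b (t, y))) \<le> indicator ?I t * (M * C)" for t
    proof (cases "t \<in> ?I")
      case True
      have "(LINT y|lborel. norm (H a b (t, y))) \<le> (LINT y|lborel. M * (indicator {a-1/2..b+1/2} (-t + 1 * y) * \<bar>f' (-t + 1 * y)\<bar>))"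
      proof (rule integral_mono)
        show "integrable lborel (\<lambda>y. norm (H a b (t, y)))" using H1 by simp
        show "integrable lborel (\<lambda>y. M * (indicator {a-1/2..b+1/2} (-t + 1 * y) * \<bar>f' (-t + 1 * y)\<bar>))"
          using i[of "a-1/2" "b+1/2"]
          by (intro integrable_mult_right lborel_integrable_real_affine[of "\<lambda>y. indicator {a-1/2..b+1/2} y * \<bar>f' y\<bar>"])
             (auto simp: set_integrable_def)
        show "norm (H a b (t, y)) \<le> M * (indicator {a-1/2..b+1/2} (-t + 1 * y) * \<bar>f' (-t + 1 * y)\<bar>)" for y
          using M[OF True] True M0 by (auto simp: H_def abs_mult indicator_def intro!: mult_right_mono)
      qed
      also have "\<dots> = M * C"
        using lborel_integral_real_affine[of 1 "\<lambda>y. indicator {a-1/2..b+1/2} y * \<bar>f' y\<bar>" "-t"]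
        by (simp add: C_def set_lebesgue_integral_def)
      finally show ?thesis using True by simp
    qed (simp add: H_def)
    show "integrable lborel (\<lambda>x. LINT y|lborel. norm (H a b (x, y)))"
    proof (rule Bochner_Integration.integrable_bound)
      show "integrable lborel (\<lambda>t. indicator ?I t * (M * C))"
        by (intro integrable_mult_left integrable_real_indicator) auto
      have "(\<lambda>p. norm (H a b p)) \<in> borel_measurable (lborel \<Otimes>\<^sub>M lborel)" using mH by simp
      then show "(\<lambda>x. LINT y|lborel. norm (H a b (x, y))) \<in> borel_measurable lborel"
        using lborel.borel_measurable_lebesgue_integral[of "\<lambda>x y. norm (H a b (x, y))" lborel]
        by (simp add: case_prod_beta')
      show "AE x in lborel. norm (LINT y|lborel. norm (H a b (x, y))) \<le> norm (indicator ?I x * (M * C))"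
      proof (intro AE_I2)
        fix x :: real
        have "0 \<le> (LINT y|lborel. norm (H a b (x, y)))" by (rule integral_nonneg_AE) simp
        then show "norm (LINT y|lborel. norm (H a b (x, y))) \<le> norm (indicator ?I x * (M * C))"
          using bd[of x] by simp
      qed
    qed
  qed
  have snd: "(LINT t|lborel. H a b (t, y)) = indicator {a..b} y *\<^sub>R conv k f' y" for a b y
  proof -
    have "(\<lambda>t. H a b (t, y)) = (\<lambda>t. indicator {a..b} y * (indicator ?I t *\<^sub>R (k t * f' (y - t))))"
      by (simp add: H_def fun_eq_iff)
    then show ?thesis by (simp only: integral_mult_right_zero conv_def set_lebesgue_integral_def real_scaleR_def)
  qed
  have HI': "integrable (lborel \<Otimes>\<^sub>M lborel) (case_prod (\<lambda>t y. H a b (t, y)))" for a b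
    using HI by (simp add: case_prod_beta')
  have "loc_integrable (conv k f')"
    using lborel_pair.integrable_snd[OF HI'] unfolding snd
    by (simp add: loc_integrable_def set_integrable_def conv_measurable)
  moreover have "conv k f b - conv k f a = (LINT x:{a..b}|lborel. conv k f' x)" if ab: "a \<le> b" for a b
  proof -
    have ic: "set_integrable lborel ?I (\<lambda>t. k t * f (x - t))" for x
      by (rule borel_integrable_atLeastAtMost')
         (intro continuous_intros continuous_on_subset[OF k] continuous_on_compose2[OF cf] subset_UNIV)
    have "conv k f b - conv k f a = (LINT t:?I|lborel. k t * f (b - t) - k t * f (a - t))"
      unfolding conv_def by (rule set_integral_diff(2)[symmetric, OF ic ic])
    also have "\<dots> = (LINT t|lborel. LINT y|lborel. H a b (t, y))"
      unfolding set_lebesgue_integral_def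
    proof (rule Bochner_Integration.integral_cong[OF refl])
      fix t
      have "ac (\<lambda>x. f (x + (-t))) (\<lambda>x. f' (x + (-t)))" by (rule ac_shift[OF f])
      from acD(2)[OF this ab] have "f (b - t) - f (a - t) = (LINT y:{a..b}|lborel. f' (y - t))" by simp
      then have "indicator ?I t *\<^sub>R (k t * f (b - t) - k t * f (a - t)) =
          (indicator ?I t * k t) * (LINT y:{a..b}|lborel. f' (y - t))"
        by (simp flip: right_diff_distrib)
      also have "\<dots> = (LINT y|lborel. H a b (t, y))"
        by (simp only: H_def prod.case integral_mult_right_zero set_lebesgue_integral_def real_scaleR_def)
      finally show "indicator ?I t *\<^sub>R (k t * f (b - t) - k t * f (a - t)) = (LINT y|lborel. H a b (t, y))" .
    qed
    also have "\<dots> = (LINT y|lborel. LINT t|lborel. H a b (t, y))"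
      by (rule lborel_pair.Fubini_integral[symmetric, OF HI'])
    also have "\<dots> = (LINT x:{a..b}|lborel. conv k f' x)"
      unfolding snd set_lebesgue_integral_def ..
    finally show ?thesis .
  qed
  ultimately show ?thesis by (simp add: ac_def)
qed

text \<open>
  \<open>sob b m K f\<close>: the derivatives of \<open>f\<close> up to order \<open>m\<close> have weighted norm at most \<open>K\<close>, i.e. a
  quantitative form of \<open>f \<in> H\<^sup>m\<^sub>b\<close>. All but the last derivative are continuous representatives.
\<close>

primrec sob :: "real \<Rightarrow> nat \<Rightarrow> real \<Rightarrow> (real \<Rightarrow> real) \<Rightarrow> bool" where
  "sob b 0 K f \<longleftrightarrow> wl2 b K f"
| "sob b (Suc m) K f \<longleftrightarrow> wl2 b K f \<and> (\<exists>f'. ac f f' \<and> sob b m K f')"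

lemma sob_wl2: "sob b m K f \<Longrightarrow> wl2 b K f"
  by (cases m) auto

lemma sob_pos: "sob b m K f \<Longrightarrow> 0 < K"
  using sob_wl2 wl2_pos by blast

lemma sob_SucI: "wl2 b K f \<Longrightarrow> ac f f' \<Longrightarrow> sob b m K f' \<Longrightarrow> sob b (Suc m) K f"
  by auto

lemma sob_SucE:
  assumes "sob b (Suc m) K f" obtains f' where "ac f f'" "sob b m K f'" "wl2 b K f"
  using assms by auto

lemma sob_mono: "sob b m K f \<Longrightarrow> K \<le> K' \<Longrightarrow> sob b m K' f"
  by (induction m arbitrary: f) (auto intro: wl2_mono)

lemma sob_SucD: "sob b (Suc m) K f \<Longrightarrow> sob b m K f"
  by (induction m arbitrary: f) auto

lemma sob_le: "sob b m K f \<Longrightarrow> j \<le> m \<Longrightarrow> sob b j K f"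
proof (induction m)
  case (Suc m)
  then show ?case using sob_SucD[of b m K f] by (auto simp del: sob.simps simp: le_Suc_eq)
qed simp

lemma sob_add: "sob b m K f \<Longrightarrow> sob b m L g \<Longrightarrow> sob b m (K + L) (\<lambda>x. f x + g x)"
proof (induction m arbitrary: f g)
  case 0 then show ?case by (simp add: wl2_add)
next
  case (Suc m)
  obtain f' where f: "ac f f'" "sob b m K f'" "wl2 b K f" using Suc.prems(1) by (rule sob_SucE)
  obtain g' where g: "ac g g'" "sob b m L g'" "wl2 b L g" using Suc.prems(2) by (rule sob_SucE)
  show ?case by (rule sob_SucI[OF wl2_add[OF f(3) g(3)] ac_add[OF f(1) g(1)] Suc.IH[OF f(2) g(2)]])
qed

lemma sob_cmult: "sob b m K f \<Longrightarrow> sob b m ((\<bar>c\<bar> + 1) * K) (\<lambda>x. c * f x)"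
proof (induction m arbitrary: f)
  case 0 then show ?case by (simp add: wl2_cmult)
next
  case (Suc m)
  obtain f' where f: "ac f f'" "sob b m K f'" "wl2 b K f" using Suc.prems(1) by (rule sob_SucE)
  show ?case by (rule sob_SucI[OF wl2_cmult[OF f(3)] ac_cmult[OF f(1)] Suc.IH[OF f(2)]])
qed

lemma sob_minus: "sob b m K f \<Longrightarrow> sob b m K (\<lambda>x. - f x)"
proof (induction m arbitrary: f)
  case 0 then show ?case by (simp add: wl2_minus)
next
  case (Suc m)
  obtain f' where f: "ac f f'" "sob b m K f'" "wl2 b K f" using Suc.prems(1) by (rule sob_SucE)
  have "ac (\<lambda>x. - f x) (\<lambda>x. - f' x)" using ac_cmult[OF f(1), of "-1"] by simp
  from sob_SucI[OF wl2_minus[OF f(3)] this Suc.IH[OF f(2)]] show ?case .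
qed

lemma sob_diff: "sob b m K f \<Longrightarrow> sob b m L g \<Longrightarrow> sob b m (K + L) (\<lambda>x. f x - g x)"
  using sob_add[OF _ sob_minus] by simp

lemma sob_shift:
  assumes "0 \<le> b" "\<bar>t\<bar> \<le> 1" shows "sob b m K f \<Longrightarrow> sob b m (exp b * K) (\<lambda>x. f (x + t))"
proof (induction m arbitrary: f)
  case 0 then show ?case using assms by (simp add: wl2_shift)
next
  case (Suc m)
  obtain f' where f: "ac f f'" "sob b m K f'" "wl2 b K f" using Suc.prems(1) by (rule sob_SucE)
  show ?case by (rule sob_SucI[OF wl2_shift[OF assms(1) f(3) assms(2)] ac_shift[OF f(1)] Suc.IH[OF f(2)]])
qed

lemma sob_cdiff:
  assumes "0 \<le> b" "sob b m K f" shows "sob b m (2 * exp b * K) (cdiff f)"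
  using sob_diff[OF sob_shift[OF assms(1) _ assms(2), of "1/2"] sob_shift[OF assms(1) _ assms(2), of "-1/2"]]
  by (simp add: cdiff_def[abs_def] mult_ac)

lemma sob_conv:
  assumes "0 \<le> b" "continuous_on UNIV k" "\<And>t. \<bar>t\<bar> \<le> 1/2 \<Longrightarrow> \<bar>k t\<bar> \<le> M" "0 < M"
  shows "sob b m K f \<Longrightarrow> sob b m (exp b * M * K) (conv k f)"
proof (induction m arbitrary: f)
  case 0 then show ?case
    using wl2_conv[OF assms(1) _ borel_measurable_continuous_onI[OF assms(2)] assms(3,4)] by simp
next
  case (Suc m)
  obtain f' where f: "ac f f'" "sob b m K f'" "wl2 b K f" using Suc.prems(1) by (rule sob_SucE)
  show ?case
    by (rule sob_SucI[OF wl2_conv[OF assms(1) f(3) borel_measurable_continuous_onI[OF assms(2)] assms(3,4)]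
        conv_ac[OF assms(2) f(1)] Suc.IH[OF f(2)]])
qed

text \<open>As tanh' = 1 - tanh^2, the derivative of tanh f is f - tanh (tanh f) + tanh f', to which
  the induction hypothesis applies, twice in the middle term. Multiplication by tanh matters because
  the logarithmic derivative of a weight is a multiple of it.\<close>

lemma sob_tanh: "\<exists>A>0. \<forall>K f. sob b m K f \<longrightarrow> sob b m (A * K) (\<lambda>x. tanh x * f x)"
proof (induction m)
  have "wl2 b (1 * K) (\<lambda>x. tanh x * f x)" if "wl2 b K f" for K f
  proof (rule wl2_bound[OF that])
    note [measurable] = wl2_measurable[OF that]
    have [measurable]: "(tanh :: real \<Rightarrow> real) \<in> borel_measurable borel"
      by (intro borel_measurable_continuous_onI continuous_intros) (auto simp: cosh_real_nonzero)
    show "(\<lambda>x. tanh x * f x) \<in> borel_measurable borel" by simp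
    show "AE x in lborel. \<bar>tanh x * f x\<bar> \<le> 1 * \<bar>f x\<bar>"
      using tanh_bounds by (auto simp: abs_mult intro!: mult_left_le_one_le)
  qed simp
  note w = this
  case 0
  show ?case using w by (auto intro!: exI[of _ 1])
  case (Suc m)
  then obtain A where A: "A > 0" "\<And>K f. sob b m K f \<Longrightarrow> sob b m (A * K) (\<lambda>x. tanh x * f x)" by blast
  have "sob b (Suc m) ((1 + A * A + A) * K) (\<lambda>x. tanh x * f x)" if f: "sob b (Suc m) K f" for K f
  proof -
    obtain f' where f': "ac f f'" "sob b m K f'" "wl2 b K f" using f by (rule sob_SucE)
    have K: "0 < K" using f sob_pos by blast
    note f0 = sob_SucD[OF f]
    have tn: "ac tanh (\<lambda>x::real. 1 - tanh x * tanh x)"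
      by (rule DERIV_ac) (auto intro!: derivative_eq_intros continuous_intros simp: power2_eq_square)
    have "ac (\<lambda>x. tanh x * f x) (\<lambda>x. f x - tanh x * (tanh x * f x) + tanh x * f' x)"
      using ac_mult[OF tn f'(1)] by (simp add: left_diff_distrib mult.assoc)
    moreover have "sob b m (K + A * (A * K) + A * K) (\<lambda>x. f x - tanh x * (tanh x * f x) + tanh x * f' x)"
      by (intro sob_add sob_diff f0 A f')
    moreover have "wl2 b (K + A * (A * K) + A * K) (\<lambda>x. tanh x * f x)"
      using w[OF f'(3)] by (rule wl2_mono) (use A K in auto)
    ultimately have "sob b (Suc m) (K + A * (A * K) + A * K) (\<lambda>x. tanh x * f x)"
      by (intro sob_SucI)
    then show ?thesis by (simp add: algebra_simps)
  qed
  moreover have "0 < 1 + A * A + A" using A by (simp add: add_pos_pos)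
  ultimately show ?case by blast
qed

text \<open>Multiplication by a weight only shifts the weight exponent. With a = b and with a = -b
  it passes between weighted bounds on f and unweighted bounds on cosh^b f, through which the given
  norm is defined.\<close>

lemma sob_wt: "\<exists>A>0. \<forall>K f. sob b m K f \<longrightarrow> sob (b - a) m (A * K) (\<lambda>x. wt a x * f x)"
proof (induction m)
  have w: "wl2 (b - a) K (\<lambda>x. wt a x * f x)" if "wl2 b K f" for K f
    using that wt_add[of "b - a" a] by (simp add: wl2_def flip: mult.assoc)
  case 0
  show ?case using w by (auto intro!: exI[of _ 1])
  case (Suc m)
  then obtain A where A: "A > 0" "\<And>K f. sob b m K f \<Longrightarrow> sob (b - a) m (A * K) (\<lambda>x. wt a x * f x)" by blast
  obtain T where T: "T > 0" "\<And>K f. sob b m K f \<Longrightarrow> sob b m (T * K) (\<lambda>x. tanh x * f x)"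
    using sob_tanh by blast
  let ?B = "1 + A * ((\<bar>a\<bar> + 1) * T + 1)"
  have "sob (b - a) (Suc m) (?B * K) (\<lambda>x. wt a x * f x)" if f: "sob b (Suc m) K f" for K f
  proof -
    obtain f' where f': "ac f f'" "sob b m K f'" "wl2 b K f" using f by (rule sob_SucE)
    have K: "0 < K" using f sob_pos by blast
    note f0 = sob_SucD[OF f]
    have wn: "ac (wt a) (\<lambda>x. wt a x * (a * tanh x))"
      by (rule DERIV_ac) (auto intro!: wt_DERIV continuous_intros wt_continuous)
    have D: "ac (\<lambda>x. wt a x * f x) (\<lambda>x. wt a x * (a * (tanh x * f x) + f' x))"
      using ac_mult[OF wn f'(1)] by (simp add: algebra_simps)
    have "sob b m ((\<bar>a\<bar> + 1) * (T * K) + K) (\<lambda>x. a * (tanh x * f x) + f' x)"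
      by (intro sob_add sob_cmult T f0 f')
    from A(2)[OF this] have "sob (b - a) m (?B * K) (\<lambda>x. wt a x * (a * (tanh x * f x) + f' x))"
      by (rule sob_mono) (use K in \<open>simp add: algebra_simps\<close>)
    moreover have "wl2 (b - a) (?B * K) (\<lambda>x. wt a x * f x)"
      using w[OF f'(3)] by (rule wl2_mono) (use A T K in \<open>simp add: field_simps\<close>)
    ultimately show ?thesis using D by (intro sob_SucI)
  qed
  moreover have "0 \<le> A * ((\<bar>a\<bar> + 1) * T + 1)"
    using A T by (intro mult_nonneg_nonneg add_nonneg_nonneg) auto
  then have "?B > 0" by linarith
  ultimately show ?case by blast
qed

text \<open>Weighted Sobolev embedding: |f x| is at most |f y| plus the integral of |f'| over
  [x, x + 1], and this is averaged over y in that interval. Each of the two terms contributes exp b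
  K.\<close>

lemma sob_sup:
  assumes b: "0 \<le> b" and f: "sob b (Suc m) K f"
  shows "wt b x * \<bar>f x\<bar> \<le> 2 * exp b * K"
proof -
  obtain f' where f': "ac f f'" "sob b m K f'" "wl2 b K f" using f by (rule sob_SucE)
  have K: "K > 0" using f sob_pos by blast
  have w': "wl2 b K f'" using f' sob_wl2 by blast
  let ?I = "{x..x+1}"
  have int: "set_integrable lborel ?I (\<lambda>y. \<bar>wt b y * g y\<bar>)"
    and le: "(LINT y:?I|lborel. \<bar>wt b y * g y\<bar>) \<le> K" if "wl2 b K g" for g
  proof -
    have g: "(\<lambda>y. wt b y * g y) \<in> L2" using that by (simp add: wl2_def L2_le_iff)
    show "set_integrable lborel ?I (\<lambda>y. \<bar>wt b y * g y\<bar>)"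
      by (intro set_integrable_abs loc_integrableD L2_loc_integrable[OF g])
    have "(LINT y:?I|lborel. \<bar>wt b y * g y\<bar>)\<^sup>2 \<le> (LINT y:?I|lborel. (wt b y * g y)\<^sup>2)"
      by (rule L2_unit_interval_average[OF g])
    also have "\<dots> \<le> (LINT y|lborel. (wt b y * g y)\<^sup>2)"
      unfolding set_lebesgue_integral_def
    proof (rule integral_mono)
      show "integrable lborel (\<lambda>y. indicator ?I y *\<^sub>R (wt b y * g y)\<^sup>2)"
        by (rule integrable_mult_indicator) (use g in \<open>auto simp: L2_def\<close>)
    qed (use g in \<open>auto simp: L2_def indicator_def\<close>)
    also have "\<dots> \<le> K\<^sup>2" using that by (simp add: wl2_def L2_le_iff)
    finally show "(LINT y:?I|lborel. \<bar>wt b y * g y\<bar>) \<le> K"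
      using K by (simp add: power2_le_iff_abs_le)
  qed
  have bound: "wt b x * \<bar>f x\<bar> \<le> exp b * \<bar>wt b y * f y\<bar> + exp b * K" if y: "y \<in> ?I" for y
  proof -
    have l: "loc_integrable f'" by (rule acD(1)[OF f'(1)])
    have "f y - f x = (LINT z:{x..y}|lborel. f' z)" using y by (intro acD(2)[OF f'(1)]) simp
    then have "\<bar>f y - f x\<bar> \<le> (LINT z:{x..y}|lborel. \<bar>f' z\<bar>)"
      using set_integral_norm_bound[OF loc_integrableD(2)[OF l, of x y]] by simp
    also have "\<dots> \<le> (LINT z:?I|lborel. \<bar>f' z\<bar>)"
      unfolding set_lebesgue_integral_def
      by (rule integral_mono)
         (use set_integrable_abs[OF loc_integrableD(2)[OF l, of x y]]
           set_integrable_abs[OF loc_integrableD(2)[OF l, of x "x+1"]] y in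
          \<open>auto simp: set_integrable_def indicator_def\<close>)
    finally have "wt b x * \<bar>f x\<bar> \<le> wt b x * (\<bar>f y\<bar> + (LINT z:?I|lborel. \<bar>f' z\<bar>))"
      by (intro mult_left_mono) auto
    also have "\<dots> = wt b x * \<bar>f y\<bar> + (LINT z:?I|lborel. wt b x * \<bar>f' z\<bar>)"
      by (simp only: distrib_left set_integral_mult_right)
    also have "(LINT z:?I|lborel. wt b x * \<bar>f' z\<bar>) \<le> (LINT z:?I|lborel. exp b * \<bar>wt b z * f' z\<bar>)"
    proof (rule set_integral_mono)
      show "set_integrable lborel ?I (\<lambda>z. wt b x * \<bar>f' z\<bar>)"
        by (intro set_integrable_mult_right set_integrable_abs loc_integrableD l)
      show "set_integrable lborel ?I (\<lambda>z. exp b * \<bar>wt b z * f' z\<bar>)"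
        by (intro set_integrable_mult_right int w')
      show "wt b x * \<bar>f' z\<bar> \<le> exp b * \<bar>wt b z * f' z\<bar>" if "z \<in> ?I" for z
        using mult_right_mono[OF wt_shift[OF b, of "z - x" x], of "\<bar>f' z\<bar>"] that
        by (simp add: abs_mult)
    qed
    also have "\<dots> = exp b * (LINT z:?I|lborel. \<bar>wt b z * f' z\<bar>)" by (rule set_integral_mult_right)
    also have "\<dots> \<le> exp b * K" using le[OF w'] by simp
    also have "wt b x * \<bar>f y\<bar> \<le> exp b * \<bar>wt b y * f y\<bar>"
      using mult_right_mono[OF wt_shift[OF b, of "y - x" x], of "\<bar>f y\<bar>"] y
      by (simp add: abs_mult)
    finally show ?thesis by simp
  qed
  have ic: "set_integrable lborel ?I (\<lambda>y. c)" for c :: real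
    by (simp add: set_integrable_def)
  have cI: "(LINT y:?I|lborel. c) = c" for c :: real
    by (simp add: set_lebesgue_integral_def)
  have ie: "set_integrable lborel ?I (\<lambda>y. exp b * \<bar>wt b y * f y\<bar>)"
    by (intro set_integrable_mult_right int f')
  have "wt b x * \<bar>f x\<bar> = (LINT y:?I|lborel. wt b x * \<bar>f x\<bar>)" by (simp only: cI)
  also have "\<dots> \<le> (LINT y:?I|lborel. exp b * \<bar>wt b y * f y\<bar> + exp b * K)"
    by (rule set_integral_mono[OF ic set_integral_add(1)[OF ie ic] bound])
  also have "\<dots> = exp b * (LINT y:?I|lborel. \<bar>wt b y * f y\<bar>) + exp b * K"
    by (simp only: set_integral_add(2)[OF ie ic] set_integral_mult_right cI)
  also have "\<dots> \<le> exp b * K + exp b * K" using le[OF f'(3)] by simp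
  finally show ?thesis by (simp add: mult_ac)
qed

lemma sob_abs_bound:
  assumes "0 \<le> b" "sob b (Suc m) K f" shows "\<bar>f x\<bar> \<le> 2 * exp b * K"
proof -
  have "1 * \<bar>f x\<bar> \<le> wt b x * \<bar>f x\<bar>" by (intro mult_right_mono wt_ge_1 assms) simp
  then show ?thesis using sob_sup[OF assms, of x] by simp
qed

lemma sob_continuous: "sob b (Suc m) K f \<Longrightarrow> continuous_on UNIV f"
  using ac_continuous by auto

lemma wl2_mult_sob:
  assumes b: "0 \<le> b" and f: "wl2 b K f" and g: "sob b m L g" and m: "1 \<le> m"
  shows "wl2 b (2 * exp b * K * L) (\<lambda>x. f x * g x)"
proof -
  obtain m' where m': "m = Suc m'" using m by (cases m) auto
  note [measurable] = wl2_measurable[OF f] wl2_measurable[OF sob_wl2[OF g]]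
  have L: "0 < L" using g sob_pos by blast
  have "wl2 b ((2 * exp b * L) * K) (\<lambda>x. f x * g x)"
  proof (rule wl2_bound[OF f])
    have "\<bar>f x * g x\<bar> \<le> 2 * exp b * L * \<bar>f x\<bar>" for x
      using mult_right_mono[OF sob_abs_bound[OF b g[unfolded m'], of x], of "\<bar>f x\<bar>"]
      by (simp add: abs_mult mult_ac)
    then show "AE x in lborel. \<bar>f x * g x\<bar> \<le> 2 * exp b * L * \<bar>f x\<bar>" by simp
  qed (use L in auto)
  then show ?thesis by (simp add: mult_ac)
qed

text \<open>Product rule and induction on \<open>j\<close>. At j = 0 the second factor enters
  through its supremum, which is why it carries at least one derivative even then.\<close>

lemma sob_mult:
  assumes b: "0 \<le> b" and "j \<le> m" "1 \<le> m"
  shows "\<exists>A>0. \<forall>K L f g. sob b j K f \<longrightarrow> sob b m L g \<longrightarrow> sob b j (A * K * L) (\<lambda>x. f x * g x)"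
  using assms(2,3)
proof (induction j arbitrary: m)
  case 0
  show ?case using wl2_mult_sob[OF b _ _ 0(2)] by (auto intro!: exI[of _ "2 * exp b"])
next
  case (Suc j)
  obtain m' where m': "m = Suc m'" using Suc.prems by (cases m) auto
  obtain A where A: "A > 0" "\<And>K L f g. sob b j K f \<Longrightarrow> sob b m L g \<Longrightarrow> sob b j (A * K * L) (\<lambda>x. f x * g x)"
    using Suc.IH[of m] Suc.prems by auto
  \<comment> \<open>In the term f g' the roles are exchanged: g' is used only to order j, so f, of
    order j + 1, acts as the more regular factor.\<close>
  obtain B where B: "B > 0" "\<And>K L f g. sob b j K f \<Longrightarrow> sob b (Suc j) L g \<Longrightarrow> sob b j (B * K * L) (\<lambda>x. f x * g x)"
    using Suc.IH[of "Suc j"] by auto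
  let ?C = "2 * exp b + A + B"
  have "sob b (Suc j) (?C * K * L) (\<lambda>x. f x * g x)" if f: "sob b (Suc j) K f" and g: "sob b m L g" for K L f g
  proof -
    obtain f' where f': "ac f f'" "sob b j K f'" "wl2 b K f" using f by (rule sob_SucE)
    obtain g' where g': "ac g g'" "sob b m' L g'" "wl2 b L g" using g unfolding m' by (rule sob_SucE)
    have KL: "0 < K" "0 < L" using f g sob_pos by blast+
    have g'j: "sob b j L g'" using g'(2) by (rule sob_le) (use Suc.prems m' in auto)
    have S: "sob b j (A * K * L + B * L * K) (\<lambda>x. f' x * g x + g' x * f x)"
      by (intro sob_add A B f' g f g'j)
    have E: "(\<lambda>x. f' x * g x + g' x * f x) = (\<lambda>x. f' x * g x + f x * g' x)"
      by (simp add: mult.commute)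
    have "A * K * L + B * L * K \<le> ?C * K * L"
      using mult_nonneg_nonneg[of "2 * exp b * K" L] KL by (simp add: algebra_simps)
    then have "sob b j (?C * K * L) (\<lambda>x. f' x * g x + f x * g' x)"
      by (rule sob_mono[OF S[unfolded E]])
    moreover have "wl2 b (?C * K * L) (\<lambda>x. f x * g x)"
    proof (rule wl2_mono[OF wl2_mult_sob[OF b f'(3) g Suc.prems(2)]])
      have "0 \<le> (A + B) * K * L" using KL A B by simp
      then show "2 * exp b * K * L \<le> ?C * K * L" by (simp add: algebra_simps)
    qed
    ultimately show ?thesis using ac_mult[OF f'(1) g'(1)] by (intro sob_SucI)
  qed
  moreover have "?C > 0" using A B by (intro add_pos_pos) auto
  ultimately show ?case by blast
qed

section \<open>Comparison of \<open>sob\<close> with the given Sobolev spaces and norms\<close>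

lemma has_weak_deriv_loc: "has_weak_deriv k f g \<Longrightarrow> loc_integrable f" "has_weak_deriv k f g \<Longrightarrow> loc_integrable g"
  by (auto simp: has_weak_deriv_def)

lemma has_weak_deriv_wderiv: "has_weak_deriv k f g \<Longrightarrow> has_weak_deriv k f (wderiv k f)"
  unfolding wderiv_def by (rule someI[of "has_weak_deriv k f"])

lemma wderiv_AE: "has_weak_deriv k f g \<Longrightarrow> ae_eq (wderiv k f) g"
  using has_weak_deriv_unique has_weak_deriv_wderiv by blast

lemma wderiv_measurable: "has_weak_deriv k f g \<Longrightarrow> wderiv k f \<in> borel_measurable borel"
  using has_weak_deriv_wderiv has_weak_deriv_loc(2) loc_integrableD(1) by blast

lemma wderiv_L2_le:
  assumes "has_weak_deriv k f g" "L2_le K g" shows "L2_le K (wderiv k f)"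
  by (rule L2_le_cong_AE[OF assms(2) wderiv_measurable[OF assms(1)]])
     (use wderiv_AE[OF assms(1)] in \<open>auto elim: eventually_mono\<close>)

text \<open>The predicates \<open>has_weak_deriv k f\<close> and \<open>has_weak_deriv k g\<close>
  coincide, so \<open>SOME\<close> returns literally the same representative.\<close>

lemma wderiv_cong_AE:
  assumes "f \<in> borel_measurable borel" "g \<in> borel_measurable borel" "ae_eq f g"
  shows "has_weak_deriv k f = has_weak_deriv k g" "wderiv k f = wderiv k g"
proof -
  have "has_weak_deriv k f h \<longleftrightarrow> has_weak_deriv k g h" for h
  proof
    assume h: "has_weak_deriv k f h"
    show "has_weak_deriv k g h"
      by (rule has_weak_deriv_cong_AE[OF h assms(2) _ assms(3)])
         (use h has_weak_deriv_loc loc_integrableD in auto)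
  next
    assume h: "has_weak_deriv k g h"
    show "has_weak_deriv k f h"
      by (rule has_weak_deriv_cong_AE[OF h assms(1)])
         (use h has_weak_deriv_loc loc_integrableD assms(3) in \<open>auto elim: eventually_mono\<close>)
  qed
  then show "has_weak_deriv k f = has_weak_deriv k g" by blast
  then show "wderiv k f = wderiv k g" by (simp add: wderiv_def)
qed

lemma sob_weak_derivs:
  "sob 0 m K f \<Longrightarrow> k \<le> m \<Longrightarrow> \<exists>g. has_weak_deriv k f g \<and> sob 0 (m - k) K g"
proof (induction k arbitrary: m f)
  case 0
  then have "loc_integrable f" using wl2_loc_integrable sob_wl2 by blast
  then show ?case using has_weak_deriv_0 0 by auto
next
  case (Suc k)
  then obtain m' where m: "m = Suc m'" by (cases m) auto
  then obtain f' where f': "ac f f'" "sob 0 m' K f'" using Suc.prems by (auto elim: sob_SucE)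
  from Suc.IH[OF f'(2)] Suc.prems m obtain g where "has_weak_deriv k f' g" "sob 0 (m' - k) K g" by auto
  then show ?case using has_weak_deriv_ac[OF f'(1)] m by auto
qed

lemma sob_0_L2_le: "sob 0 m K f \<Longrightarrow> L2_le K f"
  using sob_wl2[of 0 m K f] by (simp add: wl2_def)

lemma sob_H_space:
  assumes "f \<in> borel_measurable borel" "ae_eq f u" "sob 0 m K u"
  shows "f \<in> H_space (real m)" "H_norm (real m) f \<le> sqrt (real (Suc m)) * K"
proof -
  have u: "u \<in> borel_measurable borel" using assms(3) sob_wl2 wl2_measurable by blast
  have *: "\<exists>g. has_weak_deriv k f g \<and> L2_le K g" if "k \<le> m" for k
    using sob_weak_derivs[OF assms(3) that] sob_0_L2_le wderiv_cong_AE(1)[OF assms(1) u assms(2)] by metis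
  have L: "L2_le K f"
    by (rule L2_le_cong_AE[OF sob_0_L2_le[OF assms(3)] assms(1)])
       (use assms(2) in \<open>auto elim: eventually_mono\<close>)
  then show "f \<in> H_space (real m)"
    unfolding H_space_def using * by (auto simp: L2_le_iff)
  have "(LINT x|lborel. (wderiv k f x)\<^sup>2) \<le> K\<^sup>2" if k: "k \<le> m" for k
  proof -
    obtain g where "has_weak_deriv k f g" "L2_le K g" using *[OF k] by blast
    from wderiv_L2_le[OF this] show ?thesis by (simp add: L2_le_iff)
  qed
  then have "(\<Sum>k\<le>m. LINT x|lborel. (wderiv k f x)\<^sup>2) \<le> (\<Sum>k\<le>m. K\<^sup>2)"
    by (intro sum_mono) auto
  then have "H_norm (real m) f \<le> sqrt (real (Suc m) * K\<^sup>2)"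
    by (simp add: H_norm_def)
  also have "\<dots> = sqrt (real (Suc m)) * K"
    using sob_pos[OF assms(3)] by (simp only: real_sqrt_mult real_sqrt_abs abs_of_pos)
  finally show "H_norm (real m) f \<le> sqrt (real (Suc m)) * K" .
qed

text \<open>Representatives are built downwards from the top derivative: each weak derivative is the
  density of an absolutely continuous representative of the preceding one. Each summand of
  \<open>H_norm\<close> is bounded by the whole, so the constant K is preserved.\<close>

lemma H_space_sob:
  assumes f: "f \<in> H_space (real m)" and K: "H_norm (real m) f \<le> K" "0 < K"
  shows "\<exists>u. ae_eq f u \<and> sob 0 m K u"
proof -
  define g where "g k = wderiv k f" for k
  have ex: "\<exists>h. has_weak_deriv k f h \<and> h \<in> L2" if "k \<le> m" for k
    using f that by (auto simp: H_space_def)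
  have g: "has_weak_deriv k f (g k)" if "k \<le> m" for k
    using ex[OF that] has_weak_deriv_wderiv unfolding g_def by blast
  have gL: "L2_le K (g k)" if k: "k \<le> m" for k
  proof -
    obtain h where h: "has_weak_deriv k f h" "h \<in> L2" using ex[OF k] by blast
    have "L2_le (sqrt (LINT x|lborel. (h x)\<^sup>2) + 1) h"
    proof -
      have 0: "0 \<le> (LINT x|lborel. (h x)\<^sup>2)" by simp
      have "sqrt (LINT x|lborel. (h x)\<^sup>2) \<le> sqrt (LINT x|lborel. (h x)\<^sup>2) + 1" by simp
      from power_mono[OF this, of 2] have "(LINT x|lborel. (h x)\<^sup>2) \<le> (sqrt (LINT x|lborel. (h x)\<^sup>2) + 1)\<^sup>2"
        using 0 by simp
      moreover have "0 < sqrt (LINT x|lborel. (h x)\<^sup>2) + 1"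
        using real_sqrt_ge_zero[OF 0] by linarith
      ultimately show ?thesis using h(2) by (simp add: L2_le_iff)
    qed
    from wderiv_L2_le[OF h(1) this] have L: "g k \<in> L2" by (simp add: L2_le_iff g_def)
    have "(LINT x|lborel. (g k x)\<^sup>2) \<le> (\<Sum>j\<le>m. LINT x|lborel. (g j x)\<^sup>2)"
      by (rule member_le_sum) (use k in auto)
    also have "\<dots> = (H_norm (real m) f)\<^sup>2"
      by (simp add: H_norm_def g_def sum_nonneg)
    also have "\<dots> \<le> K\<^sup>2"
      using K by (intro power_mono) (auto simp: H_norm_def intro!: sum_nonneg)
    finally show ?thesis using L K by (simp add: L2_le_iff)
  qed
  have step: "has_weak_deriv 1 (g k) (g (Suc k))" if "Suc k \<le> m" for k
  proof -
    have *: "has_weak_deriv k f (g k)" "has_weak_deriv (Suc k) f (g (Suc k))" using g that by auto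
    have "(LINT x|lborel. g k x * deriv \<phi> x) = - (LINT x|lborel. g (Suc k) x * \<phi> x)" if t: "test_fun \<phi>" for \<phi>
    proof -
      have "(LINT x|lborel. f x * (deriv ^^ k) (deriv \<phi>) x) = (-1) ^ k * (LINT x|lborel. g k x * deriv \<phi> x)"
        using *(1) test_fun_deriv(1)[OF t] by (simp add: has_weak_deriv_def)
      moreover have "(LINT x|lborel. f x * (deriv ^^ Suc k) \<phi> x) = (-1) ^ Suc k * (LINT x|lborel. g (Suc k) x * \<phi> x)"
        using *(2) t unfolding has_weak_deriv_def by blast
      moreover have "(deriv ^^ k) (deriv \<phi>) = (deriv ^^ Suc k) \<phi>"
        by (simp only: funpow_Suc_right o_apply)
      ultimately have "(-1) ^ k * (LINT x|lborel. g k x * deriv \<phi> x) = (-1) ^ k * (- (LINT x|lborel. g (Suc k) x * \<phi> x))"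
        by simp
      then show ?thesis by (simp only: mult_cancel_left) auto
    qed
    then show ?thesis using has_weak_deriv_loc(2)[OF *(1)] has_weak_deriv_loc(2)[OF *(2)]
      by (simp add: has_weak_deriv_def)
  qed
  have "\<exists>u. ae_eq (g (m - j)) u \<and> sob 0 j K u" if "j \<le> m" for j
    using that
  proof (induction j)
    case 0
    then show ?case using gL[of m] by (intro exI[of _ "g m"]) (simp add: wl2_def)
  next
    case (Suc j)
    then obtain u where u: "ae_eq (g (m - j)) u" "sob 0 j K u" by auto
    have S: "Suc (m - Suc j) = m - j" using Suc by simp
    have "has_weak_deriv 1 (g (m - Suc j)) (g (m - j))" using step[of "m - Suc j"] S Suc.prems by simp
    from has_weak_deriv_cong_AE[OF this _ _ _ u(1)] have "has_weak_deriv 1 (g (m - Suc j)) u"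
      using u(2) sob_wl2 wl2_measurable L2_leD(1)[OF gL] by simp
    then obtain v where v: "ae_eq (g (m - Suc j)) v" "ac v u" by (rule has_weak_deriv_1_ac)
    have "L2_le K v"
      by (rule L2_le_cong_AE[OF gL[of "m - Suc j"]])
         (use v ac_continuous borel_measurable_continuous_onI in auto)
    then have "sob 0 (Suc j) K v" using v u by (intro sob_SucI[of 0 K v u]) (auto simp: wl2_def)
    then show ?case using v by blast
  qed
  from this[of m] obtain u where u: "ae_eq (g 0) u" "sob 0 m K u" by auto
  have "ae_eq f (g 0)"
    using has_weak_deriv_unique[OF has_weak_deriv_0 g[of 0]] has_weak_deriv_loc(1)[OF g[of 0]] by simp
  with u have "ae_eq f u" by auto
  with u show ?thesis by blast
qed

lemma sob_weaken: "0 \<le> b \<Longrightarrow> sob b m K f \<Longrightarrow> sob 0 m K f"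
proof (induction m arbitrary: f)
  case 0 then show ?case using wl2_L2_le by (auto simp: wl2_def)
next
  case (Suc m)
  then show ?case using wl2_L2_le by (auto simp: wl2_def)
qed

lemma Hw_space_sob:
  assumes "0 \<le> b"
  shows "\<exists>A>0. \<forall>f K. f \<in> Hw_space (real m) b \<longrightarrow> Hw_norm (real m) b f \<le> K \<longrightarrow> 0 < K \<longrightarrow>
    (\<exists>u. ae_eq f u \<and> sob b m (A * K) u)"
proof -
  obtain A where A: "A > 0" "\<And>K f. sob 0 m K f \<Longrightarrow> sob (0 - (-b)) m (A * K) (\<lambda>x. wt (-b) x * f x)"
    using sob_wt[of 0 m "-b"] by blast
  have "\<exists>u. ae_eq f u \<and> sob b m (A * K) u"
    if f: "f \<in> Hw_space (real m) b" "Hw_norm (real m) b f \<le> K" "0 < K" for f K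
  proof -
    have w: "(\<lambda>x. cosh x powr b * f x) = (\<lambda>x. wt b x * f x)" by (simp add: wt_def)
    obtain U where U: "ae_eq (\<lambda>x. wt b x * f x) U" "sob 0 m K U"
      using H_space_sob[of "\<lambda>x. wt b x * f x" m K] f by (auto simp: Hw_space_def Hw_norm_def w)
    have "ae_eq f (\<lambda>x. wt (-b) x * U x)"
      using U(1)
    proof eventually_elim
      case (elim x)
      have "f x = (wt (-b) x * wt b x) * f x" by (simp add: wt_uminus)
      then show ?case using elim by (simp add: mult.assoc)
    qed
    then show ?thesis using A(2)[OF U(2)] by auto
  qed
  with A show ?thesis by blast
qed


text \<open>The triangle inequality gives 4, and Cauchy-Schwarz for the integral of G' over an
  interval of length |h| gives h^2. In the fractional seminorm the first controls large h, the
  second the singularity at h = 0.\<close>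

lemma translation_bound:
  assumes G: "ac G G'" "L2_le K G" "L2_le K G'"
  shows "(\<integral>\<^sup>+x. ennreal ((G (x + h) - G x)\<^sup>2) \<partial>lborel) \<le> ennreal (min 4 (h\<^sup>2) * K\<^sup>2)"
proof -
  note [measurable] = L2_leD(1)[OF G(2)] L2_leD(1)[OF G(3)]
  have K: "0 < K" using L2_leD(2) G by blast
  have two: "(\<integral>\<^sup>+x. ennreal ((G (x + h) - G x)\<^sup>2) \<partial>lborel) \<le> ennreal (4 * K\<^sup>2)"
  proof -
    have "L2_le K (\<lambda>x. - G x)" using L2_le_bound[OF G(2), of "\<lambda>x. - G x" 1] by simp
    from L2_leD(3)[OF L2_le_add[OF L2_le_shift[OF G(2), of h] this]]
    show ?thesis by (simp add: power_mult_distrib mult_2[symmetric])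
  qed
  have pos: "(\<integral>\<^sup>+x. ennreal ((G (x + h) - G x)\<^sup>2) \<partial>lborel) \<le> ennreal (h\<^sup>2 * K\<^sup>2)" if h: "0 < h" for h
  proof -
    have L: "G' \<in> L2" using G(3) by (simp add: L2_le_iff)
    have "(\<integral>\<^sup>+x. ennreal ((G (x + h) - G x)\<^sup>2) \<partial>lborel) \<le>
        (\<integral>\<^sup>+x. (\<integral>\<^sup>+t. ennreal h * indicator {0..h} t * ennreal ((G' (x + t))\<^sup>2) \<partial>lborel) \<partial>lborel)"
    proof (rule nn_integral_mono)
      fix x
      have L': "(\<lambda>t. G' (x + t)) \<in> L2"
        using L2_le_shift[OF G(3), of x] by (simp add: L2_le_iff add.commute)
      have "ac (\<lambda>t. G (t + x)) (\<lambda>t. G' (t + x))" by (rule ac_shift[OF G(1)])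
      from acD(2)[OF this, of 0 h] h have "G (x + h) - G x = (LINT t:{0..0+h}|lborel. G' (x + t))"
        by (simp add: add.commute)
      then have "\<bar>G (x + h) - G x\<bar> \<le> (LINT t:{0..0+h}|lborel. \<bar>G' (x + t)\<bar>)"
        using set_integral_norm_bound[OF loc_integrableD(2)[OF L2_loc_integrable[OF L']]] by simp
      then have "\<bar>G (x + h) - G x\<bar>\<^sup>2 \<le> (LINT t:{0..0+h}|lborel. \<bar>G' (x + t)\<bar>)\<^sup>2"
        by (rule power_mono) simp
      also have "\<dots> \<le> h * (LINT t:{0..0+h}|lborel. (G' (x + t))\<^sup>2)"
        by (rule L2_interval_average[OF L' h])
      finally have "ennreal ((G (x + h) - G x)\<^sup>2) \<le> ennreal (h * (LINT t:{0..0+h}|lborel. (G' (x + t))\<^sup>2))"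
        by (intro ennreal_leI) simp
      also have "\<dots> = ennreal h * ennreal (LINT t:{0..0+h}|lborel. (G' (x + t))\<^sup>2)"
        using h by (intro ennreal_mult) (auto simp: set_lebesgue_integral_def)
      also have "ennreal (LINT t:{0..0+h}|lborel. (G' (x + t))\<^sup>2) =
          (\<integral>\<^sup>+t. ennreal (indicator {0..h} t *\<^sub>R (G' (x + t))\<^sup>2) \<partial>lborel)"
        unfolding set_lebesgue_integral_def add_0
        by (rule nn_integral_eq_integral[symmetric], rule integrable_mult_indicator)
           (use L' in \<open>auto simp: L2_def\<close>)
      also have "ennreal h * \<dots> = (\<integral>\<^sup>+t. ennreal h * ennreal (indicator {0..h} t *\<^sub>R (G' (x + t))\<^sup>2) \<partial>lborel)"
        by (rule nn_integral_cmult[symmetric]) auto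
      also have "\<dots> = (\<integral>\<^sup>+t. ennreal h * indicator {0..h} t * ennreal ((G' (x + t))\<^sup>2) \<partial>lborel)"
        by (intro nn_integral_cong) (auto simp: indicator_def)
      finally show "ennreal ((G (x + h) - G x)\<^sup>2) \<le> (\<integral>\<^sup>+t. ennreal h * indicator {0..h} t * ennreal ((G' (x + t))\<^sup>2) \<partial>lborel)" .
    qed
    also have "\<dots> = (\<integral>\<^sup>+t. (\<integral>\<^sup>+x. ennreal h * indicator {0..h} t * ennreal ((G' (x + t))\<^sup>2) \<partial>lborel) \<partial>lborel)"
      by (rule lborel_pair.Fubini'[symmetric]) measurable
    also have "\<dots> = (\<integral>\<^sup>+t. ennreal h * indicator {0..h} t * (\<integral>\<^sup>+x. ennreal ((G' (x + t))\<^sup>2) \<partial>lborel) \<partial>lborel)"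
      by (intro nn_integral_cong nn_integral_cmult) auto
    also have "\<dots> \<le> (\<integral>\<^sup>+t. ennreal h * indicator {0..h} t * ennreal (K\<^sup>2) \<partial>lborel)"
      using L2_leD(3)[OF L2_le_shift[OF G(3)]] by (intro nn_integral_mono mult_left_mono) auto
    also have "\<dots> = ennreal h * ennreal h * ennreal (K\<^sup>2)"
      using h by (simp add: nn_integral_multc nn_integral_cmult)
    also have "\<dots> = ennreal (h\<^sup>2 * K\<^sup>2)"
      using h by (simp add: ennreal_mult power2_eq_square)
    finally show ?thesis .
  qed
  have "(\<integral>\<^sup>+x. ennreal ((G (x + h) - G x)\<^sup>2) \<partial>lborel) \<le> ennreal (h\<^sup>2 * K\<^sup>2)"
  proof -
    consider "h = 0" | "h > 0" | "h < 0" by linarith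
    then show ?thesis
    proof cases
      case 3
      have "(\<integral>\<^sup>+x. ennreal ((G (x + h) - G x)\<^sup>2) \<partial>lborel) =
          (\<integral>\<^sup>+x. ennreal ((G (x + (-h) + h) - G (x + (-h)))\<^sup>2) \<partial>lborel)"
        using nn_integral_real_affine[of "\<lambda>x. ennreal ((G (x + h) - G x)\<^sup>2)" 1 "-h"] by (simp add: add.commute)
      also have "\<dots> = (\<integral>\<^sup>+x. ennreal ((G (x + (-h)) - G x)\<^sup>2) \<partial>lborel)"
        by (simp add: power2_commute)
      also have "\<dots> \<le> ennreal ((-h)\<^sup>2 * K\<^sup>2)" by (rule pos) (use 3 in simp)
      finally show ?thesis by simp
    qed (use pos in auto)
  qed
  with two show ?thesis by (auto simp: min_def)
qed

text \<open>Near zero the integrand is at most |h|^(1 - 2 \<theta>), integrable because \<theta> <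
  1; for |h| > 1 it is at most 4 |h|^(-1 - 2 \<theta>), integrable because \<theta> > 0.\<close>

lemma gagliardo_kernel_finite:
  assumes "0 < \<theta>" "\<theta> < 1"
  shows "(\<integral>\<^sup>+h. ennreal (min 4 (h\<^sup>2) * \<bar>h\<bar> powr - (1 + 2 * \<theta>)) \<partial>lborel) < \<infinity>"
proof -
  define P where "P h = ennreal (indicator {0..1} h * h powr (1 - 2 * \<theta>)) +
    4 * (ennreal (h powr (- (2 * \<theta>) - 1)) * indicator {1..} h)" for h
  have [measurable]: "P \<in> borel_measurable borel" unfolding P_def[abs_def] by measurable
  have le: "ennreal (min 4 (h\<^sup>2) * \<bar>h\<bar> powr - (1 + 2 * \<theta>)) \<le> P \<bar>h\<bar>" for h
  proof (cases "\<bar>h\<bar> \<le> 1")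
    case True
    have "min 4 (h\<^sup>2) * \<bar>h\<bar> powr - (1 + 2 * \<theta>) \<le> \<bar>h\<bar> powr (1 - 2 * \<theta>)"
    proof (cases "h = 0")
      case False
      have h2: "h\<^sup>2 = \<bar>h\<bar> powr 2" using False by (simp add: powr_numeral)
      have "min 4 (h\<^sup>2) * \<bar>h\<bar> powr - (1 + 2 * \<theta>) \<le> h\<^sup>2 * \<bar>h\<bar> powr - (1 + 2 * \<theta>)"
        by (intro mult_right_mono) auto
      also have "\<dots> = \<bar>h\<bar> powr 2 * \<bar>h\<bar> powr - (1 + 2 * \<theta>)" by (simp only: h2)
      also have "\<bar>h\<bar> powr 2 * \<bar>h\<bar> powr - (1 + 2 * \<theta>) = \<bar>h\<bar> powr (1 - 2 * \<theta>)"
        by (simp only: powr_add[symmetric]) simp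
      finally show ?thesis .
    qed simp
    then show ?thesis using True by (auto simp: P_def intro!: ennreal_leI add_increasing2)
  next
    case False
    have "min 4 (h\<^sup>2) * \<bar>h\<bar> powr - (1 + 2 * \<theta>) \<le> 4 * \<bar>h\<bar> powr (- (2 * \<theta>) - 1)"
    proof -
      have "- (1 + 2 * \<theta>) = - (2 * \<theta>) - 1" by simp
      then show ?thesis by (simp only:) (intro mult_right_mono, auto)
    qed
    then have "ennreal (min 4 (h\<^sup>2) * \<bar>h\<bar> powr - (1 + 2 * \<theta>)) \<le> ennreal (4 * \<bar>h\<bar> powr (- (2 * \<theta>) - 1))"
      by (rule ennreal_leI)
    then show ?thesis using False by (simp add: P_def ennreal_mult)
  qed
  obtain I where I: "((\<lambda>h. h powr (1 - 2 * \<theta>)) has_integral I) {0..1}"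
    using integrable_on_powr_from_0[of "1 - 2 * \<theta>" 1] assms by (auto simp: integrable_on_def)
  have 1: "(\<integral>\<^sup>+h. ennreal (indicator {0..1} h * h powr (1 - 2 * \<theta>)) \<partial>lborel) < \<infinity>"
    by (subst nn_integral_has_integral_lebesgue[OF _ I]) auto
  have lim: "((\<lambda>x. - (x powr (- (2 * \<theta>))) / (2 * \<theta>)) \<longlongrightarrow> - 0 / (2 * \<theta>)) at_top"
    by (intro tendsto_intros tendsto_neg_powr filterlim_ident) (use assms in auto)
  have 2: "(\<integral>\<^sup>+h. ennreal (h powr (- (2 * \<theta>) - 1)) * indicator {1..} h \<partial>lborel) < \<infinity>"
    by (subst nn_integral_FTC_atLeast[OF _ _ _ lim])
       (use assms in \<open>auto intro!: derivative_eq_intros simp: field_simps\<close>)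
  have P: "(\<integral>\<^sup>+h. P h \<partial>lborel) < \<infinity>"
    using 1 2 by (simp add: P_def nn_integral_add nn_integral_cmult ennreal_mult_less_top)
  have "(\<integral>\<^sup>+h. ennreal (min 4 (h\<^sup>2) * \<bar>h\<bar> powr - (1 + 2 * \<theta>)) \<partial>lborel) \<le> (\<integral>\<^sup>+h. P h + P (-h) \<partial>lborel)"
  proof (rule nn_integral_mono)
    fix h
    have "P \<bar>h\<bar> \<le> P h + P (-h)" by (cases "0 \<le> h") (auto simp: add_increasing add_increasing2)
    then show "ennreal (min 4 (h\<^sup>2) * \<bar>h\<bar> powr - (1 + 2 * \<theta>)) \<le> P h + P (-h)"
      using le[of h] by (rule order_trans[rotated])
  qed
  also have "\<dots> = (\<integral>\<^sup>+h. P h \<partial>lborel) + (\<integral>\<^sup>+h. P (-h) \<partial>lborel)"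
    by (rule nn_integral_add) auto
  also have "(\<integral>\<^sup>+h. P (-h) \<partial>lborel) = (\<integral>\<^sup>+h. P h \<partial>lborel)"
    using nn_integral_real_affine[of P "-1" 0] by simp
  finally show ?thesis using P by (auto intro: le_less_trans)
qed

text \<open>With y = x + h and Tonelli the double integral becomes an integral over h of the kernel
  times the squared L2 norm of G(x + h) - G(x). Thus one full derivative controls every fraction of
  it.\<close>

lemma gagliardo_bound:
  assumes \<theta>: "0 < \<theta>" "\<theta> < 1"
  shows "\<exists>C\<ge>0. \<forall>G G' K g. ac G G' \<longrightarrow> L2_le K G \<longrightarrow> L2_le K G' \<longrightarrow> g \<in> borel_measurable borel \<longrightarrow> ae_eq g G \<longrightarrow>
    integrable (lborel \<Otimes>\<^sub>M lborel) (gagliardo_quotient \<theta> g) \<and>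
    (LINT z|(lborel \<Otimes>\<^sub>M lborel). gagliardo_quotient \<theta> g z) \<le> C * K\<^sup>2"
proof -
  define T where "T = (\<integral>\<^sup>+h. ennreal (min 4 (h\<^sup>2) * \<bar>h\<bar> powr - (1 + 2 * \<theta>)) \<partial>lborel)"
  obtain C where C: "T = ennreal C" "0 \<le> C"
    using gagliardo_kernel_finite[OF \<theta>] unfolding T_def[symmetric] by (cases T) auto
  have "integrable (lborel \<Otimes>\<^sub>M lborel) (gagliardo_quotient \<theta> g) \<and>
    (LINT z|(lborel \<Otimes>\<^sub>M lborel). gagliardo_quotient \<theta> g z) \<le> C * K\<^sup>2"
    if G: "ac G G'" "L2_le K G" "L2_le K G'" and [measurable]: "g \<in> borel_measurable borel" and e: "ae_eq g G" for G G' K g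
  proof -
    note [measurable] = L2_leD(1)[OF G(2)]
    have meas: "gagliardo_quotient \<theta> g \<in> borel_measurable (lborel \<Otimes>\<^sub>M lborel)"
    proof -
      have "(\<lambda>p. (g (fst p) - g (snd p))\<^sup>2 / \<bar>fst p - snd p\<bar> powr (1 + 2 * \<theta>)) \<in> borel_measurable (lborel \<Otimes>\<^sub>M lborel)"
        by measurable
      then show ?thesis by (simp add: gagliardo_quotient_def case_prod_beta')
    qed
    have "(\<integral>\<^sup>+z. ennreal (gagliardo_quotient \<theta> g z) \<partial>(lborel \<Otimes>\<^sub>M lborel)) =
        (\<integral>\<^sup>+x. (\<integral>\<^sup>+y. ennreal (gagliardo_quotient \<theta> g (x, y)) \<partial>lborel) \<partial>lborel)"
      by (rule lborel.nn_integral_fst[symmetric]) (use meas in measurable)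
    also have "\<dots> = (\<integral>\<^sup>+x. (\<integral>\<^sup>+y. ennreal (gagliardo_quotient \<theta> G (x, y)) \<partial>lborel) \<partial>lborel)"
    proof (rule nn_integral_cong_AE)
      show "AE x in lborel. (\<integral>\<^sup>+y. ennreal (gagliardo_quotient \<theta> g (x, y)) \<partial>lborel) =
          (\<integral>\<^sup>+y. ennreal (gagliardo_quotient \<theta> G (x, y)) \<partial>lborel)"
        using e
      proof eventually_elim
        case (elim x)
        show ?case
          by (rule nn_integral_cong_AE) (use e elim in \<open>auto simp: gagliardo_quotient_def elim!: eventually_mono\<close>)
      qed
    qed
    also have "\<dots> = (\<integral>\<^sup>+x. (\<integral>\<^sup>+h. ennreal (\<bar>h\<bar> powr - (1 + 2 * \<theta>)) * ennreal ((G (x + h) - G x)\<^sup>2) \<partial>lborel) \<partial>lborel)"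
    proof (rule nn_integral_cong)
      fix x
      have "(\<integral>\<^sup>+y. ennreal (gagliardo_quotient \<theta> G (x, y)) \<partial>lborel) =
          (\<integral>\<^sup>+h. ennreal (gagliardo_quotient \<theta> G (x, x + h)) \<partial>lborel)"
        using nn_integral_real_affine[of "\<lambda>y. ennreal (gagliardo_quotient \<theta> G (x, y))" 1 x]
        by (simp add: gagliardo_quotient_def)
      also have "\<dots> = (\<integral>\<^sup>+h. ennreal (\<bar>h\<bar> powr - (1 + 2 * \<theta>)) * ennreal ((G (x + h) - G x)\<^sup>2) \<partial>lborel)"
      proof (rule nn_integral_cong)
        fix h
        have "gagliardo_quotient \<theta> G (x, x + h) = \<bar>h\<bar> powr - (1 + 2 * \<theta>) * (G (x + h) - G x)\<^sup>2"
          unfolding gagliardo_quotient_def prod.case powr_minus divide_inverse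
          by (simp add: power2_commute mult.commute)
        then show "ennreal (gagliardo_quotient \<theta> G (x, x + h)) =
            ennreal (\<bar>h\<bar> powr - (1 + 2 * \<theta>)) * ennreal ((G (x + h) - G x)\<^sup>2)"
          by (simp only: ennreal_mult[symmetric] powr_ge_zero zero_le_power2)
      qed
      finally show "(\<integral>\<^sup>+y. ennreal (gagliardo_quotient \<theta> G (x, y)) \<partial>lborel) =
        (\<integral>\<^sup>+h. ennreal (\<bar>h\<bar> powr - (1 + 2 * \<theta>)) * ennreal ((G (x + h) - G x)\<^sup>2) \<partial>lborel)" .
    qed
    also have "\<dots> = (\<integral>\<^sup>+h. (\<integral>\<^sup>+x. ennreal (\<bar>h\<bar> powr - (1 + 2 * \<theta>)) * ennreal ((G (x + h) - G x)\<^sup>2) \<partial>lborel) \<partial>lborel)"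
      by (rule lborel_pair.Fubini'[symmetric]) measurable
    also have "\<dots> = (\<integral>\<^sup>+h. ennreal (\<bar>h\<bar> powr - (1 + 2 * \<theta>)) * (\<integral>\<^sup>+x. ennreal ((G (x + h) - G x)\<^sup>2) \<partial>lborel) \<partial>lborel)"
      by (intro nn_integral_cong nn_integral_cmult) auto
    also have "\<dots> \<le> (\<integral>\<^sup>+h. ennreal (\<bar>h\<bar> powr - (1 + 2 * \<theta>)) * ennreal (min 4 (h\<^sup>2) * K\<^sup>2) \<partial>lborel)"
      by (intro nn_integral_mono mult_left_mono translation_bound[OF G]) auto
    also have "\<dots> = (\<integral>\<^sup>+h. ennreal (min 4 (h\<^sup>2) * \<bar>h\<bar> powr - (1 + 2 * \<theta>)) * ennreal (K\<^sup>2) \<partial>lborel)"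
      by (intro nn_integral_cong) (simp add: ennreal_mult[symmetric] mult_ac)
    also have "\<dots> = ennreal (C * K\<^sup>2)"
      using C by (subst nn_integral_multc) (auto simp: T_def ennreal_mult)
    finally have le: "(\<integral>\<^sup>+z. ennreal (gagliardo_quotient \<theta> g z) \<partial>(lborel \<Otimes>\<^sub>M lborel)) \<le> ennreal (C * K\<^sup>2)" .
    have nonneg: "0 \<le> gagliardo_quotient \<theta> g z" for z by (auto simp: gagliardo_quotient_def case_prod_beta)
    have i: "integrable (lborel \<Otimes>\<^sub>M lborel) (gagliardo_quotient \<theta> g)"
      by (rule integrableI_nonneg[OF meas]) (use nonneg le in \<open>auto intro: le_less_trans\<close>)
    have "ennreal (LINT z|(lborel \<Otimes>\<^sub>M lborel). gagliardo_quotient \<theta> g z) \<le> ennreal (C * K\<^sup>2)"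
      using le nonneg by (subst nn_integral_eq_integral[OF i, symmetric]) auto
    then have "(LINT z|(lborel \<Otimes>\<^sub>M lborel). gagliardo_quotient \<theta> g z) \<le> C * K\<^sup>2"
      using C by (subst (asm) ennreal_le_iff) auto
    with i show ?thesis by blast
  qed
  with C show ?thesis by blast
qed


text \<open>A norm of non-integer order is dominated by the next integer order. The loss is
  harmless, because for smooth \<open>V\<close> the estimates are available at all integer
  orders.\<close>

lemma sob_H_space_real:
  assumes s: "0 \<le> s"
  shows "\<exists>m. \<exists>A>0. \<forall>f u K. f \<in> borel_measurable borel \<longrightarrow> ae_eq f u \<longrightarrow> sob 0 m K u \<longrightarrow>
    f \<in> H_space s \<and> H_norm s f \<le> A * K"
proof (cases "frac s = 0")
  case True
  then have "real (nat \<lfloor>s\<rfloor>) = s" using s by (simp add: frac_def)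
  then have "f \<in> H_space s \<and> H_norm s f \<le> sqrt (real (Suc (nat \<lfloor>s\<rfloor>))) * K"
    if "f \<in> borel_measurable borel" "ae_eq f u" "sob 0 (nat \<lfloor>s\<rfloor>) K u" for f u K
    using sob_H_space[OF that] by metis
  moreover have "sqrt (real (Suc (nat \<lfloor>s\<rfloor>))) > 0" by simp
  ultimately show ?thesis by blast
next
  case False
  define m where "m = nat \<lfloor>s\<rfloor>"
  have \<theta>: "0 < frac s" "frac s < 1" using False frac_ge_0[of s] frac_lt_1[of s] by linarith+
  obtain C where C: "C \<ge> 0" "\<And>G G' K g. ac G G' \<Longrightarrow> L2_le K G \<Longrightarrow> L2_le K G' \<Longrightarrow> g \<in> borel_measurable borel \<Longrightarrow> ae_eq g G \<Longrightarrow>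
    integrable (lborel \<Otimes>\<^sub>M lborel) (gagliardo_quotient (frac s) g) \<and>
    (LINT z|(lborel \<Otimes>\<^sub>M lborel). gagliardo_quotient (frac s) g z) \<le> C * K\<^sup>2"
    using gagliardo_bound[OF \<theta>] by blast
  let ?A = "sqrt (real (Suc m) + C)"
  have "f \<in> H_space s \<and> H_norm s f \<le> ?A * K"
    if f: "f \<in> borel_measurable borel" "ae_eq f u" "sob 0 (Suc m) K u" for f u K
  proof -
    have K: "0 < K" using f(3) sob_pos by blast
    note H = sob_H_space[OF f(1,2) sob_SucD[OF f(3)]]
    obtain G where "has_weak_deriv m u G" "sob 0 1 K G" using sob_weak_derivs[OF f(3), of m] by auto
    then obtain G' where G: "has_weak_deriv m u G" "ac G G'" "L2_le K G" "L2_le K G'"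
      by (auto simp: wl2_def)
    have u: "u \<in> borel_measurable borel" using f(3) sob_wl2 wl2_measurable by blast
    have fG: "has_weak_deriv m f G" using G(1) wderiv_cong_AE(1)[OF f(1) u f(2)] by simp
    from C(2)[OF G(2,3,4) wderiv_measurable[OF fG] wderiv_AE[OF fG]]
    have g: "integrable (lborel \<Otimes>\<^sub>M lborel) (gagliardo_quotient (frac s) (wderiv m f))"
      "(LINT z|(lborel \<Otimes>\<^sub>M lborel). gagliardo_quotient (frac s) (wderiv m f) z) \<le> C * K\<^sup>2" by auto
    have 1: "f \<in> H_space s" using H(1) g(1) s by (auto simp: H_space_def m_def)
    have "(\<Sum>k\<le>m. LINT x|lborel. (wderiv k f x)\<^sup>2) = (H_norm (real m) f)\<^sup>2"
      by (simp add: H_norm_def sum_nonneg)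
    also have "\<dots> \<le> (sqrt (real (Suc m)) * K)\<^sup>2"
      by (rule power_mono[OF H(2)]) (simp add: H_norm_def sum_nonneg)
    also have "\<dots> = real (Suc m) * K\<^sup>2" by (simp add: power_mult_distrib)
    finally have "H_norm s f \<le> sqrt ((real (Suc m) + C) * K\<^sup>2)"
      using g(2) False unfolding H_norm_def m_def[symmetric] by (simp add: algebra_simps)
    also have "\<dots> = ?A * K" using K by (simp only: real_sqrt_mult real_sqrt_abs abs_of_pos)
    finally show ?thesis using 1 by blast
  qed
  moreover have "?A > 0" using C(1) by (simp add: add_pos_nonneg)
  ultimately show ?thesis by blast
qed

lemma sob_Hw_space_lift:
  assumes b: "0 \<le> b" and B: "B > 0" "\<And>f u K. f \<in> borel_measurable borel \<Longrightarrow> ae_eq f u \<Longrightarrow> sob 0 m K u \<Longrightarrow>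
    f \<in> H_space s \<and> H_norm s f \<le> B * K"
  shows "\<exists>A>0. \<forall>f u K. f \<in> borel_measurable borel \<longrightarrow> ae_eq f u \<longrightarrow> sob b m K u \<longrightarrow>
    f \<in> Hw_space s b \<and> Hw_norm s b f \<le> A * K"
proof -
  obtain A where A: "A > 0" "\<And>K f. sob b m K f \<Longrightarrow> sob (b - b) m (A * K) (\<lambda>x. wt b x * f x)"
    using sob_wt[of b m b] by blast
  have "f \<in> Hw_space s b \<and> Hw_norm s b f \<le> (B * A) * K"
    if f: "f \<in> borel_measurable borel" "ae_eq f u" "sob b m K u" for f u K
  proof -
    have w: "(\<lambda>x. cosh x powr b * f x) = (\<lambda>x. wt b x * f x)" by (simp add: wt_def)
    have 1: "f \<in> H_space s" using B(2)[OF f(1,2) sob_weaken[OF b f(3)]] by blast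
    have m: "(\<lambda>x. wt b x * f x) \<in> borel_measurable borel" using f(1) by simp
    have e: "ae_eq (\<lambda>x. wt b x * f x) (\<lambda>x. wt b x * u x)" using f(2) by (auto elim: eventually_mono)
    note s = A(2)[OF f(3), simplified]
    show ?thesis using B(2)[OF m e s] 1 by (simp add: Hw_space_def Hw_norm_def w mult.assoc)
  qed
  moreover have "B * A > 0" using A B by simp
  ultimately show ?thesis by blast
qed

lemma sob_Hw_space:
  assumes "0 \<le> b"
  shows "\<exists>A>0. \<forall>f u K. f \<in> borel_measurable borel \<longrightarrow> ae_eq f u \<longrightarrow> sob b m K u \<longrightarrow>
    f \<in> Hw_space (real m) b \<and> Hw_norm (real m) b f \<le> A * K"
proof (rule sob_Hw_space_lift[OF assms])
  show "0 < sqrt (real (Suc m))" by simp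
qed (intro conjI sob_H_space)

lemma sob_Hw_space_real:
  assumes "0 \<le> s" "0 \<le> b"
  shows "\<exists>m. \<exists>A>0. \<forall>f u K. f \<in> borel_measurable borel \<longrightarrow> ae_eq f u \<longrightarrow> sob b m K u \<longrightarrow>
    f \<in> Hw_space s b \<and> Hw_norm s b f \<le> A * K"
proof -
  obtain m B where B: "B > 0" "\<And>f u K. f \<in> borel_measurable borel \<Longrightarrow> ae_eq f u \<Longrightarrow> sob 0 m K u \<Longrightarrow>
    f \<in> H_space s \<and> H_norm s f \<le> B * K" using sob_H_space_real[OF assms(1)] by blast
  show ?thesis by (rule exI[of _ m], rule sob_Hw_space_lift[OF assms(2) B(1)]) (rule B(2))
qed

section \<open>Nonlinear composition and the resonant kernel\<close>

lemma ac_unique_continuous: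
  assumes "ac f g" "ac f g'" "continuous_on UNIV g" "continuous_on UNIV g'" shows "g = g'"
  using continuous_AE_eq_imp_eq ac_unique assms by blast

text \<open>For m > 0 the derivative inside \<open>sob\<close> is one particular continuous
  function, so continuity of \<open>f1\<close> is what identifies the two; at order zero agreement
  almost everywhere suffices.\<close>

lemma sob_ac_D:
  assumes f: "sob b (Suc m) K f" and "ac f f1" and "m = 0 \<or> continuous_on UNIV f1"
  shows "sob b m K f1"
proof -
  obtain f' where f': "ac f f'" "sob b m K f'" using f by (rule sob_SucE)
  show ?thesis
  proof (cases m)
    case 0
    have "wl2 b K f1"
      by (rule wl2_cong_AE[OF _ _ ac_unique[OF f'(1) assms(2)]])
         (use f'(2) 0 loc_integrableD(1)[OF acD(1)[OF assms(2)]] in auto)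
    then show ?thesis by (simp add: 0)
  next
    case (Suc k)
    then have "continuous_on UNIV f'" "continuous_on UNIV f1"
      using sob_continuous f'(2) assms(3) by blast+
    then have "f' = f1" using ac_unique_continuous f'(1) assms(2) by blast
    then show ?thesis using f'(2) by simp
  qed
qed

lemma sob_2E:
  assumes "sob b 2 K f" obtains f1 f2 where "ac f f1" "ac f1 f2" "wl2 b K f" "wl2 b K f1" "wl2 b K f2"
  using assms by (auto simp: numeral_2_eq_2)

lemma wl2_zero: "0 < K \<Longrightarrow> wl2 b K (\<lambda>x. 0)"
  by (simp add: wl2_def L2_le_def)

lemma sob_zero: "0 < K \<Longrightarrow> sob b m K (\<lambda>x. 0)"
proof (induction m)
  case (Suc m) then show ?case using sob_SucI[OF wl2_zero ac_const] by blast
qed (simp add: wl2_zero)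

lemma Cd_bounded:
  assumes "Cd k F" shows "\<exists>M>0. \<forall>x. \<bar>x\<bar> \<le> R \<longrightarrow> \<bar>F x\<bar> \<le> M"
proof -
  have "compact (F ` {-R..R})"
    by (intro compact_continuous_image continuous_on_subset[OF Cd_continuous[OF assms]]) auto
  then obtain M where M: "\<And>x. x \<in> {-R..R} \<Longrightarrow> \<bar>F x\<bar> \<le> M"
    using compact_imp_bounded bounded_iff by (metis imageI real_norm_def)
  have "\<bar>F x\<bar> \<le> \<bar>M\<bar> + 1" if "\<bar>x\<bar> \<le> R" for x
    using M[of x] that by (auto simp: abs_le_iff)
  then show ?thesis by (intro exI[of _ "\<bar>M\<bar> + 1"]) auto
qed

lemma Cd_lipschitz:
  assumes "Cd (Suc k) F" shows "\<exists>M>0. \<forall>x y. \<bar>x\<bar> \<le> R \<longrightarrow> \<bar>y\<bar> \<le> R \<longrightarrow> \<bar>F x - F y\<bar> \<le> M * \<bar>x - y\<bar>"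
proof -
  obtain F' where F': "\<And>x. (F has_real_derivative F' x) (at x)" "Cd k F'" using assms by auto
  obtain M where M: "M > 0" "\<And>x. \<bar>x\<bar> \<le> R \<Longrightarrow> \<bar>F' x\<bar> \<le> M" using Cd_bounded[OF F'(2)] by blast
  have "\<bar>F x - F y\<bar> \<le> M * \<bar>x - y\<bar>" if "\<bar>x\<bar> \<le> R" "\<bar>y\<bar> \<le> R" for x y
    using field_differentiable_bound[of "{-R..R}" F F' M x y] F'(1) M(2) that
    by (auto simp: abs_le_iff intro: has_field_derivative_at_within)
  with M show ?thesis by blast
qed

lemma Cd_deriv: "Cd (Suc k) F \<Longrightarrow> (\<And>x. (F has_real_derivative F' x) (at x)) \<Longrightarrow> Cd k F'"
  by (metis Cd.simps(2) DERIV_unique ext)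

lemma ac_compose:
  assumes "\<And>x. (F has_real_derivative F' x) (at x)" "continuous_on UNIV F'"
    and "ac u u1" "continuous_on UNIV u1"
  shows "ac (\<lambda>x. F (u x)) (\<lambda>x. F' (u x) * u1 x)"
proof (rule DERIV_ac)
  show "((\<lambda>x. F (u x)) has_real_derivative F' (u x) * u1 x) (at x)" for x
    using DERIV_chain2[OF assms(1) ac_DERIV[OF assms(3,4)]] .
  show "continuous_on UNIV (\<lambda>x. F' (u x) * u1 x)"
    by (intro continuous_intros continuous_on_compose2[OF assms(2)] ac_continuous[OF assms(3)] assms(4)) auto
qed

text \<open>The derivative is arranged so that each summand contains a factor that is small with
  \<xi>: an increment of F', or \<xi>1.\<close>

lemma ac_compose_diff:
  assumes F: "\<And>x. (F has_real_derivative F' x) (at x)" "continuous_on UNIV F'"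
    and a: "ac a a1" "continuous_on UNIV a1" and x: "ac \<xi> \<xi>1" "continuous_on UNIV \<xi>1"
  shows "ac (\<lambda>x. F (a x + \<xi> x) - F (a x)) (\<lambda>x. (F' (a x + \<xi> x) - F' (a x)) * (a1 x + \<xi>1 x) + F' (a x) * \<xi>1 x)"
  using ac_diff[OF ac_compose[OF F ac_add[OF a(1) x(1)] continuous_on_add[OF a(2) x(2)]] ac_compose[OF F a]]
  by (simp add: algebra_simps)

lemma sob_sum_bounds:
  assumes b: "0 \<le> b" and h: "sob b (Suc k) K a" "sob b (Suc k) \<epsilon> \<xi>" "\<epsilon> \<le> K"
  shows "\<bar>a x\<bar> \<le> 4 * exp b * K" "\<bar>a x + \<xi> x\<bar> \<le> 4 * exp b * K"
proof -
  have "\<bar>a x\<bar> \<le> 2 * exp b * K" "\<bar>\<xi> x\<bar> \<le> 2 * exp b * K"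
    using sob_abs_bound[OF b h(1)] sob_abs_bound[OF b sob_mono[OF h(2,3)]] by blast+
  moreover have "0 \<le> 2 * exp b * K" using sob_pos[OF h(1)] by simp
  ultimately show "\<bar>a x\<bar> \<le> 4 * exp b * K" "\<bar>a x + \<xi> x\<bar> \<le> 4 * exp b * K" by linarith+
qed

lemma wl2_compose_diff:
  assumes b: "0 \<le> b" and F: "Cd (Suc j) F"
  shows "\<exists>A>0. \<forall>a \<xi> \<epsilon> k. sob b (Suc k) K a \<longrightarrow> sob b (Suc k) \<epsilon> \<xi> \<longrightarrow> \<epsilon> \<le> K \<longrightarrow>
      wl2 b (A * \<epsilon>) (\<lambda>x. F (a x + \<xi> x) - F (a x))"
proof -
  obtain M where M: "M > 0" "\<And>x y. \<bar>x\<bar> \<le> 4 * exp b * K \<Longrightarrow> \<bar>y\<bar> \<le> 4 * exp b * K \<Longrightarrow> \<bar>F x - F y\<bar> \<le> M * \<bar>x - y\<bar>"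
    using Cd_lipschitz[OF F] by blast
  have "wl2 b (M * \<epsilon>) (\<lambda>x. F (a x + \<xi> x) - F (a x))"
    if h: "sob b (Suc k) K a" "sob b (Suc k) \<epsilon> \<xi>" "\<epsilon> \<le> K" for a \<xi> \<epsilon> k
  proof (rule wl2_bound[OF sob_wl2[OF h(2)]])
    note [measurable] = wl2_measurable[OF sob_wl2[OF h(1)]] wl2_measurable[OF sob_wl2[OF h(2)]]
      borel_measurable_continuous_onI[OF Cd_continuous[OF F]]
    show "(\<lambda>x. F (a x + \<xi> x) - F (a x)) \<in> borel_measurable borel" by measurable
    have "\<bar>F (a x + \<xi> x) - F (a x)\<bar> \<le> M * \<bar>\<xi> x\<bar>" for x
      using M(2)[OF sob_sum_bounds(2)[OF b h, of x] sob_sum_bounds(1)[OF b h, of x]] by simp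
    then show "AE x in lborel. \<bar>F (a x + \<xi> x) - F (a x)\<bar> \<le> M * \<bar>\<xi> x\<bar>" by simp
  qed (use M in auto)
  with M show ?thesis by blast
qed

text \<open>Order at least two makes the first derivatives of the arguments continuous and bounded,
  as the base case m = 1 uses; from m = 2 on, \<open>max 2 m\<close> is just m. The point of the
  form is linearity in \<epsilon> with a constant uniform in a and \<xi>.\<close>

lemma sob_compose_diff:
  assumes b: "0 \<le> b" and K: "0 < K" and "1 \<le> m" "Cd (Suc m) F"
  shows "\<exists>A>0. \<forall>a \<xi> \<epsilon>. sob b (max 2 m) K a \<longrightarrow> sob b (max 2 m) \<epsilon> \<xi> \<longrightarrow> \<epsilon> \<le> K \<longrightarrow>
    sob b m (A * \<epsilon>) (\<lambda>x. F (a x + \<xi> x) - F (a x))"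
  using assms(3,4)
proof (induction m arbitrary: F rule: dec_induct)
  case base
  then obtain F' where F': "\<And>x. (F has_real_derivative F' x) (at x)" "Cd 1 F'" by auto
  obtain L0 where L0: "L0 > 0" "\<And>a \<xi> \<epsilon> k. sob b (Suc k) K a \<Longrightarrow> sob b (Suc k) \<epsilon> \<xi> \<Longrightarrow> \<epsilon> \<le> K \<Longrightarrow>
      wl2 b (L0 * \<epsilon>) (\<lambda>x. F (a x + \<xi> x) - F (a x))" using wl2_compose_diff[OF b base] by blast
  obtain L1 where L1: "L1 > 0" "\<And>a \<xi> \<epsilon> k. sob b (Suc k) K a \<Longrightarrow> sob b (Suc k) \<epsilon> \<xi> \<Longrightarrow> \<epsilon> \<le> K \<Longrightarrow>
      wl2 b (L1 * \<epsilon>) (\<lambda>x. F' (a x + \<xi> x) - F' (a x))" using wl2_compose_diff[OF b F'(2)[unfolded One_nat_def]] by blast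
  obtain M1 where M1: "M1 > 0" "\<And>x. \<bar>x\<bar> \<le> 4 * exp b * K \<Longrightarrow> \<bar>F' x\<bar> \<le> M1" using Cd_bounded[OF F'(2)] by blast
  have "sob b 1 ((L0 + (4 * exp b * K) * L1 + M1) * \<epsilon>) (\<lambda>x. F (a x + \<xi> x) - F (a x))"
    if h: "sob b (max 2 1) K a" "sob b (max 2 1) \<epsilon> \<xi>" "\<epsilon> \<le> K" for a \<xi> \<epsilon>
  proof -
    have h': "sob b (Suc 1) K a" "sob b (Suc 1) \<epsilon> \<xi>" using h by (simp_all add: numeral_2_eq_2)
    obtain a1 where a: "ac a a1" "sob b 1 K a1" using h'(1) by (rule sob_SucE)
    obtain \<xi>1 where x: "ac \<xi> \<xi>1" "sob b 1 \<epsilon> \<xi>1" using h'(2) by (rule sob_SucE)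
    have e: "0 < \<epsilon>" using x sob_pos by blast
    have c: "continuous_on UNIV a1" "continuous_on UNIV \<xi>1" using a x sob_continuous[of b 0] by auto
    have F'c: "continuous_on UNIV F'" using Cd_continuous F' by blast
    have "wl2 b ((4 * exp b * K) * (L1 * \<epsilon>) + M1 * \<epsilon>) (\<lambda>x. (F' (a x + \<xi> x) - F' (a x)) * (a1 x + \<xi>1 x) + F' (a x) * \<xi>1 x)"
    proof (rule wl2_add)
      have "\<bar>a1 x + \<xi>1 x\<bar> \<le> 4 * exp b * K" for x
        using sob_sum_bounds(2)[OF b, of 0 K a1 \<epsilon> \<xi>1 x] a x h(3) by simp
      then show "wl2 b ((4 * exp b * K) * (L1 * \<epsilon>)) (\<lambda>x. (F' (a x + \<xi> x) - F' (a x)) * (a1 x + \<xi>1 x))"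
        using K by (intro wl2_bound[OF L1(2)[OF h' h(3)]] AE_I2)
          (auto simp: abs_mult mult.commute[of "4 * exp b * K"]
            intro!: mult_left_mono borel_measurable_continuous_onI continuous_intros
            continuous_on_compose2[OF F'c] ac_continuous[OF a(1)] ac_continuous[OF x(1)] c)
      show "wl2 b (M1 * \<epsilon>) (\<lambda>x. F' (a x) * \<xi>1 x)"
        using M1 sob_sum_bounds(1)[OF b h' h(3)]
        by (intro wl2_bound[OF sob_wl2[OF x(2)]])
          (auto simp: abs_mult intro!: mult_right_mono borel_measurable_continuous_onI continuous_intros
            continuous_on_compose2[OF F'c] ac_continuous[OF a(1)] c)
    qed
    from sob_SucI[OF L0(2)[OF h' h(3), THEN wl2_mono] ac_compose_diff[OF F'(1) F'c a(1) c(1) x(1) c(2)],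
        of "(L0 + (4 * exp b * K) * L1 + M1) * \<epsilon>" 0] this[THEN wl2_mono, of "(L0 + (4 * exp b * K) * L1 + M1) * \<epsilon>"]
    show ?thesis using L0(1) L1(1) M1(1) K e by (simp add: algebra_simps)
  qed
  moreover have "0 < L0 + (4 * exp b * K) * L1 + M1" using L0 L1 M1 K by (intro add_pos_pos mult_pos_pos) auto
  ultimately show ?case by blast
next
  case (step m)
  then obtain F' where F': "\<And>x. (F has_real_derivative F' x) (at x)" "Cd (Suc m) F'" by auto
  obtain L0 where L0: "L0 > 0" "\<And>a \<xi> \<epsilon> k. sob b (Suc k) K a \<Longrightarrow> sob b (Suc k) \<epsilon> \<xi> \<Longrightarrow> \<epsilon> \<le> K \<Longrightarrow>
      wl2 b (L0 * \<epsilon>) (\<lambda>x. F (a x + \<xi> x) - F (a x))" using wl2_compose_diff[OF b step.prems] by blast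
  obtain L1 where L1: "L1 > 0" "\<And>a \<xi> \<epsilon>. sob b (max 2 m) K a \<Longrightarrow> sob b (max 2 m) \<epsilon> \<xi> \<Longrightarrow> \<epsilon> \<le> K \<Longrightarrow>
      sob b m (L1 * \<epsilon>) (\<lambda>x. F' (a x + \<xi> x) - F' (a x))" using step.IH[OF F'(2)] by blast
  obtain P where P: "P > 0" "\<And>K L f g. sob b m K f \<Longrightarrow> sob b m L g \<Longrightarrow> sob b m (P * K * L) (\<lambda>x. f x * g x)"
    using sob_mult[OF b, of m m] step.hyps by auto
  let ?B = "2 * P * L1 * K + (\<bar>F' 0\<bar> + 1) + P * L1 * K"
  have B: "?B > 0" using P L1 K by (intro add_pos_pos mult_pos_pos add_nonneg_pos) auto
  have "sob b (Suc m) ((L0 + ?B) * \<epsilon>) (\<lambda>x. F (a x + \<xi> x) - F (a x))"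
    if h: "sob b (max 2 (Suc m)) K a" "sob b (max 2 (Suc m)) \<epsilon> \<xi>" "\<epsilon> \<le> K" for a \<xi> \<epsilon>
  proof -
    have h': "sob b (Suc m) K a" "sob b (Suc m) \<epsilon> \<xi>" using h step.hyps by (simp_all add: max_def split: if_splits)
    have l: "max 2 m \<le> Suc m" using step.hyps by simp
    obtain a1 where a: "ac a a1" "sob b m K a1" using h'(1) by (rule sob_SucE)
    obtain \<xi>1 where x: "ac \<xi> \<xi>1" "sob b m \<epsilon> \<xi>1" using h'(2) by (rule sob_SucE)
    have e: "0 < \<epsilon>" using x sob_pos by blast
    obtain m' where m': "m = Suc m'" using step.hyps by (cases m) auto
    have c: "continuous_on UNIV a1" "continuous_on UNIV \<xi>1"
      using a x sob_continuous unfolding m' by blast+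
    have F'c: "continuous_on UNIV F'" using Cd_continuous F' by blast
    have s1: "sob b m (L1 * \<epsilon>) (\<lambda>x. F' (a x + \<xi> x) - F' (a x))"
      by (rule L1(2)[OF sob_le[OF h'(1) l] sob_le[OF h'(2) l] h(3)])
    have s2: "sob b m (K + \<epsilon>) (\<lambda>x. a1 x + \<xi>1 x)" by (rule sob_add[OF a(2) x(2)])
    \<comment> \<open>F' (a x) need not decay, so F' 0 is split off; the rest is the induction
      hypothesis with base point 0 and increment \<open>a\<close>.\<close>
    have s3: "sob b m (L1 * K) (\<lambda>x. F' (a x) - F' 0)"
      using L1(2)[OF sob_zero[OF K] sob_le[OF h'(1) l]] by simp
    have "sob b m (P * (L1 * \<epsilon>) * (K + \<epsilon>) + ((\<bar>F' 0\<bar> + 1) * \<epsilon> + P * (L1 * K) * \<epsilon>))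
      (\<lambda>x. (F' (a x + \<xi> x) - F' (a x)) * (a1 x + \<xi>1 x) + (F' 0 * \<xi>1 x + (F' (a x) - F' 0) * \<xi>1 x))"
      by (intro sob_add P(2) sob_cmult s1 s2 s3 x)
    moreover have "(\<lambda>x. (F' (a x + \<xi> x) - F' (a x)) * (a1 x + \<xi>1 x) + (F' 0 * \<xi>1 x + (F' (a x) - F' 0) * \<xi>1 x)) =
      (\<lambda>x. (F' (a x + \<xi> x) - F' (a x)) * (a1 x + \<xi>1 x) + F' (a x) * \<xi>1 x)"
      by (simp add: fun_eq_iff algebra_simps)
    ultimately have S: "sob b m (P * (L1 * \<epsilon>) * (K + \<epsilon>) + ((\<bar>F' 0\<bar> + 1) * \<epsilon> + P * (L1 * K) * \<epsilon>))
      (\<lambda>x. (F' (a x + \<xi> x) - F' (a x)) * (a1 x + \<xi>1 x) + F' (a x) * \<xi>1 x)" by (simp only:)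
    have "P * (L1 * \<epsilon>) * (K + \<epsilon>) \<le> P * (L1 * \<epsilon>) * (2 * K)"
      using P L1 e h(3) by (intro mult_left_mono) auto
    then have "P * (L1 * \<epsilon>) * (K + \<epsilon>) + ((\<bar>F' 0\<bar> + 1) * \<epsilon> + P * (L1 * K) * \<epsilon>) \<le> ?B * \<epsilon>"
      by (simp add: algebra_simps)
    also have "\<dots> \<le> (L0 + ?B) * \<epsilon>" using L0(1) e by (intro mult_right_mono) auto
    finally have le: "P * (L1 * \<epsilon>) * (K + \<epsilon>) + ((\<bar>F' 0\<bar> + 1) * \<epsilon> + P * (L1 * K) * \<epsilon>) \<le> (L0 + ?B) * \<epsilon>" .
    have le2: "L0 * \<epsilon> \<le> (L0 + ?B) * \<epsilon>" using B e by (intro mult_right_mono) auto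
    show ?thesis
      by (rule sob_SucI[OF wl2_mono[OF L0(2)[OF h' h(3)] le2]
          ac_compose_diff[OF F'(1) F'c a(1) c(1) x(1) c(2)] sob_mono[OF S le]])
  qed
  moreover have "L0 + ?B > 0" using L0 B by linarith
  ultimately show ?case by blast
qed

section \<open>Algebra of convolutions and the resonant kernel\<close>

lemma conv_diff:
  assumes k: "continuous_on UNIV k" and "loc_integrable f" "loc_integrable g"
  shows "conv k (\<lambda>x. f x - g x) x = conv k f x - conv k g x"
proof -
  have i: "set_integrable lborel {-1/2..1/2} (\<lambda>t. k t * h (x - t))" if h: "loc_integrable h" for h
  proof -
    have "loc_integrable (\<lambda>t. h (x - t))"
    proof -
      note [measurable] = loc_integrableD(1)[OF h]
      have "set_integrable lborel {a..b} (\<lambda>t. h (x - t))" for a b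
      proof -
        have "integrable lborel (\<lambda>t. indicator {x-b..x-a} (x + (-1) * t) *\<^sub>R h (x + (-1) * t))"
          by (rule lborel_integrable_real_affine[of "\<lambda>t. indicator {x-b..x-a} t *\<^sub>R h t"])
             (use loc_integrableD(2)[OF h] in \<open>auto simp: set_integrable_def\<close>)
        moreover have "(\<lambda>t. indicator {x-b..x-a} (x + (-1) * t) *\<^sub>R h (x + (-1) * t)) = (\<lambda>t. indicator {a..b} t *\<^sub>R h (x - t))"
          by (auto simp: indicator_def fun_eq_iff)
        ultimately show ?thesis by (simp add: set_integrable_def)
      qed
      then show ?thesis by (simp add: loc_integrable_def)
    qed
    from loc_integrableD(2)[OF loc_integrable_mult_continuous[OF k this]] show ?thesis .
  qed
  show ?thesis unfolding conv_def
    by (subst set_integral_diff(2)[OF i[OF assms(2)] i[OF assms(3)], symmetric]) (simp add: right_diff_distrib)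
qed

lemma conv_cmult: "conv k (\<lambda>x. c * f x) x = c * conv k f x"
  unfolding conv_def by (simp only: mult.left_commute[of _ c] set_integral_mult_right)

lemma conv_cong_AE:
  assumes [measurable]: "k \<in> borel_measurable borel" "f \<in> borel_measurable borel" "g \<in> borel_measurable borel"
    and e: "ae_eq f g"
  shows "conv k f x = conv k g x"
proof -
  have "AE t in lborel. f (x - t) = g (x - t)"
  proof -
    have "AE t in lborel. f (x + (-1) * t) = g (x + (-1) * t)"
      by (rule AE_borel_affine[of "-1" "\<lambda>t. f t = g t"]) (use e in auto)
    then show ?thesis by simp
  qed
  then show ?thesis unfolding conv_def
    by (intro set_lebesgue_integral_cong_AE) auto
qed


lemma AE_shift:
  assumes [measurable]: "f \<in> borel_measurable borel" "g \<in> borel_measurable borel" and e: "ae_eq f g"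
  shows "AE x in lborel. f (x + t) = g (x + t)"
proof -
  have "AE x in lborel. f (t + 1 * x) = g (t + 1 * x)"
    by (rule AE_borel_affine[of 1 "\<lambda>t. f t = g t"]) (use e in auto)
  then show ?thesis by (simp add: add.commute)
qed

lemma cdiff_cong_AE:
  assumes "f \<in> borel_measurable borel" "g \<in> borel_measurable borel" "ae_eq f g"
  shows "ae_eq (cdiff f) (cdiff g)"
  using AE_shift[OF assms, of "1/2"] AE_shift[OF assms, of "-1/2"]
  by eventually_elim (simp add: cdiff_def)

lemma ac_reflect: assumes "ac f f1" shows "ac (\<lambda>t. f (x - t)) (\<lambda>t. - f1 (x - t))"
proof -
  have l: "loc_integrable f1" using acD(1) assms by blast
  note [measurable] = loc_integrableD(1)[OF l]
  have eq: "indicator {x-b..x-a} (x + (-1) * t) *\<^sub>R f1 (x + (-1) * t) = indicator {a..b} t *\<^sub>R f1 (x - t)" for a b t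
    by (auto simp: indicator_def)
  have i: "set_integrable lborel {a..b} (\<lambda>t. f1 (x - t))" for a b
    using lborel_integrable_real_affine[of "\<lambda>t. indicator {x-b..x-a} t *\<^sub>R f1 t" "-1" x]
      loc_integrableD(2)[OF l, of "x-b" "x-a"]
    unfolding eq by (simp add: set_integrable_def)
  have I: "(LINT t:{a..b}|lborel. f1 (x - t)) = (LINT t:{x-b..x-a}|lborel. f1 t)" for a b
    using lborel_integral_real_affine[of "-1" "\<lambda>t. indicator {x-b..x-a} t *\<^sub>R f1 t" x]
    unfolding eq by (simp add: set_lebesgue_integral_def)
  have "set_integrable lborel {a..b} (\<lambda>t. - f1 (x - t))" for a b
    using set_integrable_mult_right[of "-1", OF _ ] i[of a b]
    by (simp add: set_integrable_def)
  moreover have "f (x - b) - f (x - a) = (LINT t:{a..b}|lborel. - f1 (x - t))" if "a \<le> b" for a b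
    using acD(2)[OF assms, of "x-b" "x-a"] that set_integral_uminus[OF i[of a b]] I[of a b] by simp
  ultimately show ?thesis by (simp add: ac_def loc_integrable_def)
qed

lemma conv_integral_by_parts:
  assumes k: "\<And>t. (k has_real_derivative k' t) (at t)" "continuous_on UNIV k'" and f: "ac f f1"
  shows "conv k f1 x = k (-1/2) * f (x + 1/2) - k (1/2) * f (x - 1/2) + conv k' f x"
proof -
  have kc: "continuous_on UNIV k" using k(1) by (auto intro!: continuous_at_imp_continuous_on DERIV_isCont)
  note r = ac_reflect[OF f, of x]
  have a: "ac (\<lambda>t. k t * f (x - t)) (\<lambda>t. k' t * f (x - t) + k t * (- f1 (x - t)))"
    by (rule ac_mult[OF DERIV_ac[OF k] r])
  have i1: "set_integrable lborel {-1/2..1/2} (\<lambda>t. k' t * f (x - t))"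
    by (rule loc_integrableD[OF loc_integrable_mult_continuous[OF k(2)
          loc_integrable_continuous[OF ac_continuous[OF r]]]])
  have i2: "set_integrable lborel {-1/2..1/2} (\<lambda>t. k t * (- f1 (x - t)))"
    by (rule loc_integrableD[OF loc_integrable_mult_continuous[OF kc acD(1)[OF r]]])
  have "k (1/2) * f (x - 1/2) - k (-1/2) * f (x - (-1/2)) =
      (LINT t:{-1/2..1/2}|lborel. k' t * f (x - t) + k t * (- f1 (x - t)))"
    by (rule acD(2)[OF a]) simp
  also have "\<dots> = conv k' f x + (LINT t:{-1/2..1/2}|lborel. k t * (- f1 (x - t)))"
    unfolding conv_def by (rule set_integral_add(2)[OF i1 i2])
  also have "(LINT t:{-1/2..1/2}|lborel. k t * (- f1 (x - t))) = - conv k f1 x"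
    by (simp add: conv_def set_lebesgue_integral_def)
  finally show ?thesis by simp
qed

text \<open>\<open>Tn n\<close> is the operator \<open>T\<close> of the introduction, and \<open>Cn n = \<partial> T\<close>.\<close>

definition Tn :: "nat \<Rightarrow> (real \<Rightarrow> real) \<Rightarrow> real \<Rightarrow> real" where
  "Tn n = conv (\<lambda>t. (-1) ^ n / (2 * pi * real n) * sin (2 * pi * real n * t))"

definition Cn :: "nat \<Rightarrow> (real \<Rightarrow> real) \<Rightarrow> real \<Rightarrow> real" where
  "Cn n = conv (\<lambda>t. (-1) ^ n * cos (2 * pi * real n * t))"

lemma sin_half: "sin (2 * pi * real n * (1/2)) = 0" "sin (2 * pi * real n * (-1/2)) = 0"
  using sin_npi[of n] by (simp_all add: mult.commute)

lemma cos_half: "cos (2 * pi * real n * (1/2)) = (-1) ^ n" "cos (2 * pi * real n * (-1/2)) = (-1) ^ n"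
  using cos_npi[of n] by (simp_all add: mult.commute)

text \<open>The sine kernel vanishes at both ends of the window because sin (n pi) = 0. This is
  where \<omega> = 2 n pi enters: no boundary terms survive.\<close>

lemma Tn_deriv: assumes "ac f f1" "n \<ge> 1" shows "Tn n f1 x = Cn n f x"
proof -
  have "Tn n f1 x = (-1) ^ n / (2 * pi * real n) * sin (2 * pi * real n * (-1/2)) * f (x + 1/2)
      - (-1) ^ n / (2 * pi * real n) * sin (2 * pi * real n * (1/2)) * f (x - 1/2) + Cn n f x"
    unfolding Tn_def Cn_def
    by (rule conv_integral_by_parts[OF _ _ assms(1)])
       (use assms(2) in \<open>auto intro!: derivative_eq_intros continuous_intros simp: field_simps\<close>)
  then show ?thesis unfolding sin_half by simp
qed

text \<open>Here the boundary terms survive: cos (n pi) cancels the sign (-1)^n built into the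
  kernel, and they add up to \<delta> f. Together with \<open>Tn_deriv\<close> this shows that T
  inverts \<partial>^2 + \<omega>^2 on the range of \<delta>.\<close>

lemma Cn_deriv: assumes "ac f f1" "n \<ge> 1" shows "Cn n f1 x = cdiff f x - (2 * pi * real n)\<^sup>2 * Tn n f x"
proof -
  let ?w = "2 * pi * real n"
  have "Cn n f1 x = (-1) ^ n * cos (?w * (-1/2)) * f (x + 1/2) - (-1) ^ n * cos (?w * (1/2)) * f (x - 1/2)
      + conv (\<lambda>t. - ((-1) ^ n * ?w * sin (?w * t))) f x"
    unfolding Cn_def
    by (rule conv_integral_by_parts[OF _ _ assms(1)])
       (auto intro!: derivative_eq_intros continuous_intros)
  also have "(\<lambda>t. - ((-1) ^ n * ?w * sin (?w * t))) = (\<lambda>t. - (?w\<^sup>2) * ((-1) ^ n / ?w * sin (?w * t)))"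
    using assms(2) by (auto simp: power2_eq_square)
  also have "conv \<dots> f x = - (?w\<^sup>2) * Tn n f x"
    unfolding Tn_def conv_def by (simp only: mult.assoc set_integral_mult_right)
  finally show ?thesis unfolding cos_half cdiff_def by (simp flip: power_mult_distrib)
qed

lemma Tn_continuous_kernel: "continuous_on UNIV (\<lambda>t. (-1) ^ n / (2 * pi * real n) * sin (2 * pi * real n * t))"
  and Cn_continuous_kernel: "continuous_on UNIV (\<lambda>t. (-1) ^ n * cos (2 * pi * real n * t))"
  by (intro continuous_intros)+

lemma sob_Tn:
  assumes b: "0 \<le> b" and f: "sob b m K f" and n: "n \<ge> 1"
  shows "sob b m (exp b * (1 / real n) * K) (Tn n f)"
  unfolding Tn_def
proof (rule sob_conv[OF b Tn_continuous_kernel _ _ f])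
  fix t :: real
  have "1 * real n \<le> (2 * pi) * real n" using pi_gt3 by (intro mult_right_mono) auto
  then have "1 / (2 * pi * real n) \<le> 1 / real n" using n by (intro divide_left_mono) auto
  moreover have "\<bar>(-1) ^ n / (2 * pi * real n) * sin (2 * pi * real n * t)\<bar> \<le> 1 / (2 * pi * real n) * 1"
    unfolding abs_mult using n by (intro mult_mono) (auto simp: abs_divide power_abs)
  ultimately show "\<bar>(-1) ^ n / (2 * pi * real n) * sin (2 * pi * real n * t)\<bar> \<le> 1 / real n" by simp
qed (use n in auto)

lemma sob_Cn:
  assumes b: "0 \<le> b" and f: "sob b m K f"
  shows "sob b m (exp b * K) (Cn n f)"
  using sob_conv[OF b Cn_continuous_kernel _ _ f, where M = 1] by (simp add: Cn_def abs_mult power_abs)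

lemma conv_reflect:
  "conv k f (-x) = conv (\<lambda>t. k (-t)) (\<lambda>y. f (-y)) x"
  unfolding conv_def set_lebesgue_integral_def
  by (subst lborel_integral_real_affine[of "-1" _ 0])
     (auto intro!: Bochner_Integration.integral_cong simp: indicator_def)

lemma conv_uminus_kernel: "conv (\<lambda>t. - k t) f x = - conv k f x"
  by (simp add: conv_def set_lebesgue_integral_def)

lemma Tn_odd: assumes "\<And>x. f (-x) = f x" shows "Tn n f (-x) = - Tn n f x"
proof -
  have "Tn n f (-x) = conv (\<lambda>t. - ((-1) ^ n / (2 * pi * real n) * sin (2 * pi * real n * t))) f x"
    unfolding Tn_def conv_reflect by (simp add: assms)
  also have "\<dots> = - Tn n f x"
    unfolding Tn_def by (rule conv_uminus_kernel)
  finally show ?thesis .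
qed

lemma cdiff_odd: "(\<And>x. f (-x) = f x) \<Longrightarrow> cdiff f (-x) = - cdiff f x"
proof -
  assume o: "\<And>x. f (-x) = f x"
  have "f (- x + 1/2) = f (x - 1/2)" "f (- x - 1/2) = f (x + 1/2)"
    using o[of "x - 1/2"] o[of "x + 1/2"] by simp_all
  then show ?thesis by (simp add: cdiff_def)
qed

lemma cdiff_even: "(\<And>x. f (-x) = - f x) \<Longrightarrow> cdiff f (-x) = cdiff f x"
proof -
  assume o: "\<And>x. f (-x) = - f x"
  have "f (- x + 1/2) = - f (x - 1/2)" "f (- x - 1/2) = - f (x + 1/2)"
    using o[of "x - 1/2"] o[of "x + 1/2"] by simp_all
  then show ?thesis by (simp add: cdiff_def)
qed

lemma conv_cdiff:
  assumes k: "continuous_on UNIV k" and f: "loc_integrable f"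
  shows "conv k (cdiff f) x = cdiff (conv k f) x"
proof -
  have s: "loc_integrable (\<lambda>y. f (y + t))" for t
  proof -
    obtain G where "ac G f" using ac_exists[OF f] by blast
    from acD(1)[OF ac_shift[OF this]] show ?thesis .
  qed
  have "conv k (cdiff f) x = conv k (\<lambda>y. f (y + 1/2)) x - conv k (\<lambda>y. f (y - 1/2)) x"
    unfolding cdiff_def by (rule conv_diff[OF k s s[of "-1/2", simplified]])
  then show ?thesis by (simp add: conv_def cdiff_def algebra_simps)
qed

section \<open>The fixed-point problem\<close>

lemma cdiff_integral_0:
  assumes "integrable lborel Q" shows "(LINT x|lborel. cdiff Q x) = 0"
proof -
  have s: "integrable lborel (\<lambda>x. Q (x + t))" "(LINT x|lborel. Q (x + t)) = (LINT x|lborel. Q x)" for t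
    using lborel_integrable_real_affine[OF assms, of 1 t] lborel_integral_real_affine[of 1 Q t]
    by (simp_all add: add.commute)
  show ?thesis unfolding cdiff_def using s[of "1/2"] s[of "-1/2"] by simp
qed

text \<open>The equation \<H> f = h for continuous representatives, with \<open>p\<close> in the
  role of W''(\<sigma>). Evenness holds at every point, and the second derivative is an explicit
  density instead of the chosen \<open>wderiv\<close>.\<close>

definition solves :: "real \<Rightarrow> real \<Rightarrow> (real \<Rightarrow> real) \<Rightarrow> (real \<Rightarrow> real) \<Rightarrow> (real \<Rightarrow> real) \<Rightarrow> bool" where
  "solves c b p h f \<longleftrightarrow> (\<forall>x. f (-x) = f x) \<and> (\<exists>L. sob b 2 L f) \<and>
    (\<exists>f1 f2. ac f f1 \<and> ac f1 f2 \<and>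
      (AE x in lborel. c\<^sup>2 * f2 x - cdiff (cdiff (\<lambda>y. p y * f y)) x = h x))"

lemma solves_even: "solves c b p h f \<Longrightarrow> f (-x) = f x"
  by (simp add: solves_def)

lemma solves_diff:
  assumes "solves c b p h f" "solves c b p k g"
  shows "solves c b p (\<lambda>x. h x - k x) (\<lambda>x. f x - g x)"
proof -
  obtain f1 f2 L where f: "ac f f1" "ac f1 f2" "sob b 2 L f"
    "AE x in lborel. c\<^sup>2 * f2 x - cdiff (cdiff (\<lambda>y. p y * f y)) x = h x"
    using assms(1) by (auto simp: solves_def)
  obtain g1 g2 M where g: "ac g g1" "ac g1 g2" "sob b 2 M g"
    "AE x in lborel. c\<^sup>2 * g2 x - cdiff (cdiff (\<lambda>y. p y * g y)) x = k x"
    using assms(2) by (auto simp: solves_def)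
  have "AE x in lborel. c\<^sup>2 * (f2 x - g2 x) - cdiff (cdiff (\<lambda>y. p y * (f y - g y))) x = h x - k x"
    using f(4) g(4) by eventually_elim (simp add: cdiff_def algebra_simps)
  moreover have "\<forall>x. f (-x) - g (-x) = f x - g x" using assms by (simp add: solves_even)
  ultimately show ?thesis
    unfolding solves_def using sob_diff[OF f(3) g(3)] ac_diff[OF f(1) g(1)] ac_diff[OF f(2) g(2)] by blast
qed

text \<open>T composed with two derivatives, written without any derivative of \<open>g\<close>, so
  that it is meaningful for \<open>g\<close> in weighted L2. \<open>res_Tn\<close> and
  \<open>res_Cn\<close> give the forms with two derivatives and with one derivative on
  \<open>g\<close>.\<close>

definition res :: "nat \<Rightarrow> (real \<Rightarrow> real) \<Rightarrow> real \<Rightarrow> real" where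
  "res n g = (\<lambda>y. cdiff g y - (2 * pi * real n)\<^sup>2 * Tn n g y)"

lemma res_Tn: "ac g g1 \<Longrightarrow> ac g1 g2 \<Longrightarrow> n \<ge> 1 \<Longrightarrow> res n g = Tn n g2"
  by (auto simp: res_def Tn_deriv Cn_deriv[symmetric])

lemma res_Cn: "ac g g1 \<Longrightarrow> n \<ge> 1 \<Longrightarrow> res n g = Cn n g1"
  by (auto simp: res_def Cn_deriv[symmetric])

lemma res_diff:
  assumes "loc_integrable f" "loc_integrable g"
  shows "res n (\<lambda>x. f x - g x) y = res n f y - res n g y"
  unfolding res_def Tn_def conv_diff[OF Tn_continuous_kernel assms] by (simp add: cdiff_def algebra_simps)

lemma res_odd: "(\<And>x. g (-x) = g x) \<Longrightarrow> res n g (-x) = - res n g x"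
  by (simp add: res_def cdiff_odd Tn_odd)

text \<open>The factor of order n^2 is acceptable, since this bound is used only at fixed n: to see
  that right-hand sides are square integrable and to pass to the limit of the iteration.\<close>

lemma wl2_res:
  assumes "0 \<le> b" "wl2 b K g" "n \<ge> 1"
  shows "wl2 b ((2 * exp b + ((2 * pi * real n)\<^sup>2 + 1) * exp b) * K) (res n g)"
proof -
  have "sob b 0 (exp b * (1 / real n) * K) (Tn n g)" by (rule sob_Tn) (use assms in auto)
  then have T: "wl2 b (exp b * (1 / real n) * K) (Tn n g)" by simp
  have "exp b * (1 / real n) * K \<le> exp b * 1 * K"
    using assms(3) wl2_pos[OF assms(2)] by (intro mult_right_mono mult_left_mono) auto
  then have "wl2 b (exp b * K) (Tn n g)" using wl2_mono[OF T] by simp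
  from wl2_diff[OF wl2_cdiff[OF assms(1,2)] wl2_cmult[OF this, of "(2 * pi * real n)\<^sup>2"]]
  show ?thesis by (simp add: res_def algebra_simps)
qed

text \<open>
  Here \<open>s\<close> is the continuous representative of \<open>\<sigma>\<close>, \<open>F = V'\<close> and \<open>\<nu> = 1 / (1 + \<mu>)\<close>, so \<open>\<nu> F = W'\<close>. The last
  two assumptions are all that is needed of the homeomorphism \<open>\<H>\<close>.
\<close>

locale perturbed_wave =
  fixes c b \<nu> \<mu> K0 A :: real and F F' s :: "real \<Rightarrow> real"
  assumes b: "0 < b" and c: "c \<noteq> 0" and \<nu>: "0 < \<nu>" and \<mu>: "0 < \<mu>" and A: "0 < A"
    and F: "\<And>x. (F has_real_derivative F' x) (at x)" "Cd 4 F" "F 0 = 0"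
    and s: "\<And>x. s (-x) = s x" "sob b 2 K0 s"
    and s_eq: "\<exists>s1 s2. ac s s1 \<and> ac s1 s2 \<and>
      (AE x in lborel. c\<^sup>2 * s2 x = \<nu> * cdiff (cdiff (\<lambda>y. F (s y))) x)"
    and inverse_bound: "\<And>h f K. solves c b (\<lambda>y. \<nu> * F' (s y)) h f \<Longrightarrow> wl2 b K h \<Longrightarrow> sob b 2 (A * K) f"
    and surjective: "\<And>h K. wl2 b K h \<Longrightarrow> (\<And>x. h (-x) = h x) \<Longrightarrow> (LINT x|lborel. h x) = 0 \<Longrightarrow>
      \<exists>f. solves c b (\<lambda>y. \<nu> * F' (s y)) h f"
begin

lemma b0: "0 \<le> b" and K0: "0 < K0"
  using b s sob_pos by auto

abbreviation "slv \<equiv> solves c b (\<lambda>y. \<nu> * F' (s y))"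

definition gg :: "(real \<Rightarrow> real) \<Rightarrow> real \<Rightarrow> real" where "gg \<xi> = (\<lambda>y. F (s y + \<xi> y))"

text \<open>The part of the nonlinearity that is quadratic in \<xi>; the linear part has gone into
  \<H>.\<close>

definition remainder :: "(real \<Rightarrow> real) \<Rightarrow> real \<Rightarrow> real" where
  "remainder \<xi> = (\<lambda>y. F (s y + \<xi> y) - F (s y) - F' (s y) * \<xi> y)"

text \<open>
  The fixed-point equation is \<open>\<H> \<xi> = Psi n \<xi>\<close>. Its right-hand side is \<open>\<delta> (Q n \<xi>)\<close>, which makes its
  zero mean evident.
\<close>

definition Q :: "nat \<Rightarrow> (real \<Rightarrow> real) \<Rightarrow> real \<Rightarrow> real" where
  "Q n \<xi> = (\<lambda>y. \<nu> * (cdiff (remainder \<xi>) y + \<mu> * res n (gg \<xi>) y))"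

definition Psi :: "nat \<Rightarrow> (real \<Rightarrow> real) \<Rightarrow> real \<Rightarrow> real" where "Psi n \<xi> = cdiff (Q n \<xi>)"

lemma F_Cd: "Cd (Suc 3) F" using F(2) by (simp del: Cd.simps)

lemma F'_Cd: "Cd (Suc 2) F'" using Cd_deriv[OF F_Cd F(1)] by (simp del: Cd.simps)

lemma F_continuous: "continuous_on UNIV F" and F'_continuous: "continuous_on UNIV F'"
  using Cd_continuous[OF F_Cd] Cd_continuous[OF F'_Cd] .

lemma sob2_compose:
  assumes "0 < K"
  shows "\<exists>L>0. \<forall>a \<xi> \<epsilon>. sob b 2 K a \<longrightarrow> sob b 2 \<epsilon> \<xi> \<longrightarrow> \<epsilon> \<le> K \<longrightarrow>
    sob b 2 (L * \<epsilon>) (\<lambda>x. F (a x + \<xi> x) - F (a x))"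
proof -
  have "Cd (Suc 2) F" by (rule Cd_mono[OF F(2)]) simp
  from sob_compose_diff[OF b0 assms _ this] show ?thesis by (simp del: sob.simps Cd.simps)
qed

lemma F_measurable [measurable]: "F \<in> borel_measurable borel" "F' \<in> borel_measurable borel"
  by (intro borel_measurable_continuous_onI F_continuous F'_continuous)+

lemma s_measurable [measurable]: "s \<in> borel_measurable borel"
  using s sob_wl2 wl2_measurable by blast

lemma s_bound: "\<bar>s x\<bar> \<le> 2 * exp b * K0"
  using sob_abs_bound[OF b0, of 1 K0 s x] s(2) by (simp add: numeral_2_eq_2 del: sob.simps)

lemma sob2_bound: "sob b 2 r \<xi> \<Longrightarrow> \<bar>\<xi> x\<bar> \<le> 2 * exp b * r"
  using sob_abs_bound[OF b0, of 1 r \<xi> x] by (simp add: numeral_2_eq_2 del: sob.simps)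

text \<open>Both \<delta> and T map even functions to odd ones, so \<open>Q\<close> is odd and the
  outer difference restores evenness.\<close>

lemma Psi_even: assumes "\<And>x. \<xi> (-x) = \<xi> x" shows "Psi n \<xi> (-x) = Psi n \<xi> x"
proof -
  have "Q n \<xi> (-x) = - Q n \<xi> x" for x
    unfolding Q_def
    by (subst cdiff_odd) (simp_all add: remainder_def gg_def assms s res_odd algebra_simps)
  then show ?thesis unfolding Psi_def by (rule cdiff_even)
qed

lemma gg_loc_integrable:
  assumes "wl2 b K \<xi>" "\<And>x. \<bar>\<xi> x\<bar> \<le> R" shows "loc_integrable (gg \<xi>)"
proof -
  note [measurable] = wl2_measurable[OF assms(1)]
  obtain M where M: "M > 0" "\<And>x. \<bar>x\<bar> \<le> 2 * exp b * K0 + R \<Longrightarrow> \<bar>F x\<bar> \<le> M"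
    using Cd_bounded[OF F(2)] by blast
  have "\<bar>gg \<xi> x\<bar> \<le> M" for x
    unfolding gg_def by (rule M(2)) (use s_bound[of x] assms(2)[of x] in linarith)
  moreover have m: "gg \<xi> \<in> borel_measurable borel" unfolding gg_def by measurable
  moreover have "set_integrable lborel {x..y} (gg \<xi>)" for x y
    by (rule set_integrable_bound[of _ _ "\<lambda>_. M"])
       (use M m calculation borel_integrable_atLeastAtMost'[of x y "\<lambda>_. M"] in
        \<open>auto simp: set_borel_measurable_def\<close>)
  ultimately show ?thesis by (simp add: loc_integrable_def)
qed

text \<open>Only the weighted L2 distance enters, at the price of a constant depending on n. The
  pointwise bounds keep the arguments of F in a fixed compact interval and pass to pointwise limits
  of iterates, where no derivatives are under control yet.\<close>

lemma Q_lipschitz: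
  assumes n: "n \<ge> 1"
  shows "\<exists>B>0. \<forall>\<xi> \<eta> \<epsilon> L L'. wl2 b L \<xi> \<longrightarrow> wl2 b L' \<eta> \<longrightarrow> (\<forall>x. \<bar>\<xi> x\<bar> \<le> 2 * exp b * K0) \<longrightarrow>
    (\<forall>x. \<bar>\<eta> x\<bar> \<le> 2 * exp b * K0) \<longrightarrow> wl2 b \<epsilon> (\<lambda>x. \<xi> x - \<eta> x) \<longrightarrow>
    wl2 b (B * \<epsilon>) (\<lambda>x. Q n \<xi> x - Q n \<eta> x)"
proof -
  obtain M where M: "M > 0" "\<And>x y. \<bar>x\<bar> \<le> 4 * exp b * K0 \<Longrightarrow> \<bar>y\<bar> \<le> 4 * exp b * K0 \<Longrightarrow> \<bar>F x - F y\<bar> \<le> M * \<bar>x - y\<bar>"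
    using Cd_lipschitz[OF F_Cd] by blast
  obtain M' where M': "M' > 0" "\<And>x. \<bar>x\<bar> \<le> 2 * exp b * K0 \<Longrightarrow> \<bar>F' x\<bar> \<le> M'"
    using Cd_bounded[OF F'_Cd] by blast
  let ?R = "2 * exp b + ((2 * pi * real n)\<^sup>2 + 1) * exp b"
  let ?B = "(\<bar>\<nu>\<bar> + 1) * (2 * exp b * (M + M') + (\<bar>\<mu>\<bar> + 1) * (?R * M))"
  have "wl2 b (?B * \<epsilon>) (\<lambda>x. Q n \<xi> x - Q n \<eta> x)"
    if \<xi>: "wl2 b L \<xi>" "\<And>x. \<bar>\<xi> x\<bar> \<le> 2 * exp b * K0" and \<eta>: "wl2 b L' \<eta>" "\<And>x. \<bar>\<eta> x\<bar> \<le> 2 * exp b * K0"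
      and d: "wl2 b \<epsilon> (\<lambda>x. \<xi> x - \<eta> x)" for \<xi> \<eta> \<epsilon> L L'
  proof -
    note [measurable] = wl2_measurable[OF \<xi>(1)] wl2_measurable[OF \<eta>(1)]
    have gb: "\<bar>gg \<xi> x - gg \<eta> x\<bar> \<le> M * \<bar>\<xi> x - \<eta> x\<bar>" for x
      using M(2)[of "s x + \<xi> x" "s x + \<eta> x"] s_bound[of x] \<xi>(2)[of x] \<eta>(2)[of x] by (simp add: gg_def)
    have g: "wl2 b (M * \<epsilon>) (\<lambda>x. gg \<xi> x - gg \<eta> x)"
      by (rule wl2_bound[OF d]) (use gb M(1) in \<open>auto simp: gg_def\<close>)
    have r: "wl2 b ((M + M') * \<epsilon>) (\<lambda>x. remainder \<xi> x - remainder \<eta> x)"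
    proof (rule wl2_bound[OF d])
      have "\<bar>remainder \<xi> x - remainder \<eta> x\<bar> \<le> (M + M') * \<bar>\<xi> x - \<eta> x\<bar>" for x
      proof -
        have "remainder \<xi> x - remainder \<eta> x = (gg \<xi> x - gg \<eta> x) - F' (s x) * (\<xi> x - \<eta> x)"
          by (simp add: remainder_def gg_def algebra_simps)
        then have "\<bar>remainder \<xi> x - remainder \<eta> x\<bar> \<le> \<bar>gg \<xi> x - gg \<eta> x\<bar> + \<bar>F' (s x) * (\<xi> x - \<eta> x)\<bar>"
          by (simp add: abs_triangle_ineq4)
        also have "\<bar>F' (s x) * (\<xi> x - \<eta> x)\<bar> \<le> M' * \<bar>\<xi> x - \<eta> x\<bar>"
          unfolding abs_mult by (intro mult_right_mono M'(2) s_bound) auto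
        finally show ?thesis using gb[of x] by (simp add: distrib_right)
      qed
      then show "AE x in lborel. \<bar>remainder \<xi> x - remainder \<eta> x\<bar> \<le> (M + M') * \<bar>\<xi> x - \<eta> x\<bar>" by simp
    qed (use M M' in \<open>auto simp: remainder_def\<close>)
    have "wl2 b ((\<bar>\<nu>\<bar> + 1) * (2 * exp b * ((M + M') * \<epsilon>) + (\<bar>\<mu>\<bar> + 1) * (?R * (M * \<epsilon>))))
      (\<lambda>x. \<nu> * (cdiff (\<lambda>x. remainder \<xi> x - remainder \<eta> x) x + \<mu> * res n (\<lambda>x. gg \<xi> x - gg \<eta> x) x))"
      by (intro wl2_cmult wl2_add wl2_cdiff wl2_res b0 r g n)
    moreover have "(\<lambda>x. \<nu> * (cdiff (\<lambda>x. remainder \<xi> x - remainder \<eta> x) x + \<mu> * res n (\<lambda>x. gg \<xi> x - gg \<eta> x) x)) =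
      (\<lambda>x. Q n \<xi> x - Q n \<eta> x)"
      unfolding Q_def res_diff[OF gg_loc_integrable[OF \<xi>] gg_loc_integrable[OF \<eta>]]
      by (simp add: cdiff_def algebra_simps)
    ultimately show ?thesis by (simp add: algebra_simps)
  qed
  moreover have "?B > 0" using M(1) M'(1) \<nu> \<mu> n by (intro mult_pos_pos add_pos_pos) auto
  ultimately show ?thesis by blast
qed

text \<open>For fixed x the function F z - F' (s x) z of z has derivative F' z - F' (s x), which is
  of size r between the two arguments; the mean value bound yields the factor r.\<close>

lemma remainder_contraction:
  "\<exists>M>0. \<forall>\<xi> \<eta> r \<epsilon>. sob b 2 r \<xi> \<longrightarrow> sob b 2 r \<eta> \<longrightarrow> r \<le> K0 \<longrightarrow> wl2 b \<epsilon> (\<lambda>x. \<xi> x - \<eta> x) \<longrightarrow>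
    wl2 b (M * r * \<epsilon>) (\<lambda>x. remainder \<xi> x - remainder \<eta> x)"
proof -
  obtain M where M: "M > 0" "\<And>x y. \<bar>x\<bar> \<le> 4 * exp b * K0 \<Longrightarrow> \<bar>y\<bar> \<le> 4 * exp b * K0 \<Longrightarrow> \<bar>F' x - F' y\<bar> \<le> M * \<bar>x - y\<bar>"
    using Cd_lipschitz[OF F'_Cd] by blast
  have "wl2 b ((M * (4 * exp b)) * r * \<epsilon>) (\<lambda>x. remainder \<xi> x - remainder \<eta> x)"
    if \<xi>: "sob b 2 r \<xi>" and \<eta>: "sob b 2 r \<eta>" and r: "r \<le> K0" and d: "wl2 b \<epsilon> (\<lambda>x. \<xi> x - \<eta> x)"
    for \<xi> \<eta> r \<epsilon>
  proof -
    note [measurable] = wl2_measurable[OF sob_wl2[OF \<xi>]] wl2_measurable[OF sob_wl2[OF \<eta>]]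
    have pos: "0 < r" "0 < \<epsilon>" using \<xi> sob_pos d wl2_pos by auto
    have bd: "\<bar>\<xi> x\<bar> \<le> 2 * exp b * r" "\<bar>\<eta> x\<bar> \<le> 2 * exp b * r" for x using \<xi> \<eta> sob2_bound by auto
    have rK: "2 * exp b * r \<le> 2 * exp b * K0" using r by simp
    have "wl2 b ((M * (4 * exp b * r)) * \<epsilon>) (\<lambda>x. remainder \<xi> x - remainder \<eta> x)"
    proof (rule wl2_bound[OF d])
      have "\<bar>remainder \<xi> x - remainder \<eta> x\<bar> \<le> (M * (4 * exp b * r)) * \<bar>\<xi> x - \<eta> x\<bar>" for x
      proof -
        let ?S = "{min (s x + \<xi> x) (s x + \<eta> x)..max (s x + \<xi> x) (s x + \<eta> x)}"
        have "norm ((F (s x + \<xi> x) - F' (s x) * (s x + \<xi> x)) - (F (s x + \<eta> x) - F' (s x) * (s x + \<eta> x)))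
            \<le> (M * (4 * exp b * r)) * norm ((s x + \<xi> x) - (s x + \<eta> x))"
        proof (rule field_differentiable_bound[of ?S "\<lambda>z. F z - F' (s x) * z" "\<lambda>z. F' z - F' (s x)"])
          fix z assume z: "z \<in> ?S"
          show "((\<lambda>z. F z - F' (s x) * z) has_field_derivative F' z - F' (s x)) (at z within ?S)"
            by (rule has_field_derivative_at_within) (auto intro!: derivative_eq_intros F(1))
          have zs: "\<bar>z - s x\<bar> \<le> 2 * exp b * r" using z bd[of x] by (auto simp: abs_le_iff min_def max_def split: if_splits)
          have "\<bar>F' z - F' (s x)\<bar> \<le> M * \<bar>z - s x\<bar>"
            by (rule M(2)) (use zs s_bound[of x] rK in linarith)+
          also have "\<dots> \<le> M * (4 * exp b * r)" using zs pos M(1) by (intro mult_left_mono) auto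
          finally show "norm (F' z - F' (s x)) \<le> M * (4 * exp b * r)" by simp
        qed auto
        then show ?thesis by (simp add: remainder_def algebra_simps)
      qed
      then show "AE x in lborel. \<bar>remainder \<xi> x - remainder \<eta> x\<bar> \<le> (M * (4 * exp b * r)) * \<bar>\<xi> x - \<eta> x\<bar>" by simp
    qed (use M pos in \<open>auto simp: remainder_def\<close>)
    then show ?thesis by (simp add: mult.assoc)
  qed
  moreover have "M * (4 * exp b) > 0" using M(1) by simp
  ultimately show ?thesis by blast
qed

text \<open>Smallness has two sources: r from the Taylor remainder, and 1/n from T applied to the
  second derivative of a difference controlled in H2. Unlike in \<open>Q_lipschitz\<close> the
  constant is uniform in n.\<close>

lemma Q_contraction:
  "\<exists>B>0. \<forall>n\<ge>1. \<forall>\<xi> \<eta> r \<epsilon>. sob b 2 r \<xi> \<longrightarrow> sob b 2 r \<eta> \<longrightarrow> r \<le> K0 \<longrightarrow> sob b 2 \<epsilon> (\<lambda>x. \<xi> x - \<eta> x) \<longrightarrow> \<epsilon> \<le> K0 \<longrightarrow>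
    wl2 b (B * (r + 1 / real n) * \<epsilon>) (\<lambda>x. Q n \<xi> x - Q n \<eta> x)"
proof -
  obtain M where M: "M > 0" "\<And>\<xi> \<eta> r \<epsilon>. sob b 2 r \<xi> \<Longrightarrow> sob b 2 r \<eta> \<Longrightarrow> r \<le> K0 \<Longrightarrow> wl2 b \<epsilon> (\<lambda>x. \<xi> x - \<eta> x) \<Longrightarrow>
    wl2 b (M * r * \<epsilon>) (\<lambda>x. remainder \<xi> x - remainder \<eta> x)" using remainder_contraction by blast
  obtain L where L: "L > 0" "\<And>a \<xi> \<epsilon>. sob b 2 (2 * K0) a \<Longrightarrow> sob b 2 \<epsilon> \<xi> \<Longrightarrow> \<epsilon> \<le> 2 * K0 \<Longrightarrow>
      sob b 2 (L * \<epsilon>) (\<lambda>x. F (a x + \<xi> x) - F (a x))"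
    using sob2_compose[of "2 * K0"] K0 by auto
  let ?B = "(\<bar>\<nu>\<bar> + 1) * (2 * exp b * (M) + (\<bar>\<mu>\<bar> + 1) * (exp b * L))"
  have "wl2 b (?B * (r + 1 / real n) * \<epsilon>) (\<lambda>x. Q n \<xi> x - Q n \<eta> x)"
    if n: "n \<ge> 1" and \<xi>: "sob b 2 r \<xi>" and \<eta>: "sob b 2 r \<eta>" and r: "r \<le> K0" and d: "sob b 2 \<epsilon> (\<lambda>x. \<xi> x - \<eta> x)" and \<epsilon>: "\<epsilon> \<le> K0"
    for n \<xi> \<eta> r \<epsilon>
  proof -
    have pos: "0 < r" "0 < \<epsilon>" using \<xi> d sob_pos by auto
    have bd: "\<bar>\<xi> x\<bar> \<le> 2 * exp b * r" "\<bar>\<eta> x\<bar> \<le> 2 * exp b * r" for x using \<xi> \<eta> sob2_bound by auto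
    have rem: "wl2 b (M * r * \<epsilon>) (\<lambda>x. remainder \<xi> x - remainder \<eta> x)"
      by (rule M(2)[OF \<xi> \<eta> r sob_wl2[OF d]])
    \<comment> \<open>The difference of the two compositions is an increment from s + \<eta> by
      \<xi> - \<eta>, and this base point has norm at most 2 K0.\<close>
    have a: "sob b 2 (2 * K0) (\<lambda>x. s x + \<eta> x)"
      using sob_add[OF s(2) sob_mono[OF \<eta> r]] by simp
    have g: "sob b 2 (L * \<epsilon>) (\<lambda>x. gg \<xi> x - gg \<eta> x)"
      using L(2)[OF a d] \<epsilon> K0 by (simp add: gg_def)
    then obtain g1 g2 where g12: "ac (\<lambda>x. gg \<xi> x - gg \<eta> x) g1" "ac g1 g2" "wl2 b (L * \<epsilon>) g2" by (rule sob_2E)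
    have "sob b 0 (exp b * (1 / real n) * (L * \<epsilon>)) (Tn n g2)"
      using sob_Tn[OF b0 _ n, of 0] g12(3) by simp
    then have res: "wl2 b (exp b * (1 / real n) * (L * \<epsilon>)) (res n (\<lambda>x. gg \<xi> x - gg \<eta> x))"
      using res_Tn[OF g12(1,2) n] by simp
    have "wl2 b ((\<bar>\<nu>\<bar> + 1) * (2 * exp b * (M * r * \<epsilon>) + (\<bar>\<mu>\<bar> + 1) * (exp b * (1 / real n) * (L * \<epsilon>))))
      (\<lambda>x. \<nu> * (cdiff (\<lambda>x. remainder \<xi> x - remainder \<eta> x) x + \<mu> * res n (\<lambda>x. gg \<xi> x - gg \<eta> x) x))"
      by (intro wl2_cmult wl2_add wl2_cdiff b0 rem res)
    moreover have "(\<lambda>x. \<nu> * (cdiff (\<lambda>x. remainder \<xi> x - remainder \<eta> x) x + \<mu> * res n (\<lambda>x. gg \<xi> x - gg \<eta> x) x)) =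
      (\<lambda>x. Q n \<xi> x - Q n \<eta> x)"
      unfolding Q_def res_diff[OF gg_loc_integrable[OF sob_wl2[OF \<xi>] bd(1)] gg_loc_integrable[OF sob_wl2[OF \<eta>] bd(2)]]
      by (simp add: cdiff_def algebra_simps)
    ultimately have 1: "wl2 b ((\<bar>\<nu>\<bar> + 1) * (2 * exp b * (M * r * \<epsilon>) + (\<bar>\<mu>\<bar> + 1) * (exp b * (1 / real n) * (L * \<epsilon>))))
       (\<lambda>x. Q n \<xi> x - Q n \<eta> x)" by simp
    have "(\<bar>\<nu>\<bar> + 1) * (2 * exp b * (M * r * \<epsilon>) + (\<bar>\<mu>\<bar> + 1) * (exp b * (1 / real n) * (L * \<epsilon>)))
      = (\<bar>\<nu>\<bar> + 1) * ((2 * exp b * (M)) * r + ((\<bar>\<mu>\<bar> + 1) * (exp b * L)) * (1 / real n)) * \<epsilon>"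
      by (simp only: algebra_simps)
    also have "\<dots> \<le> (\<bar>\<nu>\<bar> + 1) * ((2 * exp b * (M) + (\<bar>\<mu>\<bar> + 1) * (exp b * L)) * (r + 1 / real n)) * \<epsilon>"
    proof (intro mult_right_mono mult_left_mono)
      have p: "0 \<le> 2 * exp b * (M)" "0 \<le> (\<bar>\<mu>\<bar> + 1) * (exp b * L)" "0 \<le> 1 / real n"
        using M L by (auto intro!: mult_nonneg_nonneg)
      show "(2 * exp b * (M)) * r + ((\<bar>\<mu>\<bar> + 1) * (exp b * L)) * (1 / real n) \<le>
        (2 * exp b * (M) + (\<bar>\<mu>\<bar> + 1) * (exp b * L)) * (r + 1 / real n)"
        using mult_nonneg_nonneg[OF p(1,3)] mult_nonneg_nonneg[OF p(2), of r] pos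
        unfolding distrib_left distrib_right by linarith
    qed (use pos in auto)
    also have "\<dots> = ?B * (r + 1 / real n) * \<epsilon>" by (simp only: mult.assoc)
    finally show ?thesis by (rule wl2_mono[OF 1])
  qed
  moreover have "?B > 0" using M(1) L(1) \<nu> \<mu> by (intro mult_pos_pos add_pos_pos) auto
  ultimately show ?thesis by blast
qed

lemma F_s_sob: "\<exists>K. sob b 2 K (\<lambda>x. F (s x))"
proof -
  obtain L where "\<And>a \<xi> \<epsilon>. sob b 2 K0 a \<Longrightarrow> sob b 2 \<epsilon> \<xi> \<Longrightarrow> \<epsilon> \<le> K0 \<Longrightarrow>
      sob b 2 (L * \<epsilon>) (\<lambda>x. F (a x + \<xi> x) - F (a x))"
    using sob2_compose[OF K0] by blast
  from this[OF sob_zero[OF K0] s(2)] show ?thesis using F(3) by auto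
qed

text \<open>At zero the Taylor remainder vanishes and only the T term of F(s) is left; its size 1/n
  fixes the radius of the ball.\<close>

lemma Q_0: "\<exists>B>0. \<forall>n\<ge>1. wl2 b (B / real n) (Q n (\<lambda>_. 0))"
proof -
  obtain K where K: "sob b 2 K (\<lambda>x. F (s x))" using F_s_sob by blast
  then obtain g1 g2 where g: "ac (\<lambda>x. F (s x)) g1" "ac g1 g2" "wl2 b K g2" by (rule sob_2E)
  have "wl2 b (((\<bar>\<nu> * \<mu>\<bar> + 1) * (exp b * K)) / real n) (Q n (\<lambda>_. 0))" if n: "n \<ge> 1" for n
  proof -
    have "wl2 b (exp b * (1 / real n) * K) (Tn n g2)"
      using sob_Tn[OF b0 _ n, of 0] g(3) by simp
    from wl2_cmult[OF this, of "\<nu> * \<mu>"] show ?thesis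
      by (simp add: Q_def remainder_def gg_def cdiff_def res_Tn[OF g(1,2) n] mult_ac)
  qed
  moreover have "(\<bar>\<nu> * \<mu>\<bar> + 1) * (exp b * K) > 0"
    using sob_pos[OF K] \<nu> \<mu> by (intro mult_pos_pos add_pos_pos) auto
  ultimately show ?thesis by blast
qed

section \<open>Solvability, contraction and the fixed point\<close>

lemma Psi_diff: "(\<lambda>x. Psi n \<xi> x - Psi n \<eta> x) = cdiff (\<lambda>x. Q n \<xi> x - Q n \<eta> x)"
  by (simp add: Psi_def cdiff_def fun_eq_iff)

text \<open>A weighted L2 bound and a supremum bound are the right hypotheses, because the lemma is
  also applied to the pointwise limit of the iterates before that limit is known to lie in
  H2.\<close>

lemma solve_Psi:
  assumes n: "n \<ge> 1" and \<xi>: "wl2 b L \<xi>" "\<And>x. \<bar>\<xi> x\<bar> \<le> 2 * exp b * K0" "\<And>x. \<xi> (-x) = \<xi> x"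
  shows "\<exists>f. slv (Psi n \<xi>) f"
proof -
  obtain B where B: "wl2 b (B / real n) (Q n (\<lambda>_. 0))" using Q_0 n by blast
  obtain B' where B': "\<And>\<xi> \<eta> \<epsilon> L L'. wl2 b L \<xi> \<Longrightarrow> wl2 b L' \<eta> \<Longrightarrow> (\<forall>x. \<bar>\<xi> x\<bar> \<le> 2 * exp b * K0) \<Longrightarrow>
    (\<forall>x. \<bar>\<eta> x\<bar> \<le> 2 * exp b * K0) \<Longrightarrow> wl2 b \<epsilon> (\<lambda>x. \<xi> x - \<eta> x) \<Longrightarrow>
    wl2 b (B' * \<epsilon>) (\<lambda>x. Q n \<xi> x - Q n \<eta> x)" using Q_lipschitz[OF n] by blast
  have "wl2 b (B' * L) (\<lambda>x. Q n \<xi> x - Q n (\<lambda>_. 0) x)"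
    by (rule B'[OF \<xi>(1) wl2_zero]) (use \<xi> K0 in auto)
  from wl2_add[OF this B] have q: "wl2 b (B' * L + B / real n) (Q n \<xi>)" by simp
  show ?thesis
  proof (rule surjective)
    show "wl2 b (2 * exp b * (B' * L + B / real n)) (Psi n \<xi>)"
      unfolding Psi_def by (rule wl2_cdiff[OF b0 q])
    show "Psi n \<xi> (-x) = Psi n \<xi> x" for x using Psi_even[of \<xi>] \<xi>(3) by simp
    show "(LINT x|lborel. Psi n \<xi> x) = 0"
      unfolding Psi_def by (rule cdiff_integral_0[OF wl2_integrable[OF b q]])
  qed
qed

lemma solution_contraction:
  "\<exists>B>0. \<forall>n\<ge>1. \<forall>\<xi> \<eta> \<xi>' \<eta>' r \<epsilon>. sob b 2 r \<xi> \<longrightarrow> sob b 2 r \<eta> \<longrightarrow> r \<le> K0 \<longrightarrow> sob b 2 \<epsilon> (\<lambda>x. \<xi> x - \<eta> x) \<longrightarrow> \<epsilon> \<le> K0 \<longrightarrow>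
    slv (Psi n \<xi>) \<xi>' \<longrightarrow> slv (Psi n \<eta>) \<eta>' \<longrightarrow> sob b 2 (B * (r + 1 / real n) * \<epsilon>) (\<lambda>x. \<xi>' x - \<eta>' x)"
proof -
  obtain B where B: "B > 0" "\<And>n \<xi> \<eta> r \<epsilon>. n \<ge> 1 \<Longrightarrow> sob b 2 r \<xi> \<Longrightarrow> sob b 2 r \<eta> \<Longrightarrow> r \<le> K0 \<Longrightarrow> sob b 2 \<epsilon> (\<lambda>x. \<xi> x - \<eta> x) \<Longrightarrow> \<epsilon> \<le> K0 \<Longrightarrow>
    wl2 b (B * (r + 1 / real n) * \<epsilon>) (\<lambda>x. Q n \<xi> x - Q n \<eta> x)"
    using Q_contraction by blast
  have "sob b 2 ((A * (2 * exp b * B)) * (r + 1 / real n) * \<epsilon>) (\<lambda>x. \<xi>' x - \<eta>' x)"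
    if "n \<ge> 1" "sob b 2 r \<xi>" "sob b 2 r \<eta>" "r \<le> K0" "sob b 2 \<epsilon> (\<lambda>x. \<xi> x - \<eta> x)" "\<epsilon> \<le> K0"
      "slv (Psi n \<xi>) \<xi>'" "slv (Psi n \<eta>) \<eta>'" for n \<xi> \<eta> \<xi>' \<eta>' r \<epsilon>
  proof -
    have "wl2 b (2 * exp b * (B * (r + 1 / real n) * \<epsilon>)) (\<lambda>x. Psi n \<xi> x - Psi n \<eta> x)"
      unfolding Psi_diff by (rule wl2_cdiff[OF b0 B(2)]) (use that in auto)
    from inverse_bound[OF solves_diff[OF that(7,8)] this] show ?thesis by (simp add: mult_ac)
  qed
  moreover have "A * (2 * exp b * B) > 0" using A B by simp
  ultimately show ?thesis by blast
qed

lemma sob2_all_small: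
  assumes "\<And>k. sob b 2 (\<epsilon> / 2 ^ k) f" shows "f x = 0"
proof -
  have "(\<lambda>k. 2 * exp b * (\<epsilon> * (1 / 2) ^ k)) \<longlonglongrightarrow> 2 * exp b * (\<epsilon> * 0)"
    by (intro tendsto_intros LIMSEQ_realpow_zero) auto
  moreover have "\<bar>f x\<bar> \<le> 2 * exp b * (\<epsilon> * (1 / 2) ^ k)" for k
    using sob2_bound[OF assms[of k], of x] by (simp add: power_one_over divide_simps)
  ultimately have "\<bar>f x\<bar> \<le> 2 * exp b * (\<epsilon> * 0)"
    by (rule LIMSEQ_le_const[OF _ exI, rule_format])
  then show ?thesis by simp
qed

lemma large_n: "\<exists>N\<ge>1. \<forall>n\<ge>N. C \<le> real n"
  using real_arch_simple[of C] by (meson le_trans nat_le_linear of_nat_mono order_trans)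

text \<open>Applied to two fixed points, the contraction halves any bound on their difference, so
  the bound 2 C / n shrinks to 2 C / (n 2^k) for every k.\<close>

lemma fixed_point_unique:
  assumes C: "0 < C"
  shows "\<exists>N\<ge>1. \<forall>n\<ge>N. \<forall>\<xi> \<eta>. sob b 2 (C / real n) \<xi> \<longrightarrow> sob b 2 (C / real n) \<eta> \<longrightarrow>
    slv (Psi n \<xi>) \<xi> \<longrightarrow> slv (Psi n \<eta>) \<eta> \<longrightarrow> \<xi> = \<eta>"
proof -
  obtain B where B: "B > 0" "\<And>n \<xi> \<eta> \<xi>' \<eta>' r \<epsilon>. n \<ge> 1 \<Longrightarrow> sob b 2 r \<xi> \<Longrightarrow> sob b 2 r \<eta> \<Longrightarrow> r \<le> K0 \<Longrightarrow> sob b 2 \<epsilon> (\<lambda>x. \<xi> x - \<eta> x) \<Longrightarrow> \<epsilon> \<le> K0 \<Longrightarrow>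
    slv (Psi n \<xi>) \<xi>' \<Longrightarrow> slv (Psi n \<eta>) \<eta>' \<Longrightarrow> sob b 2 (B * (r + 1 / real n) * \<epsilon>) (\<lambda>x. \<xi>' x - \<eta>' x)"
    using solution_contraction by blast
  \<comment> \<open>The first entry puts the radius C/n and the distance of two members of the ball
    below K0; the second makes the contraction factor B (C + 1) / n at most 1/2.\<close>
  obtain N where N: "N \<ge> 1" "\<And>n. n \<ge> N \<Longrightarrow> max (2 * C / K0) (2 * B * (C + 1)) \<le> real n"
    using large_n by blast
  have "\<xi> = \<eta>" if n: "n \<ge> N" and \<xi>: "sob b 2 (C / real n) \<xi>" "slv (Psi n \<xi>) \<xi>"
    and \<eta>: "sob b 2 (C / real n) \<eta>" "slv (Psi n \<eta>) \<eta>" for n \<xi> \<eta>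
  proof -
    have n0: "0 < real n" "1 \<le> n" using n N(1) by auto
    have r2: "2 * (C / real n) \<le> K0" using N(2)[OF n] n0 K0 by (simp add: field_simps)
    moreover have "0 < C / real n" using C n0 by simp
    ultimately have r: "C / real n \<le> K0" by linarith
    have h: "B * (C / real n + 1 / real n) \<le> 1 / 2" using N(2)[OF n] n0 by (simp add: field_simps)
    have "sob b 2 (2 * (C / real n) / 2 ^ k) (\<lambda>x. \<xi> x - \<eta> x)" for k
    proof (induction k)
      case 0 then show ?case using sob_diff[OF \<xi>(1) \<eta>(1)] by simp
    next
      case (Suc k)
      have "2 * (C / real n) / 2 ^ k \<le> 2 * (C / real n)"
        using C n0 by (simp add: divide_le_eq mult_le_cancel_left1)
      then have "2 * (C / real n) / 2 ^ k \<le> K0" using r2 by linarith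
      note S = B(2)[OF n0(2) \<xi>(1) \<eta>(1) r Suc this \<xi>(2) \<eta>(2)]
      have "B * (C / real n + 1 / real n) * (2 * (C / real n) / 2 ^ k) \<le> 1 / 2 * (2 * (C / real n) / 2 ^ k)"
        using h C n0 by (intro mult_right_mono) auto
      then show ?case using sob_mono[OF S] by simp
    qed
    then show ?thesis using sob2_all_small[of "2 * (C / real n)" "\<lambda>x. \<xi> x - \<eta> x"] by (auto simp: fun_eq_iff)
  qed
  with N(1) show ?thesis by blast
qed

text \<open>Picard iteration from zero. The limit \<zeta> is at first known only in weighted L2;
  solving once more with right-hand side \<open>Psi n \<zeta>\<close> gives \<open>f\<close> in H2,
  and f = \<zeta> because both are limits of the same iterates.\<close>

lemma fixed_point_exists:
  "\<exists>C>0. \<exists>N\<ge>1. \<forall>n\<ge>N. \<exists>\<xi>. sob b 2 (C / real n) \<xi> \<and> slv (Psi n \<xi>) \<xi>"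
proof -
  obtain B where B: "B > 0" "\<And>n \<xi> \<eta> \<xi>' \<eta>' r \<epsilon>. n \<ge> 1 \<Longrightarrow> sob b 2 r \<xi> \<Longrightarrow> sob b 2 r \<eta> \<Longrightarrow> r \<le> K0 \<Longrightarrow> sob b 2 \<epsilon> (\<lambda>x. \<xi> x - \<eta> x) \<Longrightarrow> \<epsilon> \<le> K0 \<Longrightarrow>
    slv (Psi n \<xi>) \<xi>' \<Longrightarrow> slv (Psi n \<eta>) \<eta>' \<Longrightarrow> sob b 2 (B * (r + 1 / real n) * \<epsilon>) (\<lambda>x. \<xi>' x - \<eta>' x)"
    using solution_contraction by blast
  obtain B0 where B0: "B0 > 0" "\<And>n. n \<ge> 1 \<Longrightarrow> wl2 b (B0 / real n) (Q n (\<lambda>_. 0))" using Q_0 by blast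
  \<comment> \<open>The first iterate then has norm at most C / (4 n), which is \<rho> / 2^2, the
    first term of the geometric series of increments.\<close>
  define C where "C = 4 * (A * (2 * exp b * B0))"
  have C: "0 < C" using A B0 by (simp add: C_def)
  obtain N where N: "N \<ge> 1" "\<And>n. n \<ge> N \<Longrightarrow> max (C / K0) (2 * B * (C + 1)) \<le> real n"
    using large_n by blast
  have "\<exists>\<xi>. sob b 2 (2 * C / real n) \<xi> \<and> slv (Psi n \<xi>) \<xi>" if n: "n \<ge> N" for n
  proof -
    define \<rho> where "\<rho> = C / real n"
    have n0: "0 < real n" "1 \<le> n" using n N(1) by auto
    have \<rho>: "0 < \<rho>" using C n0 by (simp add: \<rho>_def)
    have rK: "\<rho> \<le> K0" using N(2)[OF n] n0 K0 by (simp add: field_simps \<rho>_def)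
    have h: "B * (\<rho> + 1 / real n) \<le> 1 / 2" using N(2)[OF n] n0 by (simp add: field_simps \<rho>_def)
    define \<Phi> where "\<Phi> f = (SOME f'. slv (Psi n f) f')" for f
    define \<xi> where "\<xi> k = (\<Phi> ^^ k) (\<lambda>_. 0)" for k
    have \<xi>0: "\<xi> 0 = (\<lambda>_. 0)" and \<xi>S: "\<xi> (Suc k) = \<Phi> (\<xi> k)" for k by (simp_all add: \<xi>_def)
    have slv\<Phi>: "slv (Psi n f) (\<Phi> f)" if "wl2 b L f" "\<And>x. \<bar>f x\<bar> \<le> 2 * exp b * K0" "\<And>x. f (-x) = f x" for f L
      unfolding \<Phi>_def using solve_Psi[of n L f, OF n0(2) that] by (rule someI_ex)
    have slvb: "slv (Psi n f) (\<Phi> f)" if f: "sob b 2 r f" "r \<le> \<rho>" "\<And>x. f (-x) = f x" for f r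
    proof (rule slv\<Phi>[of r f, OF sob_wl2[OF f(1)] _ f(3)])
      have "2 * exp b * r \<le> 2 * exp b * K0" using f(2) rK by simp
      then show "\<bar>f x\<bar> \<le> 2 * exp b * K0" for x using sob2_bound[OF f(1), of x] by linarith
    qed
    \<comment> \<open>Bounds being positive, the zero function is charged \<rho> / 2; the increments
      \<rho> / 2^(k + 2) add up to the other half, so every iterate stays in the ball of radius
      \<rho>.\<close>
    have I: "sob b 2 (\<rho> * (1 - 1 / 2 ^ (k + 1))) (\<xi> k) \<and> (\<forall>x. \<xi> k (-x) = \<xi> k x) \<and>
        sob b 2 (\<rho> / 2 ^ (k + 2)) (\<lambda>x. \<xi> (Suc k) x - \<xi> k x) \<and> slv (Psi n (\<xi> k)) (\<xi> (Suc k))" for k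
    proof (induction k)
      case 0
      have z: "sob b 2 (\<rho> * (1 - 1 / 2 ^ (0 + 1))) (\<xi> 0)" unfolding \<xi>0 by (rule sob_zero) (use \<rho> in simp)
      have S: "slv (Psi n (\<xi> 0)) (\<xi> (Suc 0))"
        unfolding \<xi>S by (rule slvb[where r = "\<rho> * (1 - 1 / 2 ^ (0 + 1))" and f = "\<xi> 0", OF z]) (use \<rho> \<xi>0 in auto)
      have "wl2 b (2 * exp b * (B0 / real n)) (Psi n (\<xi> 0))"
        unfolding Psi_def \<xi>0 by (rule wl2_cdiff[OF b0 B0(2)[OF n0(2)]])
      moreover have "A * (2 * exp b * (B0 / real n)) = \<rho> / 2 ^ (0 + 2)"
        by (simp add: \<rho>_def C_def)
      ultimately have "sob b 2 (\<rho> / 2 ^ (0 + 2)) (\<lambda>x. \<xi> (Suc 0) x - \<xi> 0 x)"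
        using inverse_bound[OF S, of "2 * exp b * (B0 / real n)"] by (simp only: \<xi>0 diff_zero)
      then show ?case using z S \<xi>0 by simp
    next
      case (Suc k)
      have e: "\<rho> * (1 - 1 / 2 ^ (k + 1)) + \<rho> / 2 ^ (k + 2) = \<rho> * (1 - 1 / 2 ^ (Suc k + 1))"
        by (simp add: field_simps)
      have "sob b 2 (\<rho> * (1 - 1 / 2 ^ (k + 1)) + \<rho> / 2 ^ (k + 2)) (\<lambda>x. \<xi> k x + (\<xi> (Suc k) x - \<xi> k x))"
        by (rule sob_add) (use Suc in auto)
      then have s1: "sob b 2 (\<rho> * (1 - 1 / 2 ^ (Suc k + 1))) (\<xi> (Suc k))" unfolding e by simp
      have ev: "\<xi> (Suc k) (-x) = \<xi> (Suc k) x" for x using Suc solves_even by blast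
      have le: "\<rho> * (1 - 1 / 2 ^ j) \<le> \<rho>" for j using \<rho> by (simp add: mult_left_le)
      have S: "slv (Psi n (\<xi> (Suc k))) (\<xi> (Suc (Suc k)))"
        unfolding \<xi>S[of "Suc k"] by (rule slvb[where f = "\<xi> (Suc k)", OF s1 le ev])
      have sm: "\<rho> / 2 ^ (k + 2) \<le> K0"
      proof -
        have "\<rho> / 2 ^ (k + 2) \<le> \<rho> / 1" using \<rho> by (intro divide_left_mono one_le_power) auto
        then show ?thesis using rK by simp
      qed
      have D: "sob b 2 (\<rho> / 2 ^ (k + 2)) (\<lambda>x. \<xi> (Suc k) x - \<xi> k x)" using Suc by blast
      have s0: "sob b 2 \<rho> (\<xi> k)" "sob b 2 \<rho> (\<xi> (Suc k))" using Suc s1 sob_mono[OF _ le] by blast+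
      have S0: "slv (Psi n (\<xi> k)) (\<xi> (Suc k))" using Suc by blast
      have "sob b 2 (B * (\<rho> + 1 / real n) * (\<rho> / 2 ^ (k + 2))) (\<lambda>x. \<xi> (Suc (Suc k)) x - \<xi> (Suc k) x)"
        by (rule B(2)[OF n0(2) s0(2,1) rK D sm S S0])
      moreover have "B * (\<rho> + 1 / real n) * (\<rho> / 2 ^ (k + 2)) \<le> 1 / 2 * (\<rho> / 2 ^ (k + 2))"
        using h \<rho> by (intro mult_right_mono) auto
      ultimately have "sob b 2 (1 / 2 * (\<rho> / 2 ^ (k + 2))) (\<lambda>x. \<xi> (Suc (Suc k)) x - \<xi> (Suc k) x)"
        by (rule sob_mono)
      moreover have "1 / 2 * (\<rho> / 2 ^ (k + 2)) = \<rho> / 2 ^ (Suc k + 2)" by simp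
      ultimately have "sob b 2 (\<rho> / 2 ^ (Suc k + 2)) (\<lambda>x. \<xi> (Suc (Suc k)) x - \<xi> (Suc k) x)" by metis
      with s1 ev S show ?case by blast
    qed
    have tail: "sob b 2 (\<rho> / 2 ^ k * (1 - 1 / 2 ^ (j + 1))) (\<lambda>x. \<xi> (k + j) x - \<xi> k x)" for k j
    proof (induction j)
      case 0 show ?case using sob_zero[of "\<rho> / 2 ^ k * (1 - 1 / 2 ^ (0 + 1))" b 2] \<rho> by simp
    next
      case (Suc j)
      have e: "\<rho> / 2 ^ k * (1 - 1 / 2 ^ (j + 1)) + \<rho> / 2 ^ (k + j + 2) = \<rho> / 2 ^ k * (1 - 1 / 2 ^ (Suc j + 1))"
        by (simp add: field_simps power_add)
      have "sob b 2 (\<rho> / 2 ^ k * (1 - 1 / 2 ^ (j + 1)) + \<rho> / 2 ^ (k + j + 2))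
          (\<lambda>x. (\<xi> (k + j) x - \<xi> k x) + (\<xi> (Suc (k + j)) x - \<xi> (k + j) x))"
        by (rule sob_add[OF Suc]) (use I[of "k + j"] in blast)
      then show ?case unfolding e by simp
    qed
    have tail': "sob b 2 (\<rho> / 2 ^ k) (\<lambda>x. \<xi> (k + j) x - \<xi> k x)" for k j
      by (rule sob_mono[OF tail]) (use \<rho> in \<open>simp add: mult_left_le divide_right_mono\<close>)
    have small: "(\<lambda>k. c * (\<rho> / 2 ^ k)) \<longlonglongrightarrow> 0" for c
    proof -
      have "(\<lambda>k. c * (\<rho> * (1 / 2) ^ k)) \<longlonglongrightarrow> c * (\<rho> * 0)"
        by (intro tendsto_intros LIMSEQ_realpow_zero) auto
      moreover have "c * (\<rho> * (1 / 2) ^ k) = c * (\<rho> / 2 ^ k)" for k by (simp add: power_one_over)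
      ultimately show ?thesis by simp
    qed
    have Cau: "Cauchy (\<lambda>k. \<xi> k x)" for x
    proof (rule CauchyI')
      fix e :: real assume "0 < e"
      then have "\<forall>\<^sub>F k in sequentially. 2 * exp b * (\<rho> / 2 ^ k) < e"
        using small[of "2 * exp b"] by (auto dest: order_tendstoD)
      then obtain M where M: "\<And>k. k \<ge> M \<Longrightarrow> 2 * exp b * (\<rho> / 2 ^ k) < e"
        by (auto simp: eventually_sequentially)
      have "dist (\<xi> m x) (\<xi> l x) < e" if "m \<ge> M" "l > m" for m l
        using sob2_bound[OF tail'[of m "l - m"], of x] M[OF that(1)] that(2) by (simp add: dist_real_def abs_minus_commute)
      then show "\<exists>M. \<forall>m\<ge>M. \<forall>l>m. dist (\<xi> m x) (\<xi> l x) < e" by blast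
    qed
    define \<zeta> where "\<zeta> x = lim (\<lambda>k. \<xi> k x)" for x
    have \<zeta>: "(\<lambda>k. \<xi> k x) \<longlonglongrightarrow> \<zeta> x" for x
      unfolding \<zeta>_def convergent_LIMSEQ_iff[symmetric] by (rule Cauchy_convergent[OF Cau])
    have d: "wl2 b (\<rho> / 2 ^ k) (\<lambda>x. \<xi> k x - \<zeta> x)" for k
    proof -
      have "wl2 b (\<rho> / 2 ^ k) (\<lambda>x. \<zeta> x - \<xi> k x)"
      proof (rule wl2_liminf)
        show "wl2 b (\<rho> / 2 ^ k) (\<lambda>x. \<xi> (k + j) x - \<xi> k x)" for j by (rule sob_wl2[OF tail'])
        show "(\<lambda>j. \<xi> (k + j) x - \<xi> k x) \<longlonglongrightarrow> \<zeta> x - \<xi> k x" for x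
          using LIMSEQ_ignore_initial_segment[OF \<zeta>, of k] by (intro tendsto_intros) (simp add: add.commute)
      qed
      from wl2_minus[OF this] show ?thesis by simp
    qed
    have w\<zeta>: "wl2 b \<rho> \<zeta>" using wl2_minus[OF d[of 0]] by (simp add: \<xi>0)
    have bk: "\<bar>\<xi> k x\<bar> \<le> 2 * exp b * K0" for k x
    proof -
      have "\<bar>\<xi> k x\<bar> \<le> 2 * exp b * \<rho>" using sob2_bound[OF tail'[of 0 k], of x] by (simp add: \<xi>0)
      also have "\<dots> \<le> 2 * exp b * K0" using rK by simp
      finally show ?thesis .
    qed
    have b\<zeta>: "\<bar>\<zeta> x\<bar> \<le> 2 * exp b * K0" for x
      by (rule LIMSEQ_le_const2[OF tendsto_rabs[OF \<zeta>]]) (use bk in auto)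
    have e\<zeta>: "\<zeta> (-x) = \<zeta> x" for x
    proof -
      have "(\<lambda>k. \<xi> k (-x)) \<longlonglongrightarrow> \<zeta> x" using \<zeta>[of x] I by simp
      then show ?thesis using LIMSEQ_unique \<zeta> by blast
    qed
    obtain f where f: "slv (Psi n \<zeta>) f" using solve_Psi[OF n0(2) w\<zeta> b\<zeta> e\<zeta>] by blast
    obtain B' where B': "B' > 0" "\<And>\<xi> \<eta> \<epsilon> L L'. wl2 b L \<xi> \<Longrightarrow> wl2 b L' \<eta> \<Longrightarrow> (\<forall>x. \<bar>\<xi> x\<bar> \<le> 2 * exp b * K0) \<Longrightarrow>
      (\<forall>x. \<bar>\<eta> x\<bar> \<le> 2 * exp b * K0) \<Longrightarrow> wl2 b \<epsilon> (\<lambda>x. \<xi> x - \<eta> x) \<Longrightarrow>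
      wl2 b (B' * \<epsilon>) (\<lambda>x. Q n \<xi> x - Q n \<eta> x)" using Q_lipschitz[OF n0(2)] by blast
    let ?D = "A * (2 * exp b * B')"
    have conv: "sob b 2 (?D * (\<rho> / 2 ^ k)) (\<lambda>x. \<xi> (Suc k) x - f x)" for k
    proof -
      have "wl2 b \<rho> (\<xi> k)" using sob_wl2[OF tail'[of 0 k]] by (simp add: \<xi>0)
      from B'(2)[OF this w\<zeta> _ _ d] have "wl2 b (B' * (\<rho> / 2 ^ k)) (\<lambda>x. Q n (\<xi> k) x - Q n \<zeta> x)"
        using bk b\<zeta> by blast
      from wl2_cdiff[OF b0 this] have "wl2 b (2 * exp b * (B' * (\<rho> / 2 ^ k))) (\<lambda>x. Psi n (\<xi> k) x - Psi n \<zeta> x)"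
        unfolding Psi_diff .
      from inverse_bound[OF solves_diff[OF _ f] this, of "\<xi> (Suc k)"] show ?thesis
        using I[of k] by (simp add: mult_ac)
    qed
    have "f x = \<zeta> x" for x
    proof -
      have "(\<lambda>k. \<xi> (Suc k) x - f x) \<longlonglongrightarrow> 0"
      proof (rule Lim_null_comparison)
        show "\<forall>\<^sub>F k in sequentially. norm (\<xi> (Suc k) x - f x) \<le> (2 * exp b * ?D) * (\<rho> / 2 ^ k)"
          using sob2_bound[OF conv, of _ x] by (intro always_eventually allI) (simp add: mult_ac)
        show "(\<lambda>k. (2 * exp b * ?D) * (\<rho> / 2 ^ k)) \<longlonglongrightarrow> 0" by (rule small)
      qed
      moreover have "(\<lambda>k. \<xi> (Suc k) x - f x) \<longlonglongrightarrow> \<zeta> x - f x"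
        by (intro tendsto_intros LIMSEQ_Suc \<zeta>)
      ultimately show ?thesis using LIMSEQ_unique by fastforce
    qed
    then have f\<zeta>: "f = \<zeta>" by blast
    have "\<forall>\<^sub>F k in sequentially. ?D * (\<rho> / 2 ^ k) < \<rho>"
      using small[of ?D] \<rho> by (auto dest: order_tendstoD)
    \<comment> \<open>One late iterate is enough: it has norm at most \<rho> and its successor bound
      differs from \<zeta> by less than \<rho>, whence the final constant 2 C.\<close>
    then obtain k where k: "?D * (\<rho> / 2 ^ k) < \<rho>" by (auto simp: eventually_sequentially)
    have "sob b 2 \<rho> (\<xi> (Suc k))" using tail'[of 0 "Suc k"] by (simp add: \<xi>0 del: sob.simps)
    then have "sob b 2 (\<rho> + ?D * (\<rho> / 2 ^ k)) (\<lambda>x. \<xi> (Suc k) x - (\<xi> (Suc k) x - f x))"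
      by (rule sob_diff[OF _ conv])
    then have S: "sob b 2 (\<rho> + ?D * (\<rho> / 2 ^ k)) \<zeta>" by (simp add: f\<zeta> del: sob.simps)
    have "sob b 2 (2 * C / real n) \<zeta>"
      by (rule sob_mono[OF S]) (use k in \<open>simp add: \<rho>_def\<close>)
    then show ?thesis using f f\<zeta> by blast
  qed
  moreover have "0 < 2 * C" using C by simp
  ultimately show ?thesis using N(1) by blast
qed

end

section \<open>Smooth potentials\<close>

declare sob.simps(2) [simp del]

lemma wl2_scale:
  assumes "wl2 b K f" "\<bar>c\<bar> \<le> C" "0 < C" shows "wl2 b (C * K) (\<lambda>x. c * f x)"
proof (rule wl2_bound[OF assms(1) _ _ assms(3)])
  note [measurable] = wl2_measurable[OF assms(1)]
  show "(\<lambda>x. c * f x) \<in> borel_measurable borel" by simp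
qed (use assms(2) in \<open>auto simp: abs_mult intro!: mult_right_mono\<close>)

text \<open>Keeps small factors such as 1/n^2 intact, where \<open>sob_cmult\<close> would replace
  |c| by |c| + 1.\<close>

lemma sob_scale: "sob b m K f \<Longrightarrow> \<bar>c\<bar> \<le> C \<Longrightarrow> 0 < C \<Longrightarrow> sob b m (C * K) (\<lambda>x. c * f x)"
proof (induction m arbitrary: f)
  case 0 then show ?case using wl2_scale by simp
next
  case (Suc m)
  obtain f' where f: "ac f f'" "sob b m K f'" "wl2 b K f" using Suc.prems(1) by (rule sob_SucE)
  show ?case by (rule sob_SucI[OF wl2_scale[OF f(3) Suc.prems(2,3)] ac_cmult[OF f(1)] Suc.IH[OF f(2) Suc.prems(2,3)]])
qed

text \<open>Solving the identity of \<open>Cn_deriv\<close> for T expresses T g as \<delta> g - Cn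
  g', bounded uniformly in n, divided by \<omega>^2: one lost derivative buys a second factor
  1/n.\<close>

lemma sob_Tn_gain:
  assumes b: "0 \<le> b" and g: "sob b (Suc m) K g" and n: "n \<ge> 1"
  shows "sob b m (1 / (real n)\<^sup>2 * (3 * exp b * K)) (Tn n g)"
proof -
  obtain g1 where g1: "ac g g1" "sob b m K g1" using g by (rule sob_SucE)
  let ?w = "2 * pi * real n"
  have w: "0 < ?w" "real n \<le> ?w" using n pi_gt3 mult_right_mono[of 1 "2 * pi" "real n"] by auto
  have "sob b m (2 * exp b * K + exp b * K) (\<lambda>x. cdiff g x - Cn n g1 x)"
    by (intro sob_diff sob_cdiff[OF b] sob_Cn[OF b] sob_SucD[OF g] g1)
  moreover have "2 * exp b * K + exp b * K = 3 * exp b * K" by simp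
  ultimately have "sob b m (3 * exp b * K) (\<lambda>x. cdiff g x - Cn n g1 x)" by (simp only:)
  then have "sob b m (1 / (real n)\<^sup>2 * (3 * exp b * K)) (\<lambda>x. (1 / ?w\<^sup>2) * (cdiff g x - Cn n g1 x))"
  proof (rule sob_scale)
    have "(real n)\<^sup>2 \<le> ?w\<^sup>2" using w n by (intro power_mono) auto
    then have "1 / ?w\<^sup>2 \<le> 1 / (real n)\<^sup>2" using n w by (intro divide_left_mono mult_pos_pos) auto
    then show "\<bar>1 / ?w\<^sup>2\<bar> \<le> 1 / (real n)\<^sup>2" by (simp add: abs_of_nonneg)
  qed (use n in auto)
  moreover have "(1 / ?w\<^sup>2) * (cdiff g x - Cn n g1 x) = Tn n g x" for x
    using w(1) n unfolding Cn_deriv[OF g1(1) n] by simp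
  ultimately show ?thesis by simp
qed

text \<open>An equation u'' = h turns regularity of the right-hand side into two further derivatives
  of u; as densities matter only almost everywhere, \<open>h\<close> may replace \<open>u2\<close>
  in \<open>ac\<close>.\<close>

lemma sob_bootstrap:
  assumes u: "sob b (Suc m) K u" and m: "1 \<le> m" and ac: "ac u u1" "ac u1 u2" and e: "ae_eq u2 h" and h: "sob b m K' h"
  shows "sob b (Suc (Suc m)) (max K K') u"
proof -
  have K: "K \<le> max K K'" "K' \<le> max K K'" by auto
  have u1: "sob b m K u1" by (rule sob_ac_D[OF u ac(1)]) (use ac_continuous[OF ac(2)] in simp)
  have "ac u1 h" by (rule ac_cong_AE[OF ac(2) wl2_measurable[OF sob_wl2[OF h]] e])
  from sob_SucI[OF wl2_mono[OF sob_wl2[OF u1] K(1)] this sob_mono[OF h K(2)]]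
  have "sob b (Suc m) (max K K') u1" .
  from sob_SucI[OF wl2_mono[OF sob_wl2[OF u] K(1)] ac(1) this] show ?thesis .
qed

lemma sob_all_smooth:
  assumes "\<And>m. \<exists>K. sob b m K u" shows "smooth u"
proof -
  have "Cd k u" if "\<And>m. \<exists>K. sob b m K u" for k u
    using that
  proof (induction k arbitrary: u)
    case 0
    obtain K where "sob b (Suc 0) K u" using 0 by blast
    then show ?case using sob_continuous by simp
  next
    case (Suc k)
    obtain K where "sob b (Suc 1) K u" using Suc.prems by blast
    then obtain u1 where u1: "ac u u1" "sob b (Suc 0) K u1" by (auto elim: sob_SucE)
    have c: "continuous_on UNIV u1" by (rule sob_continuous[OF u1(2)])
    have "\<exists>K. sob b m K u1" for m
    proof -
      obtain K where "sob b (Suc m) K u" using Suc.prems by blast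
      then show ?thesis using sob_ac_D[OF _ u1(1)] c by blast
    qed
    then show ?case using Cd_SucI[OF ac_DERIV[OF u1(1) c] Suc.IH] by blast
  qed
  then show ?thesis using assms unfolding smooth_iff_Cd by blast
qed

section \<open>Forms of the fixed-point equation, uniform regularity and quadratic decay\<close>

context perturbed_wave begin

text \<open>Adding the equation of \<open>s\<close> and moving the linear term back to the right
  cancels all traces of the linearisation. What remains is the first wave equation after elimination
  of the second unknown.\<close>

lemma fixed_point_iff:
  assumes u: "\<And>x. u (-x) = u x" "sob b 2 L u" "ac u u1" "ac u1 u2"
  shows "slv (Psi n (\<lambda>x. u x - s x)) (\<lambda>x. u x - s x) \<longleftrightarrow>
    (AE x in lborel. c\<^sup>2 * u2 x = cdiff (\<lambda>y. \<nu> * (cdiff (\<lambda>z. F (u z)) y + \<mu> * res n (\<lambda>z. F (u z)) y)) x)"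
    (is "_ \<longleftrightarrow> (AE x in lborel. c\<^sup>2 * u2 x = ?R x)")
proof -
  obtain s1 s2 where s12: "ac s s1" "ac s1 s2" "AE x in lborel. c\<^sup>2 * s2 x = \<nu> * cdiff (cdiff (\<lambda>y. F (s y))) x"
    using s_eq by blast
  have gg: "gg (\<lambda>x. u x - s x) = (\<lambda>z. F (u z))" by (simp add: gg_def)
  have P: "Psi n (\<lambda>x. u x - s x) x = ?R x - \<nu> * cdiff (cdiff (\<lambda>y. F (s y))) x
      - cdiff (cdiff (\<lambda>y. \<nu> * F' (s y) * (u y - s y))) x" for x
    by (simp add: Psi_def Q_def gg remainder_def) (simp add: cdiff_def algebra_simps)
  have d: "ac (\<lambda>x. u x - s x) (\<lambda>x. u1 x - s1 x)" "ac (\<lambda>x. u1 x - s1 x) (\<lambda>x. u2 x - s2 x)"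
    by (intro ac_diff u s12)+
  show ?thesis
  proof
    assume "slv (Psi n (\<lambda>x. u x - s x)) (\<lambda>x. u x - s x)"
    then obtain f1 f2 where f: "ac (\<lambda>x. u x - s x) f1" "ac f1 f2"
      "AE x in lborel. c\<^sup>2 * f2 x - cdiff (cdiff (\<lambda>y. \<nu> * F' (s y) * (u y - s y))) x = Psi n (\<lambda>x. u x - s x) x"
      by (auto simp: solves_def)
    have "f1 = (\<lambda>x. u1 x - s1 x)"
      by (rule ac_unique_continuous[OF f(1) d(1) ac_continuous[OF f(2)] ac_continuous[OF d(2)]])
    then have "ae_eq f2 (\<lambda>x. u2 x - s2 x)" using ac_unique f(2) d(2) by blast
    then show "AE x in lborel. c\<^sup>2 * u2 x = ?R x"
      using f(3) s12(3)
    proof eventually_elim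
      case (elim x)
      have "c\<^sup>2 * u2 x = c\<^sup>2 * f2 x + c\<^sup>2 * s2 x"
        using elim(1) by (simp flip: distrib_left)
      then show ?case using elim(2,3) unfolding P by linarith
    qed
  next
    assume "AE x in lborel. c\<^sup>2 * u2 x = ?R x"
    then have "AE x in lborel. c\<^sup>2 * (u2 x - s2 x) - cdiff (cdiff (\<lambda>y. \<nu> * F' (s y) * (u y - s y))) x = Psi n (\<lambda>x. u x - s x) x"
      using s12(3) by eventually_elim (simp add: P algebra_simps)
    then show "slv (Psi n (\<lambda>x. u x - s x)) (\<lambda>x. u x - s x)"
      unfolding solves_def using d sob_diff[OF u(2) s(2)] u(1) s(1) by auto
  qed
qed

text \<open>Retains the difference F(s + \<xi>) - F(s), so that each term on the right is small with
  \<xi> or contains \<open>res\<close>; the equation for s + \<xi> in \<open>fixed_point_iff\<close>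
  hides this smallness.\<close>

lemma slv_second_derivative:
  assumes x: "slv (Psi n \<xi>) \<xi>"
  obtains \<xi>1 \<xi>2 where "ac \<xi> \<xi>1" "ac \<xi>1 \<xi>2"
    "ae_eq \<xi>2 (\<lambda>x. 1 / c\<^sup>2 * cdiff (\<lambda>y. \<nu> * (cdiff (\<lambda>z. F (s z + \<xi> z) - F (s z)) y + \<mu> * res n (gg \<xi>) y)) x)"
proof -
  obtain f1 f2 where f: "ac \<xi> f1" "ac f1 f2"
    "AE x in lborel. c\<^sup>2 * f2 x - cdiff (cdiff (\<lambda>y. \<nu> * F' (s y) * \<xi> y)) x = Psi n \<xi> x"
    using x by (auto simp: solves_def)
  have P: "Psi n \<xi> x + cdiff (cdiff (\<lambda>y. \<nu> * F' (s y) * \<xi> y)) x =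
      cdiff (\<lambda>y. \<nu> * (cdiff (\<lambda>z. F (s z + \<xi> z) - F (s z)) y + \<mu> * res n (gg \<xi>) y)) x" for x
    by (simp add: Psi_def Q_def remainder_def) (simp add: cdiff_def algebra_simps)
  have "ae_eq f2 (\<lambda>x. 1 / c\<^sup>2 * cdiff (\<lambda>y. \<nu> * (cdiff (\<lambda>z. F (s z + \<xi> z) - F (s z)) y + \<mu> * res n (gg \<xi>) y)) x)"
    using f(3)
  proof eventually_elim
    case (elim x)
    then have "c\<^sup>2 * f2 x = Psi n \<xi> x + cdiff (cdiff (\<lambda>y. \<nu> * F' (s y) * \<xi> y)) x" by simp
    then show ?case unfolding P using c by (simp add: field_simps)
  qed
  with f that show ?thesis by blast
qed

lemma sob_rhs:
  assumes "sob b m K g" "sob b m K' r"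
  shows "sob b m ((1 / c\<^sup>2) * (2 * exp b * (\<nu> * (2 * exp b * K + \<mu> * K'))))
    (\<lambda>x. 1 / c\<^sup>2 * cdiff (\<lambda>y. \<nu> * (cdiff g y + \<mu> * r y)) x)"
  by (rule sob_scale[OF sob_cdiff[OF b0 sob_scale[OF sob_add[OF sob_cdiff[OF b0 assms(1)] sob_scale[OF assms(2)]]]]])
     (use \<nu> \<mu> c in auto)

context
  assumes smF: "\<And>k. Cd k F"
begin

lemma F_sob:
  assumes "2 \<le> m" "0 < K" shows "\<exists>L>0. \<forall>u. sob b m K u \<longrightarrow> sob b m (L * K) (\<lambda>x. F (u x))"
proof -
  obtain L where L: "L > 0" "\<And>a \<xi> \<epsilon>. sob b (max 2 m) K a \<Longrightarrow> sob b (max 2 m) \<epsilon> \<xi> \<Longrightarrow> \<epsilon> \<le> K \<Longrightarrow>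
    sob b m (L * \<epsilon>) (\<lambda>x. F (a x + \<xi> x) - F (a x))"
    using sob_compose_diff[OF b0 assms(2) _ smF, of m] assms(1) by auto
  have "sob b m (L * K) (\<lambda>x. F (u x))" if u: "sob b m K u" for u
    using L(2)[OF sob_zero[OF assms(2)], of K u] u assms(1) F(3) by (simp add: max_absorb2)
  with L show ?thesis by blast
qed

lemma s_regular: "\<exists>K. sob b m K s"
proof -
  obtain s1 s2 where s12: "ac s s1" "ac s1 s2" "AE x in lborel. c\<^sup>2 * s2 x = \<nu> * cdiff (cdiff (\<lambda>y. F (s y))) x"
    using s_eq by blast
  have "\<exists>K. sob b (Suc (Suc m)) K s" for m
  proof (induction m)
    case 0 then show ?case using s(2) by (auto simp: numeral_2_eq_2)
  next
    case (Suc m)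
    then obtain K where K: "sob b (Suc (Suc m)) K s" by blast
    obtain L where "sob b (Suc (Suc m)) (L * K) (\<lambda>x. F (s x))"
      using F_sob[OF _ sob_pos[OF K], of "Suc (Suc m)"] K by auto
    from sob_cmult[OF sob_cdiff[OF b0 sob_cdiff[OF b0 sob_SucD[OF this]]], of "\<nu> / c\<^sup>2"]
    obtain K' where h: "sob b (Suc m) K' (\<lambda>x. \<nu> / c\<^sup>2 * cdiff (cdiff (\<lambda>x. F (s x))) x)" by blast
    have "ae_eq s2 (\<lambda>x. \<nu> / c\<^sup>2 * cdiff (cdiff (\<lambda>x. F (s x))) x)"
      using s12(3) c by (auto simp: field_simps)
    from sob_bootstrap[OF K _ s12(1,2) this h] show ?case by auto
  qed
  from this[of m] show ?thesis using sob_le[of b "Suc (Suc m)" _ s m] by auto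
qed

text \<open>By \<open>res_Cn\<close> the term \<open>res\<close> is Cn of one derivative, bounded
  uniformly in n. It costs one order while the equation returns two, so each round gains one order
  without n entering the constant.\<close>

lemma uniform_regularity:
  assumes C: "0 < C" and N: "N \<ge> 1" and \<xi>: "\<And>n. n \<ge> N \<Longrightarrow> sob b 2 (C / real n) (\<xi> n)"
    "\<And>n. n \<ge> N \<Longrightarrow> slv (Psi n (\<xi> n)) (\<xi> n)"
  shows "\<exists>K>0. \<forall>n\<ge>N. sob b m K (\<lambda>x. s x + \<xi> n x)"
proof -
  have "\<exists>K>0. \<forall>n\<ge>N. sob b (Suc (Suc m)) K (\<lambda>x. s x + \<xi> n x)" for m
  proof (induction m)
    case 0
    have "sob b 2 (K0 + C) (\<lambda>x. s x + \<xi> n x)" if n: "n \<ge> N" for n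
    proof (rule sob_add[OF s(2) sob_mono[OF \<xi>(1)[OF n]]])
      show "C / real n \<le> C" using n N C by (simp add: divide_le_eq mult_le_cancel_left1)
    qed
    then show ?case using K0 C by (intro exI[of _ "K0 + C"]) (auto simp: numeral_2_eq_2)
  next
    case (Suc m)
    then obtain K where K: "0 < K" "\<And>n. n \<ge> N \<Longrightarrow> sob b (Suc (Suc m)) K (\<lambda>x. s x + \<xi> n x)" by blast
    obtain L where L: "L > 0" "\<And>u. sob b (Suc (Suc m)) K u \<Longrightarrow> sob b (Suc (Suc m)) (L * K) (\<lambda>x. F (u x))"
      using F_sob[of "Suc (Suc m)" K] K(1) by auto
    define K' where "K' = (1 / c\<^sup>2) * (2 * exp b * (\<nu> * (2 * exp b * (L * K) + \<mu> * (exp b * (L * K)))))"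
    have "sob b (Suc (Suc (Suc m))) (max K K') (\<lambda>x. s x + \<xi> n x)" if n: "n \<ge> N" for n
    proof -
      have n1: "n \<ge> 1" using n N by simp
      let ?u = "\<lambda>x. s x + \<xi> n x"
      note u = K(2)[OF n]
      have "sob b 2 K ?u" by (rule sob_le[OF u]) simp
      then obtain u1 u2 where u12: "ac ?u u1" "ac u1 u2" by (rule sob_2E)
      have "slv (Psi n (\<lambda>x. ?u x - s x)) (\<lambda>x. ?u x - s x)" using \<xi>(2)[OF n] by simp
      moreover have "?u (-x) = ?u x" for x using s(1) solves_even[OF \<xi>(2)[OF n]] by simp
      ultimately have "AE x in lborel. c\<^sup>2 * u2 x = cdiff (\<lambda>y. \<nu> * (cdiff (\<lambda>z. F (?u z)) y + \<mu> * res n (\<lambda>z. F (?u z)) y)) x"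
        using fixed_point_iff[of ?u K u1 u2 n] \<open>sob b 2 K ?u\<close> u12 by blast
      then have e: "ae_eq u2 (\<lambda>x. 1 / c\<^sup>2 * cdiff (\<lambda>y. \<nu> * (cdiff (\<lambda>z. F (?u z)) y + \<mu> * res n (\<lambda>z. F (?u z)) y)) x)"
        using c by (auto simp: field_simps)
      note g = L(2)[OF u]
      obtain g1 where g1: "ac (\<lambda>z. F (?u z)) g1" "sob b (Suc m) (L * K) g1" using g by (rule sob_SucE)
      have "sob b (Suc m) K' (\<lambda>x. 1 / c\<^sup>2 * cdiff (\<lambda>y. \<nu> * (cdiff (\<lambda>z. F (?u z)) y + \<mu> * res n (\<lambda>z. F (?u z)) y)) x)"
        unfolding K'_def res_Cn[OF g1(1) n1]
        by (rule sob_rhs[OF sob_SucD[OF g] sob_Cn[OF b0 g1(2)]])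
      from sob_bootstrap[OF u _ u12 e this] show ?thesis by simp
    qed
    moreover have "0 < max K K'" using K by simp
    ultimately show ?case by blast
  qed
  from this[of m] show ?thesis using sob_le[of b "Suc (Suc m)" _ _ m] by (metis le_SucI order_refl)
qed

text \<open>F(s + \<xi>) is bounded uniformly in n at all orders, so T gains 1/n^2 at every order.
  At order two the Taylor remainder is quadratic in \<xi>, itself O(1/n), and the inverse of \<H>
  gives the rate; higher orders follow from the equation for the second derivative of \<xi>.\<close>

lemma quadratic_decay:
  assumes C: "0 < C" and N: "N \<ge> 1" and CK: "\<And>n. n \<ge> N \<Longrightarrow> C / real n \<le> K0"
    and \<xi>: "\<And>n. n \<ge> N \<Longrightarrow> sob b 2 (C / real n) (\<xi> n)" "\<And>n. n \<ge> N \<Longrightarrow> slv (Psi n (\<xi> n)) (\<xi> n)"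
  shows "\<exists>K>0. \<forall>n\<ge>N. sob b m (K / (real n)\<^sup>2) (\<xi> n)"
    and "\<exists>K>0. \<forall>n\<ge>N. sob b m (K / (real n)\<^sup>2) (Tn n (\<lambda>x. F (s x + \<xi> n x)))"
proof -
  have reg: "\<exists>G>0. \<forall>n\<ge>N. sob b m G (gg (\<xi> n))" for m
  proof -
    obtain K where K: "0 < K" "\<And>n. n \<ge> N \<Longrightarrow> sob b (Suc (Suc m)) K (\<lambda>x. s x + \<xi> n x)"
      using uniform_regularity[OF C N \<xi>] by blast
    obtain L where L: "L > 0" "\<And>u. sob b (Suc (Suc m)) K u \<Longrightarrow> sob b (Suc (Suc m)) (L * K) (\<lambda>x. F (u x))"
      using F_sob[of "Suc (Suc m)" K] K(1) by auto
    have "sob b m (L * K) (gg (\<xi> n))" if "n \<ge> N" for n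
      unfolding gg_def using L(2)[OF K(2)[OF that]] by (rule sob_le) simp
    then show ?thesis using L(1) K(1) by (intro exI[of _ "L * K"]) auto
  qed
  show "\<exists>K>0. \<forall>n\<ge>N. sob b m (K / (real n)\<^sup>2) (Tn n (\<lambda>x. F (s x + \<xi> n x)))" for m
  proof -
    obtain G where G: "0 < G" "\<And>n. n \<ge> N \<Longrightarrow> sob b (Suc m) G (gg (\<xi> n))" using reg by blast
    have "sob b m ((3 * exp b * G) / (real n)\<^sup>2) (Tn n (\<lambda>x. F (s x + \<xi> n x)))" if "n \<ge> N" for n
      using sob_Tn_gain[OF b0 G(2)[OF that]] that N by (simp add: gg_def)
    then show ?thesis using G(1) by (intro exI[of _ "3 * exp b * G"]) auto
  qed
  \<comment> \<open>Three derivatives are spent: two through \<open>res_Tn\<close> and one through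
    \<open>sob_Tn_gain\<close>.\<close>
  have res: "\<exists>G>0. \<forall>n\<ge>N. sob b m (G / (real n)\<^sup>2) (res n (gg (\<xi> n)))" for m
  proof -
    obtain G where G: "0 < G" "\<And>n. n \<ge> N \<Longrightarrow> sob b (Suc (Suc (Suc m))) G (gg (\<xi> n))" using reg by blast
    have "sob b m ((3 * exp b * G) / (real n)\<^sup>2) (res n (gg (\<xi> n)))" if n: "n \<ge> N" for n
    proof -
      have n1: "n \<ge> 1" using n N by simp
      obtain g1 where g1: "ac (gg (\<xi> n)) g1" "sob b (Suc (Suc m)) G g1" using G(2)[OF n] by (rule sob_SucE)
      obtain g2 where g2: "ac g1 g2" "sob b (Suc m) G g2" using g1(2) by (rule sob_SucE)
      show ?thesis using sob_Tn_gain[OF b0 g2(2) n1] by (simp add: res_Tn[OF g1(1) g2(1) n1])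
    qed
    then show ?thesis using G(1) by (intro exI[of _ "3 * exp b * G"]) auto
  qed
  have "\<exists>K>0. \<forall>n\<ge>N. sob b (Suc (Suc m)) (K / (real n)\<^sup>2) (\<xi> n)" for m
  proof (induction m)
    case 0
    obtain M where M: "M > 0" "\<And>\<xi> \<eta> r \<epsilon>. sob b 2 r \<xi> \<Longrightarrow> sob b 2 r \<eta> \<Longrightarrow> r \<le> K0 \<Longrightarrow> wl2 b \<epsilon> (\<lambda>x. \<xi> x - \<eta> x) \<Longrightarrow>
      wl2 b (M * r * \<epsilon>) (\<lambda>x. remainder \<xi> x - remainder \<eta> x)" using remainder_contraction by blast
    obtain G where G: "0 < G" "\<And>n. n \<ge> N \<Longrightarrow> sob b 0 (G / (real n)\<^sup>2) (res n (gg (\<xi> n)))" using res by blast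
    define K where "K = A * (2 * exp b * (\<nu> * (2 * exp b * (M * C * C) + \<mu> * G)))"
    have "sob b 2 (K / (real n)\<^sup>2) (\<xi> n)" if n: "n \<ge> N" for n
    proof -
      have n0: "0 < real n" using n N by simp
      \<comment> \<open>Comparison with \<eta> = 0, whose remainder is zero, for r = \<epsilon> =
        C/n: the product M r \<epsilon> is the quadratic rate.\<close>
      have "sob b 2 (C / real n) (\<lambda>_. 0)" by (rule sob_zero) (use C n0 in simp)
      from M(2)[OF \<xi>(1)[OF n] this CK[OF n], of "C / real n"] sob_wl2[OF \<xi>(1)[OF n]]
      have "wl2 b (M * (C / real n) * (C / real n)) (remainder (\<xi> n))"
        by (simp add: remainder_def[of "\<lambda>_. 0"])
      then have r: "sob b 0 (M * C * C / (real n)\<^sup>2) (remainder (\<xi> n))" by (simp add: power2_eq_square)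
      have "sob b 0 (2 * exp b * (\<nu> * (2 * exp b * (M * C * C / (real n)\<^sup>2) + \<mu> * (G / (real n)\<^sup>2)))) (Psi n (\<xi> n))"
        unfolding Psi_def Q_def
        by (rule sob_cdiff[OF b0 sob_scale[OF sob_add[OF sob_cdiff[OF b0 r] sob_scale[OF G(2)[OF n]]]]])
           (use \<nu> \<mu> in auto)
      then have "wl2 b (2 * exp b * (\<nu> * (2 * exp b * (M * C * C / (real n)\<^sup>2) + \<mu> * (G / (real n)\<^sup>2)))) (Psi n (\<xi> n))"
        by simp
      from inverse_bound[OF \<xi>(2)[OF n] this]
      have "sob b 2 (A * (2 * exp b * (\<nu> * (2 * exp b * (M * C * C / (real n)\<^sup>2) + \<mu> * (G / (real n)\<^sup>2))))) (\<xi> n)" .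
      moreover have "A * (2 * exp b * (\<nu> * (2 * exp b * (M * C * C / (real n)\<^sup>2) + \<mu> * (G / (real n)\<^sup>2)))) = K / (real n)\<^sup>2"
        by (simp add: K_def add_divide_distrib distrib_left)
      ultimately show ?thesis by (simp only:)
    qed
    moreover have "0 < K" unfolding K_def using A \<nu> \<mu> M(1) C G(1) by (intro mult_pos_pos add_pos_pos) auto
    ultimately show ?case by (intro exI[of _ K]) (simp add: numeral_2_eq_2)
  next
    case (Suc m)
    then obtain K where K: "0 < K" "\<And>n. n \<ge> N \<Longrightarrow> sob b (Suc (Suc m)) (K / (real n)\<^sup>2) (\<xi> n)" by blast
    obtain S where S: "sob b (Suc (Suc m)) S s" using s_regular by blast
    let ?S = "max S K"
    have S0: "0 < ?S" using K(1) by simp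
    have S': "sob b (max 2 (Suc (Suc m))) ?S s" using sob_mono[OF S] by simp
    obtain L where L: "L > 0" "\<And>a \<xi> \<epsilon>. sob b (max 2 (Suc (Suc m))) ?S a \<Longrightarrow> sob b (max 2 (Suc (Suc m))) \<epsilon> \<xi> \<Longrightarrow> \<epsilon> \<le> ?S \<Longrightarrow>
      sob b (Suc (Suc m)) (L * \<epsilon>) (\<lambda>x. F (a x + \<xi> x) - F (a x))"
      using sob_compose_diff[OF b0 S0 _ smF, of "Suc (Suc m)"] by auto
    obtain G where G: "0 < G" "\<And>n. n \<ge> N \<Longrightarrow> sob b (Suc m) (G / (real n)\<^sup>2) (res n (gg (\<xi> n)))" using res by blast
    define K' where "K' = (1 / c\<^sup>2) * (2 * exp b * (\<nu> * (2 * exp b * (L * K) + \<mu> * G)))"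
    have "sob b (Suc (Suc (Suc m))) (max K K' / (real n)\<^sup>2) (\<xi> n)" if n: "n \<ge> N" for n
    proof -
      have n1: "1 \<le> real n" using n N by simp
      then have "1 \<le> (real n)\<^sup>2" by simp
      then have "K / (real n)\<^sup>2 \<le> K / 1" using K(1) n1 by (intro divide_left_mono) auto
      then have "K / (real n)\<^sup>2 \<le> ?S" by simp
      from L(2)[OF S' _ this, of "\<xi> n"] K(2)[OF n]
      have D: "sob b (Suc (Suc m)) (L * (K / (real n)\<^sup>2)) (\<lambda>x. F (s x + \<xi> n x) - F (s x))"
        by simp
      obtain \<xi>1 \<xi>2 where x12: "ac (\<xi> n) \<xi>1" "ac \<xi>1 \<xi>2"
        "ae_eq \<xi>2 (\<lambda>x. 1 / c\<^sup>2 * cdiff (\<lambda>y. \<nu> * (cdiff (\<lambda>z. F (s z + \<xi> n z) - F (s z)) y + \<mu> * res n (gg (\<xi> n)) y)) x)"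
        using slv_second_derivative[OF \<xi>(2)[OF n]] .
      note h = sob_rhs[OF sob_SucD[OF D] G(2)[OF n]]
      have e: "(1 / c\<^sup>2) * (2 * exp b * (\<nu> * (2 * exp b * (L * (K / (real n)\<^sup>2)) + \<mu> * (G / (real n)\<^sup>2)))) = K' / (real n)\<^sup>2"
        by (simp add: K'_def add_divide_distrib distrib_left)
      from sob_bootstrap[OF K(2)[OF n] _ x12 h[unfolded e]]
      have "sob b (Suc (Suc (Suc m))) (max (K / (real n)\<^sup>2) (K' / (real n)\<^sup>2)) (\<xi> n)" by simp
      then show ?thesis by (rule sob_mono) (simp add: divide_right_mono)
    qed
    moreover have "0 < max K K'" using K(1) by simp
    ultimately show ?case by blast
  qed
  from this[of m] show "\<exists>K>0. \<forall>n\<ge>N. sob b m (K / (real n)\<^sup>2) (\<xi> n)"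
    using sob_le[of b "Suc (Suc m)" _ _ m] by (metis le_SucI order_refl)
qed

end

end

section \<open>From admissibility to the fixed-point problem\<close>

lemma cdiff_measurable [measurable]:
  assumes [measurable]: "f \<in> borel_measurable borel" shows "cdiff f \<in> borel_measurable borel"
  unfolding cdiff_def[abs_def] by measurable

lemma Hw_space_measurable: "f \<in> Hw_space r b \<Longrightarrow> f \<in> borel_measurable borel"
  by (auto simp: Hw_space_def H_space_def L2_def)

lemma Hw_space_rep:
  assumes "0 \<le> b" "f \<in> Hw_space (real m) b" obtains u K where "ae_eq f u" "sob b m K u"
proof -
  have "Hw_norm (real m) b f \<le> max (Hw_norm (real m) b f) 1" "0 < max (Hw_norm (real m) b f) 1" by auto
  with Hw_space_sob[OF assms(1), of m] assms(2) that show ?thesis by blast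
qed

lemma Hw_norm_nonneg: "0 \<le> Hw_norm 2 b f"
  by (simp add: Hw_norm_def H_norm_def frac_def sum_nonneg)

lemma has_weak_deriv_2_ac:
  assumes "f \<in> borel_measurable borel" "ae_eq f u" "ac u u1" "ac u1 u2"
  shows "has_weak_deriv 2 f u2"
proof -
  have "has_weak_deriv (Suc (Suc 0)) u u2"
    by (intro has_weak_deriv_ac[OF assms(3)] has_weak_deriv_ac[OF assms(4)] has_weak_deriv_0 acD(1)[OF assms(4)])
  then show ?thesis
    using wderiv_cong_AE(1)[OF assms(1) borel_measurable_continuous_onI[OF ac_continuous[OF assms(3)]] assms(2)]
    by (simp add: numeral_2_eq_2)
qed

lemma even_ae_continuous:
  assumes e: "even_ae f" and "f \<in> borel_measurable borel" "ae_eq f u" "continuous_on UNIV u"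
  shows "u (-x) = u x"
proof -
  have [measurable]: "f \<in> borel_measurable borel" "u \<in> borel_measurable borel"
    using assms borel_measurable_continuous_onI by auto
  have "AE x in lborel. f (0 + (-1) * x) = u (0 + (-1) * x)"
    by (rule AE_borel_affine) (use assms(3) in auto)
  then have "ae_eq (\<lambda>x. u (-x)) u"
    using e[unfolded even_ae_def] assms(3) by eventually_elim simp
  moreover have "continuous_on UNIV (\<lambda>x. u (-x))"
    by (rule continuous_on_compose2[OF assms(4)]) (auto intro: continuous_intros)
  ultimately have "(\<lambda>x. u (-x)) = u" using continuous_AE_eq_imp_eq assms(4) by blast
  then show ?thesis by metis
qed

lemma lin_op_AE:
  assumes [measurable]: "\<sigma> \<in> borel_measurable borel" "f \<in> borel_measurable borel"
    "(deriv ^^ 2) W \<in> borel_measurable borel"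
    and \<sigma>: "ae_eq \<sigma> s" "continuous_on UNIV s"
    and u: "ae_eq f u" "ac u u1" "ac u1 u2"
  shows "ae_eq (lin_op W c \<sigma> f) (\<lambda>x. c\<^sup>2 * u2 x - cdiff (cdiff (\<lambda>y. (deriv ^^ 2) W (s y) * u y)) x)"
    and "lin_op W c \<sigma> f \<in> borel_measurable borel"
proof -
  have wd: "has_weak_deriv 2 f u2" by (rule has_weak_deriv_2_ac[OF assms(2) u])
  have [measurable]: "s \<in> borel_measurable borel" "u \<in> borel_measurable borel" "wderiv 2 f \<in> borel_measurable borel"
    using \<sigma>(2) ac_continuous[OF u(2)] borel_measurable_continuous_onI wderiv_measurable[OF wd] by auto
  have "ae_eq (\<lambda>y. (deriv ^^ 2) W (\<sigma> y) * f y) (\<lambda>y. (deriv ^^ 2) W (s y) * u y)"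
    using \<sigma>(1) u(1) by eventually_elim simp
  from cdiff_cong_AE[OF _ _ cdiff_cong_AE[OF _ _ this]]
  have "ae_eq (cdiff (cdiff (\<lambda>y. (deriv ^^ 2) W (\<sigma> y) * f y))) (cdiff (cdiff (\<lambda>y. (deriv ^^ 2) W (s y) * u y)))"
    by measurable
  then show "ae_eq (lin_op W c \<sigma> f) (\<lambda>x. c\<^sup>2 * u2 x - cdiff (cdiff (\<lambda>y. (deriv ^^ 2) W (s y) * u y)) x)"
    using wderiv_AE[OF wd] unfolding lin_op_def by eventually_elim simp
  show "lin_op W c \<sigma> f \<in> borel_measurable borel" unfolding lin_op_def by measurable
qed

text \<open>Surjectivity is read off from the homeomorphism, but of the inverse only continuity is
  given. Since \<open>lin_op\<close> is linear up to null sets, continuity at zero and rescaling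
  produce the linear bound that the locale asks for.\<close>

lemma admissible_perturbed_wave:
  assumes \<mu>: "\<mu> > 0" and V: "C_k 5 V" "deriv V 0 = 0" and c: "c \<noteq> 0"
    and adm: "admissible_via (\<lambda>x. inverse (1 + \<mu>) * V x) c b \<sigma>"
  shows "\<exists>K0 A s. perturbed_wave c b (inverse (1 + \<mu>)) \<mu> K0 A (deriv V) (deriv (deriv V)) s \<and> ae_eq \<sigma> s"
proof -
  define \<nu> where "\<nu> = inverse (1 + \<mu>)"
  have \<nu>: "0 < \<nu>" using \<mu> by (simp add: \<nu>_def)
  define W where "W = (\<lambda>x. \<nu> * V x)"
  define F where "F = deriv V"
  define F' where "F' = deriv F"
  have "C_k (Suc 4) V" using V(1) by simp
  then have V1: "V differentiable at x" and C4: "C_k 4 F" for x unfolding C_k_Suc F_def by auto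
  then have "C_k (Suc 3) F" by simp
  then have F1: "F differentiable at x" and C3: "C_k 3 F'" for x unfolding C_k_Suc F'_def by auto
  have dV: "(V has_real_derivative F x) (at x)" for x
    using V1 by (simp add: F_def DERIV_deriv_iff_real_differentiable)
  have dF: "(F has_real_derivative F' x) (at x)" for x
    using F1 by (simp add: F'_def DERIV_deriv_iff_real_differentiable)
  have W1: "deriv W = (\<lambda>x. \<nu> * F x)"
    unfolding W_def by (rule ext, rule DERIV_imp_deriv) (auto intro!: derivative_eq_intros dV)
  have "deriv (\<lambda>x. \<nu> * F x) = (\<lambda>x. \<nu> * F' x)"
    by (rule ext, rule DERIV_imp_deriv) (auto intro!: derivative_eq_intros dF)
  then have W2: "(deriv ^^ 2) W = (\<lambda>x. \<nu> * F' x)" by (simp add: numeral_2_eq_2 W1)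
  have [measurable]: "F \<in> borel_measurable borel" "F' \<in> borel_measurable borel"
    using C4 C3 Cd_continuous unfolding C_k_iff_Cd by (blast intro: borel_measurable_continuous_onI)+
  have W2m: "(deriv ^^ 2) W \<in> borel_measurable borel" unfolding W2 by measurable
  have b: "0 < b" and \<sigma>E: "\<sigma> \<in> E_space 2 b"
    and \<sigma>eq: "AE x in lborel. c\<^sup>2 * wderiv 2 \<sigma> x - cdiff (cdiff (\<lambda>y. deriv W (\<sigma> y))) x = 0"
    and hom: "homeomorphism_ae (E_space 2 b) (Hw_norm 2 b) (E0_space 0 b) (Hw_norm 0 b) (lin_op W c \<sigma>)"
    using adm unfolding admissible_via_def W_def \<nu>_def by auto
  have b0: "0 \<le> b" using b by simp
  have \<sigma>H: "\<sigma> \<in> Hw_space (real 2) b" using \<sigma>E by (simp add: E_space_def)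
  note [measurable] = Hw_space_measurable[OF \<sigma>H]
  obtain s K0 where s: "ae_eq \<sigma> s" "sob b 2 K0 s" by (rule Hw_space_rep[OF b0 \<sigma>H])
  have sc: "continuous_on UNIV s" using s(2) ac_continuous by (auto elim: sob_2E)
  note [measurable] = borel_measurable_continuous_onI[OF sc]
  have se: "s (-x) = s x" for x
    by (rule even_ae_continuous[OF _ _ s(1) sc]) (use \<sigma>E in \<open>auto simp: E_space_def\<close>)
  obtain s1 s2 where s12: "ac s s1" "ac s1 s2" using s(2) by (rule sob_2E)
  have Fs: "ae_eq (\<lambda>y. \<nu> * F (\<sigma> y)) (\<lambda>y. \<nu> * F (s y))" using s(1) by eventually_elim simp
  have "ae_eq (cdiff (cdiff (\<lambda>y. \<nu> * F (\<sigma> y)))) (cdiff (cdiff (\<lambda>y. \<nu> * F (s y))))"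
    by (rule cdiff_cong_AE[OF _ _ cdiff_cong_AE[OF _ _ Fs]]) measurable
  moreover have "ae_eq (wderiv 2 \<sigma>) s2"
    by (rule wderiv_AE[OF has_weak_deriv_2_ac[OF Hw_space_measurable[OF \<sigma>H] s(1) s12]])
  ultimately have s_eq: "AE x in lborel. c\<^sup>2 * s2 x = \<nu> * cdiff (cdiff (\<lambda>y. F (s y))) x"
    using \<sigma>eq unfolding W1
    by eventually_elim (simp add: cdiff_def algebra_simps)
  let ?slv = "solves c b (\<lambda>y. \<nu> * F' (s y))"
  obtain A0 where A0: "A0 > 0" "\<And>f u K. f \<in> borel_measurable borel \<Longrightarrow> ae_eq f u \<Longrightarrow> wl2 b K u \<Longrightarrow>
    f \<in> Hw_space 0 b \<and> Hw_norm 0 b f \<le> A0 * K"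
    using sob_Hw_space[OF b0, of 0] by auto
  obtain A1 where A1: "A1 > 0" "\<And>f u K. f \<in> borel_measurable borel \<Longrightarrow> ae_eq f u \<Longrightarrow> sob b 2 K u \<Longrightarrow>
    f \<in> Hw_space 2 b \<and> Hw_norm 2 b f \<le> A1 * K"
    using sob_Hw_space[OF b0, of 2] by auto
  obtain A2 where A2: "A2 > 0" "\<And>f K. f \<in> Hw_space 2 b \<Longrightarrow> Hw_norm 2 b f \<le> K \<Longrightarrow> 0 < K \<Longrightarrow>
    \<exists>u. ae_eq f u \<and> sob b 2 (A2 * K) u"
    using Hw_space_sob[OF b0, of 2] by auto
  have E: "f \<in> E_space 2 b" if "sob b 2 L f" "\<And>x. f (-x) = f x" for f L
    using A1(2)[OF wl2_measurable[OF sob_wl2[OF that(1)]] _ that(1)] that(2) by (simp add: E_space_def even_ae_def)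
  let ?z = "\<lambda>_::real. 0::real"
  have zE: "?z \<in> E_space 2 b" by (rule E[OF sob_zero[of 1]]) auto
  have Tz: "ae_eq (lin_op W c \<sigma> ?z) ?z" and Tzm: "lin_op W c \<sigma> ?z \<in> borel_measurable borel"
    using lin_op_AE[OF _ _ W2m s(1) sc _ ac_const ac_const, of ?z 0 c] by (simp_all add: cdiff_def)
  have inv_cont: "\<forall>f\<in>E_space 2 b. \<forall>\<epsilon>>0. \<exists>d>0. \<forall>g\<in>E_space 2 b.
      Hw_norm 0 b (\<lambda>x. lin_op W c \<sigma> g x - lin_op W c \<sigma> f x) < d \<longrightarrow> Hw_norm 2 b (\<lambda>x. g x - f x) < \<epsilon>"
    using hom unfolding homeomorphism_ae_def by (elim conjE)
  obtain d where d: "d > 0" "\<And>g. g \<in> E_space 2 b \<Longrightarrow> Hw_norm 0 b (\<lambda>x. lin_op W c \<sigma> g x - lin_op W c \<sigma> ?z x) < d \<Longrightarrow>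
      Hw_norm 2 b (\<lambda>x. g x - 0) < 1"
    using inv_cont[rule_format, OF zE zero_less_one] by blast
  let ?A = "2 * A0 * A2 / d"
  have inv: "sob b 2 (?A * K) f" if f: "?slv h f" and h: "wl2 b K h" for h f K
  proof -
    have K: "0 < K" using h wl2_pos by blast
    \<comment> \<open>This scaling brings the image of t f to norm at most d / 2, below the
      continuity threshold. Then t f has norm below 1, and dividing by t gives the factor 2 A0 A2 K
      / d.\<close>
    define t where "t = d / (2 * A0 * K)"
    have t: "0 < t" using d(1) A0(1) K by (simp add: t_def)
    obtain f1 f2 L where f12: "ac f f1" "ac f1 f2" "sob b 2 L f"
      "AE x in lborel. c\<^sup>2 * f2 x - cdiff (cdiff (\<lambda>y. \<nu> * F' (s y) * f y)) x = h x"
      using f by (auto simp: solves_def)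
    let ?g = "\<lambda>x. t * f x"
    have gs: "sob b 2 ((\<bar>t\<bar> + 1) * L) ?g" by (rule sob_cmult[OF f12(3)])
    note [measurable] = wl2_measurable[OF sob_wl2[OF gs]] Tzm
    have gE: "?g \<in> E_space 2 b" by (rule E[OF gs]) (simp add: solves_even[OF f])
    note T = lin_op_AE[OF _ _ W2m s(1) sc _ ac_cmult[OF f12(1)] ac_cmult[OF f12(2)], of ?g t c]
    have "ae_eq (lin_op W c \<sigma> ?g) (\<lambda>x. t * h x)"
    proof -
      have e: "c\<^sup>2 * (t * f2 x) - cdiff (cdiff (\<lambda>y. (deriv ^^ 2) W (s y) * (t * f y))) x =
          t * (c\<^sup>2 * f2 x - cdiff (cdiff (\<lambda>y. \<nu> * F' (s y) * f y)) x)" for x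
        by (simp add: W2 cdiff_def algebra_simps)
      have "ae_eq (lin_op W c \<sigma> ?g) (\<lambda>x. c\<^sup>2 * (t * f2 x) - cdiff (cdiff (\<lambda>y. (deriv ^^ 2) W (s y) * (t * f y))) x)"
        using T(1) by simp
      then show ?thesis using f12(4) by eventually_elim (simp only: e)
    qed
    with Tz have D: "ae_eq (\<lambda>x. lin_op W c \<sigma> ?g x - lin_op W c \<sigma> ?z x) (\<lambda>x. t * h x)" by eventually_elim simp
    have [measurable]: "lin_op W c \<sigma> ?g \<in> borel_measurable borel" using T(2) by simp
    have "wl2 b (t * K) (\<lambda>x. t * h x)" by (rule wl2_scale[OF h]) (use t in auto)
    from A0(2)[OF _ D this] have "Hw_norm 0 b (\<lambda>x. lin_op W c \<sigma> ?g x - lin_op W c \<sigma> ?z x) \<le> A0 * (t * K)" by simp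
    also have "A0 * (t * K) = d / 2" using A0(1) K by (simp add: t_def)
    also have "d / 2 < d" using d(1) by simp
    finally have "Hw_norm 2 b ?g < 1" using d(2)[OF gE] by simp
    then obtain u where u: "ae_eq ?g u" "sob b 2 (A2 * 1) u"
      using A2(2)[of ?g 1] gE by (auto simp: E_space_def)
    have "?g = u"
      by (rule continuous_AE_eq_imp_eq[OF _ _ u(1)])
         (use u(2) gs ac_continuous in \<open>auto elim!: sob_2E\<close>)
    then have "sob b 2 (A2 * 1) ?g" using u(2) by simp
    from sob_scale[OF this, of "1 / t" "1 / t"] have "sob b 2 (1 / t * (A2 * 1)) f" using t by simp
    moreover have "1 / t * (A2 * 1) = ?A * K" by (simp add: t_def)
    ultimately show ?thesis by (simp only:)
  qed
  have surj: "\<exists>f. ?slv h f" if h: "wl2 b K h" "\<And>x. h (-x) = h x" "(LINT x|lborel. h x) = 0" for h K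
  proof -
    have "h \<in> E0_space 0 b"
      using A0(2)[OF wl2_measurable[OF h(1)] _ h(1)] h wl2_integrable[OF b h(1)]
      by (simp add: E0_space_def E_space_def even_ae_def)
    then obtain f where f: "f \<in> E_space 2 b" "ae_eq (lin_op W c \<sigma> f) h"
      using hom unfolding homeomorphism_ae_def by blast
    have fH: "f \<in> Hw_space (real 2) b" using f(1) by (simp add: E_space_def)
    obtain u L where u: "ae_eq f u" "sob b 2 L u" by (rule Hw_space_rep[OF b0 fH])
    obtain u1 u2 where u12: "ac u u1" "ac u1 u2" using u(2) by (rule sob_2E)
    have "u (-x) = u x" for x
      by (rule even_ae_continuous[OF _ Hw_space_measurable[OF fH] u(1) ac_continuous[OF u12(1)]])
         (use f(1) in \<open>simp add: E_space_def\<close>)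
    moreover have "AE x in lborel. c\<^sup>2 * u2 x - cdiff (cdiff (\<lambda>y. \<nu> * F' (s y) * u y)) x = h x"
      using lin_op_AE(1)[OF _ Hw_space_measurable[OF fH] W2m s(1) sc u(1) u12, of c] f(2)
      by (auto simp: W2 elim!: eventually_elim2)
    ultimately show ?thesis unfolding solves_def using u(2) u12 by blast
  qed
  have "perturbed_wave c b \<nu> \<mu> K0 ?A F F' s"
  proof
    show "\<exists>s1 s2. ac s s1 \<and> ac s1 s2 \<and> (AE x in lborel. c\<^sup>2 * s2 x = \<nu> * cdiff (cdiff (\<lambda>y. F (s y))) x)"
      using s12 s_eq by blast
    show "Cd 4 F" using C4 by (simp add: C_k_iff_Cd del: Cd.simps)
    show "0 < 2 * A0 * A2 / d" using A0 A2 d by simp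
  qed (use b c \<nu> \<mu> dF V(2) se s(2) inv surj F_def in auto)
  then show ?thesis using s(1) unfolding F_def F'_def \<nu>_def by blast
qed


text \<open>Vanishing of \<delta> z means period one, so |z x| = |z (x + k)| is at most a constant
  divided by the weight at x + k, which tends to infinity with k.\<close>

lemma decaying_periodic_zero:
  assumes b: "0 < b" and z: "sob b 2 L z" "\<And>x. cdiff z x = 0" shows "z x = 0"
proof -
  have p: "z (x + 1) = z x" for x using z(2)[of "x + 1/2"] by (simp add: cdiff_def add.assoc)
  have pn: "z (x + real k) = z x" for k
  proof (induction k)
    case (Suc k) then show ?case using p[of "x + real k"] by (simp add: ac_simps)
  qed simp
  have bd: "\<bar>z x\<bar> \<le> (2 * exp b * L) * inverse (wt b (x + real k))" for k
    using sob_sup[of b 1 L z "x + real k"] z(1) b pn[of k] by (simp add: numeral_2_eq_2 field_simps)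
  have "filterlim (\<lambda>k. x + real k) at_top sequentially"
    by (rule filterlim_tendsto_add_at_top[OF tendsto_const filterlim_real_sequentially])
  from tendsto_inverse_0_at_top[OF filterlim_compose[OF wt_tendsto[OF b] this]]
  have "(\<lambda>k. (2 * exp b * L) * inverse (wt b (x + real k))) \<longlonglongrightarrow> (2 * exp b * L) * 0"
    by (intro tendsto_intros)
  from LIMSEQ_le_const[OF this] bd have "\<bar>z x\<bar> \<le> (2 * exp b * L) * 0" by blast
  then show ?thesis by simp
qed

section \<open>Equivalence of the travelling-wave system and the fixed-point problem\<close>

context perturbed_wave begin

definition rho2 :: "nat \<Rightarrow> (real \<Rightarrow> real) \<Rightarrow> real \<Rightarrow> real" where
  "rho2 n u = (\<lambda>x. - (1 / c\<^sup>2) * Tn n (\<lambda>y. F (u y)) x)"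

lemma kappa_eq: "\<nu> = inverse (1 + \<mu>) \<Longrightarrow> kappa \<mu> c n = c\<^sup>2 * ((2 * pi * real n)\<^sup>2 * (\<mu> * \<nu>))"
  "\<nu> = inverse (1 + \<mu>) \<Longrightarrow> kappa \<mu> c n * (1 + \<mu>) = c\<^sup>2 * ((2 * pi * real n)\<^sup>2 * \<mu>)"
  using \<mu> by (simp_all add: kappa_def power_mult_distrib divide_simps)

lemma F_compose_sob: assumes "sob b 2 L u" shows "\<exists>K. sob b 2 K (\<lambda>x. F (u x))"
proof -
  obtain M where "\<And>a \<xi> \<epsilon>. sob b 2 L a \<Longrightarrow> sob b 2 \<epsilon> \<xi> \<Longrightarrow> \<epsilon> \<le> L \<Longrightarrow>
      sob b 2 (M * \<epsilon>) (\<lambda>x. F (a x + \<xi> x) - F (a x))"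
    using sob2_compose[OF sob_pos[OF assms]] by blast
  from this[OF sob_zero[OF sob_pos[OF assms]] assms] show ?thesis using F(3) by auto
qed

lemma travelling_wave_of_fixed_point:
  assumes V: "deriv V = F" and \<nu>\<mu>: "\<nu> = inverse (1 + \<mu>)" and n: "n \<ge> 1"
    and u: "\<And>x. u (-x) = u x" "sob b 2 L u" "slv (Psi n (\<lambda>x. u x - s x)) (\<lambda>x. u x - s x)"
  shows "travelling_wave V \<mu> c (kappa \<mu> c n) u (rho2 n u)"
proof -
  obtain u1 u2 where u12: "ac u u1" "ac u1 u2" using u(2) by (rule sob_2E)
  obtain K where g: "sob b 2 K (\<lambda>x. F (u x))" using F_compose_sob[OF u(2)] by blast
  then obtain g1 g2 where g12: "ac (\<lambda>x. F (u x)) g1" "ac g1 g2" by (rule sob_2E)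
  let ?w = "(2 * pi * real n)\<^sup>2"
  let ?g = "\<lambda>x. F (u x)"
  have r: "ac (rho2 n u) (\<lambda>x. - (1 / c\<^sup>2) * Tn n g1 x)"
    "ac (\<lambda>x. - (1 / c\<^sup>2) * Tn n g1 x) (\<lambda>x. - (1 / c\<^sup>2) * Tn n g2 x)"
    unfolding rho2_def Tn_def by (intro ac_cmult conv_ac Tn_continuous_kernel g12)+
  have m: "u \<in> borel_measurable borel" "rho2 n u \<in> borel_measurable borel"
    using borel_measurable_continuous_onI ac_continuous u12(1) r(1) by blast+
  have wu: "ae_eq (wderiv 2 u) u2" and wr: "ae_eq (wderiv 2 (rho2 n u)) (\<lambda>x. - (1 / c\<^sup>2) * Tn n g2 x)"
    using wderiv_AE[OF has_weak_deriv_2_ac[OF m(1) _ u12]] wderiv_AE[OF has_weak_deriv_2_ac[OF m(2) _ r]] by simp_all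
  have eq: "AE x in lborel. c\<^sup>2 * u2 x = cdiff (\<lambda>y. \<nu> * (cdiff ?g y + \<mu> * res n ?g y)) x"
    using fixed_point_iff[OF u(1,2) u12] u(3) by blast
  \<comment> \<open>That is, \<nu> + \<nu> \<mu> = 1: the second differences with factors \<nu> and
    \<nu> \<mu> recombine to the full second difference in the first wave equation.\<close>
  have \<nu>1: "\<nu> * \<mu> = 1 - \<nu>" using \<nu>\<mu> \<mu> by (simp add: field_simps)
  have "AE x in lborel. c\<^sup>2 * wderiv 2 u x - cdiff (cdiff ?g) x - kappa \<mu> c n * cdiff (rho2 n u) x = 0"
    using wu eq
  proof eventually_elim
    case (elim x)
    have "c\<^sup>2 * u2 x = \<nu> * cdiff (cdiff ?g) x + (\<nu> * \<mu>) * (cdiff (cdiff ?g) x - ?w * cdiff (Tn n ?g) x)"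
      unfolding elim(2) by (simp add: cdiff_def res_def algebra_simps)
    also have "\<dots> = cdiff (cdiff ?g) x - (\<nu> * \<mu>) * ?w * cdiff (Tn n ?g) x"
      unfolding \<nu>1 by (simp add: algebra_simps)
    also have "(\<nu> * \<mu>) * ?w * cdiff (Tn n ?g) x = - kappa \<mu> c n * cdiff (rho2 n u) x"
      unfolding kappa_eq(1)[OF \<nu>\<mu>] using c by (simp add: rho2_def cdiff_def field_simps)
    finally show ?case using elim(1) by simp
  qed
  moreover have "AE x in lborel. c\<^sup>2 * \<mu> * wderiv 2 (rho2 n u) x + kappa \<mu> c n * (1 + \<mu>) * rho2 n u x + \<mu> * cdiff ?g x = 0"
    using wr
  proof eventually_elim
    case (elim x)
    have T: "Tn n g2 x = cdiff ?g x - ?w * Tn n ?g x"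
      by (simp only: res_Tn[OF g12 n, symmetric] res_def)
    show ?case unfolding elim kappa_eq(2)[OF \<nu>\<mu>] unfolding rho2_def T using c by (simp add: field_simps)
  qed
  ultimately show ?thesis unfolding travelling_wave_def V by simp
qed

text \<open>T applied to v'' is computed in two ways: from the second wave equation solved for v'',
  and as \<delta> v - \<omega>^2 T v. The terms \<omega>^2 T v cancel, so v and
  \<open>rho2 n u\<close> have the same \<delta>; their difference decays and is therefore
  zero.\<close>

lemma fixed_point_of_travelling_wave:
  assumes V: "deriv V = F" and \<nu>\<mu>: "\<nu> = inverse (1 + \<mu>)" and n: "n \<ge> 1"
    and tw: "travelling_wave V \<mu> c (kappa \<mu> c n) r1 r2"
    and r1: "r1 \<in> borel_measurable borel" "ae_eq r1 u" and u: "\<And>x. u (-x) = u x" "sob b 2 L u"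
    and r2: "r2 \<in> borel_measurable borel" "ae_eq r2 v" and v: "sob b 2 M v"
  shows "slv (Psi n (\<lambda>x. u x - s x)) (\<lambda>x. u x - s x)" "v = rho2 n u"
proof -
  obtain u1 u2 where u12: "ac u u1" "ac u1 u2" using u(2) by (rule sob_2E)
  obtain v1 v2 where v12: "ac v v1" "ac v1 v2" using v by (rule sob_2E)
  obtain K where g: "sob b 2 K (\<lambda>x. F (u x))" using F_compose_sob[OF u(2)] by blast
  let ?w = "(2 * pi * real n)\<^sup>2"
  let ?g = "\<lambda>x. F (u x)"
  have [measurable]: "r1 \<in> borel_measurable borel" "u \<in> borel_measurable borel" "r2 \<in> borel_measurable borel"
    "v \<in> borel_measurable borel" "v2 \<in> borel_measurable borel"
    using r1 r2 wl2_measurable[OF sob_wl2[OF u(2)]] wl2_measurable[OF sob_wl2[OF v]]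
      loc_integrableD(1)[OF acD(1)[OF v12(2)]] by auto
  have wu: "ae_eq (wderiv 2 r1) u2" and wv: "ae_eq (wderiv 2 r2) v2"
    using wderiv_AE[OF has_weak_deriv_2_ac[OF r1 u12]] wderiv_AE[OF has_weak_deriv_2_ac[OF r2 v12]] by auto
  have "ae_eq (\<lambda>y. F (r1 y)) ?g" using r1(2) by eventually_elim simp
  then have G1: "ae_eq (cdiff (\<lambda>y. F (r1 y))) (cdiff ?g)" by (rule cdiff_cong_AE[rotated 2]) measurable
  then have G2: "ae_eq (cdiff (cdiff (\<lambda>y. F (r1 y)))) (cdiff (cdiff ?g))" by (rule cdiff_cong_AE[rotated 2]) measurable
  have R: "ae_eq (cdiff r2) (cdiff v)" by (rule cdiff_cong_AE[OF _ _ r2(2)]) measurable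
  have "ae_eq v2 (\<lambda>x. (- ?w) * v x - (1 / c\<^sup>2) * cdiff ?g x)"
    using tw[unfolded travelling_wave_def V, THEN conjunct2] wv r2(2) G1
  proof eventually_elim
    case (elim x)
    have "c\<^sup>2 * \<mu> * (v2 x + ?w * v x + (1 / c\<^sup>2) * cdiff ?g x) =
        c\<^sup>2 * \<mu> * v2 x + c\<^sup>2 * (?w * \<mu>) * v x + (c\<^sup>2 * (1 / c\<^sup>2)) * (\<mu> * cdiff ?g x)"
      by (simp only: algebra_simps)
    also have "c\<^sup>2 * (1 / c\<^sup>2) = 1" using c by simp
    also have "c\<^sup>2 * \<mu> * v2 x + c\<^sup>2 * (?w * \<mu>) * v x + 1 * (\<mu> * cdiff ?g x) = 0"
      using elim(1) unfolding elim(2,3,4) kappa_eq(2)[OF \<nu>\<mu>] by simp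
    finally have "c\<^sup>2 * \<mu> * (v2 x + ?w * v x + (1 / c\<^sup>2) * cdiff ?g x) = 0" .
    then have "v2 x + ?w * v x + (1 / c\<^sup>2) * cdiff ?g x = 0" using c \<mu> by simp
    then show ?case by simp
  qed
  note E = this
  have lv: "loc_integrable (\<lambda>x. (- ?w) * v x)" and lg: "loc_integrable ?g"
    using loc_integrable_cmult wl2_loc_integrable[OF sob_wl2[OF v]] wl2_loc_integrable[OF sob_wl2[OF g]] by blast+
  have lc: "loc_integrable (\<lambda>x. (1 / c\<^sup>2) * cdiff ?g x)"
    by (intro loc_integrable_cmult wl2_loc_integrable[OF wl2_cdiff[OF b0 sob_wl2[OF g]]])
  have "cdiff v x = cdiff (rho2 n u) x" for x
  proof -
    have "Tn n v2 x = Tn n (\<lambda>x. (- ?w) * v x - (1 / c\<^sup>2) * cdiff ?g x) x"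
      unfolding Tn_def
      by (rule conv_cong_AE[OF borel_measurable_continuous_onI[OF Tn_continuous_kernel] _ _ E]) measurable
    also have "\<dots> = (- ?w) * Tn n v x - (1 / c\<^sup>2) * cdiff (Tn n ?g) x"
      unfolding Tn_def conv_diff[OF Tn_continuous_kernel lv lc] conv_cmult conv_cdiff[OF Tn_continuous_kernel lg] ..
    finally have 1: "Tn n v2 x = (- ?w) * Tn n v x - (1 / c\<^sup>2) * cdiff (Tn n ?g) x" .
    have 2: "Tn n v2 x = cdiff v x - ?w * Tn n v x"
      by (simp only: res_Tn[OF v12 n, symmetric] res_def)
    \<comment> \<open>Abstract form of the cancellation: \<open>t\<close> stands for T v'',
      \<open>a\<close> for T v and \<open>e\<close> for \<delta> v.\<close>
    have "e = - k * d" if "t = (- w) * a - k * d" "t = e - w * a" for t w a k d e :: real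
      using that by (simp add: algebra_simps)
    from this[OF 1 2] have "cdiff v x = - (1 / c\<^sup>2) * cdiff (Tn n ?g) x" .
    then show ?thesis by (simp add: rho2_def cdiff_def algebra_simps)
  qed
  then have cd: "cdiff v = cdiff (rho2 n u)" by blast
  obtain L' where "sob b 2 L' (rho2 n u)"
    unfolding rho2_def using sob_cmult[OF sob_Tn[OF b0 g n]] by blast
  from sob_diff[OF v this] have "v x - rho2 n u x = 0" for x
    by (rule decaying_periodic_zero[OF b]) (use cd in \<open>simp add: cdiff_def fun_eq_iff algebra_simps\<close>)
  then show "v = rho2 n u" by (simp add: fun_eq_iff)
  have \<nu>1: "\<nu> * \<mu> = 1 - \<nu>" using \<nu>\<mu> \<mu> by (simp add: field_simps)
  have "AE x in lborel. c\<^sup>2 * u2 x = cdiff (\<lambda>y. \<nu> * (cdiff ?g y + \<mu> * res n ?g y)) x"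
    using tw[unfolded travelling_wave_def V, THEN conjunct1] wu G2 R
  proof eventually_elim
    case (elim x)
    have "cdiff (\<lambda>y. \<nu> * (cdiff ?g y + \<mu> * res n ?g y)) x =
        \<nu> * cdiff (cdiff ?g) x + (\<nu> * \<mu>) * (cdiff (cdiff ?g) x - ?w * cdiff (Tn n ?g) x)"
      by (simp add: cdiff_def res_def algebra_simps)
    also have "\<dots> = cdiff (cdiff ?g) x - (\<nu> * \<mu>) * ?w * cdiff (Tn n ?g) x"
      unfolding \<nu>1 by (simp add: algebra_simps)
    also have "(\<nu> * \<mu>) * ?w * cdiff (Tn n ?g) x = - kappa \<mu> c n * cdiff (rho2 n u) x"
      unfolding kappa_eq(1)[OF \<nu>\<mu>] using c by (simp add: rho2_def cdiff_def field_simps)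
    finally show ?case using elim by (simp add: cd)
  qed
  then show "slv (Psi n (\<lambda>x. u x - s x)) (\<lambda>x. u x - s x)"
    using fixed_point_iff[OF u u12] by blast
qed

end

theorem theorem2p3:
  fixes \<mu> c \<beta> :: real and V \<sigma> :: "real \<Rightarrow> real"
  assumes "\<mu> > 0"
    and "C_k 5 V"
    and "deriv V 0 = 0"
    and "c \<noteq> 0"
    and "admissible_via (\<lambda>x. inverse (1 + \<mu>) * V x) c \<beta> \<sigma>"
  shows "\<exists>C>0. \<exists>N\<ge>1. \<exists>\<rho>1 \<rho>2 :: nat \<Rightarrow> real \<Rightarrow> real.
     (\<forall>n\<ge>N. wave_near V \<mu> c \<beta> \<sigma> C n (\<rho>1 n) (\<rho>2 n) \<and>
        (\<forall>r1 r2. wave_near V \<mu> c \<beta> \<sigma> C n r1 r2 \<longrightarrow> ae_eq r1 (\<rho>1 n) \<and> ae_eq r2 (\<rho>2 n))) \<and>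
     (smooth V \<longrightarrow>
        (\<forall>n\<ge>N. smooth (\<rho>1 n) \<and> smooth (\<rho>2 n)) \<and>
        (\<forall>s\<ge>0. \<exists>C'>0. \<forall>n\<ge>N.
           (\<lambda>x. \<sigma> x - \<rho>1 n x) \<in> Hw_space s \<beta> \<and> \<rho>2 n \<in> Hw_space s \<beta> \<and>
           Hw_norm s \<beta> (\<lambda>x. \<sigma> x - \<rho>1 n x) + Hw_norm s \<beta> (\<rho>2 n) \<le> C' / (real n)\<^sup>2))"
proof -
  define \<nu> where "\<nu> = inverse (1 + \<mu>)"
  define F where "F = deriv V"
  have VF: "deriv V = F" by (simp add: F_def)
  obtain K0 A s where pw: "perturbed_wave c \<beta> \<nu> \<mu> K0 A F (deriv F) s" and \<sigma>s: "ae_eq \<sigma> s"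
    using admissible_perturbed_wave[OF assms] unfolding \<nu>_def F_def by blast
  interpret perturbed_wave c \<beta> \<nu> \<mu> K0 A F "deriv F" s by (rule pw)
  have "\<sigma> \<in> Hw_space 2 \<beta>" using assms(5) by (simp add: admissible_via_def E_space_def)
  then have \<sigma>m [measurable]: "\<sigma> \<in> borel_measurable borel" by (rule Hw_space_measurable)
  obtain A1 where A1: "A1 > 0" "\<And>f u K. f \<in> borel_measurable borel \<Longrightarrow> ae_eq f u \<Longrightarrow> sob \<beta> 2 K u \<Longrightarrow>
    f \<in> Hw_space 2 \<beta> \<and> Hw_norm 2 \<beta> f \<le> A1 * K"
    using sob_Hw_space[OF b0, of 2] by auto
  obtain A2 where A2: "A2 > 0" "\<And>f K. f \<in> Hw_space 2 \<beta> \<Longrightarrow> Hw_norm 2 \<beta> f \<le> K \<Longrightarrow> 0 < K \<Longrightarrow>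
    \<exists>u. ae_eq f u \<and> sob \<beta> 2 (A2 * K) u"
    using Hw_space_sob[OF b0, of 2] by auto
  obtain C1 N1 where C1: "C1 > 0" and N1: "N1 \<ge> 1"
    "\<And>n. n \<ge> N1 \<Longrightarrow> \<exists>\<xi>. sob \<beta> 2 (C1 / real n) \<xi> \<and> slv (Psi n \<xi>) \<xi>"
    using fixed_point_exists by blast
  obtain N2 where N2: "N2 \<ge> 1" "\<And>n. n \<ge> N2 \<Longrightarrow> C1 / K0 \<le> real n" using large_n by blast
  have Ku: "0 < K0 + C1" using K0 C1 by simp
  obtain L where L: "L > 0" "\<And>a \<xi> \<epsilon>. sob \<beta> 2 (K0 + C1) a \<Longrightarrow> sob \<beta> 2 \<epsilon> \<xi> \<Longrightarrow> \<epsilon> \<le> K0 + C1 \<Longrightarrow>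
      sob \<beta> 2 (L * \<epsilon>) (\<lambda>x. F (a x + \<xi> x) - F (a x))" using sob2_compose[OF Ku] by blast
  define D where "D = 1 / c\<^sup>2 * (exp \<beta> * (L * (K0 + C1)))"
  have D: "0 < D" using c L(1) Ku by (simp add: D_def)
  \<comment> \<open>\<open>A1\<close> converts \<open>sob\<close> bounds into the given norm; C1 / n
    bounds \<open>\<xi> n\<close> and D / n bounds the second component.\<close>
  define C where "C = A1 * C1 + A1 * D"
  have C: "0 < C" using A1(1) C1 D by (simp add: C_def add_pos_pos)
  \<comment> \<open>A2 C / n bounds the first component of every competitor allowed by the constant
    C, and C1 / n the constructed \<xi>; uniqueness is needed in one ball that contains
    both.\<close>
  define C3 where "C3 = A2 * C + C1"
  have C3: "0 < C3" "A2 * C \<le> C3" "C1 \<le> C3" using A2(1) C C1 by (auto simp: C3_def intro: add_pos_pos)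
  obtain N3 where N3: "N3 \<ge> 1" "\<And>n \<xi> \<eta>. n \<ge> N3 \<Longrightarrow> sob \<beta> 2 (C3 / real n) \<xi> \<Longrightarrow> sob \<beta> 2 (C3 / real n) \<eta> \<Longrightarrow>
    slv (Psi n \<xi>) \<xi> \<Longrightarrow> slv (Psi n \<eta>) \<eta> \<Longrightarrow> \<xi> = \<eta>" using fixed_point_unique[OF C3(1)] by blast
  define N where "N = max N1 (max N2 N3)"
  have N: "N \<ge> 1" "\<And>n. n \<ge> N \<Longrightarrow> n \<ge> N1 \<and> n \<ge> N2 \<and> n \<ge> N3" using N1(1) by (auto simp: N_def)
  have "\<forall>n. \<exists>\<xi>. n \<ge> N \<longrightarrow> sob \<beta> 2 (C1 / real n) \<xi> \<and> slv (Psi n \<xi>) \<xi>" using N1(2) N(2) by blast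
  then obtain \<xi> where \<xi>: "\<And>n. n \<ge> N \<Longrightarrow> sob \<beta> 2 (C1 / real n) (\<xi> n)" "\<And>n. n \<ge> N \<Longrightarrow> slv (Psi n (\<xi> n)) (\<xi> n)"
    using choice[of "\<lambda>n \<xi>. n \<ge> N \<longrightarrow> sob \<beta> 2 (C1 / real n) \<xi> \<and> slv (Psi n \<xi>) \<xi>"] by blast
  define \<rho>1 where "\<rho>1 n = (\<lambda>x. s x + \<xi> n x)" for n
  define \<rho>2 where "\<rho>2 n = rho2 n (\<rho>1 n)" for n
  have n0: "n \<ge> 1" "0 < real n" if "n \<ge> N" for n using that N(1) by auto
  have CK: "C1 / real n \<le> K0" if "n \<ge> N" for n
    using N2(2)[of n] N(2)[OF that] n0[OF that] K0 by (simp add: field_simps)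
  have \<rho>1_even: "\<rho>1 n (-x) = \<rho>1 n x" if "n \<ge> N" for n x
    using s(1) solves_even[OF \<xi>(2)[OF that]] by (simp add: \<rho>1_def)
  have \<rho>1_sob: "sob \<beta> 2 (K0 + C1) (\<rho>1 n)" if n: "n \<ge> N" for n
    unfolding \<rho>1_def
  proof (rule sob_add[OF s(2) sob_mono[OF \<xi>(1)[OF n]]])
    show "C1 / real n \<le> C1" using n0[OF n] C1 by (simp add: divide_le_eq mult_le_cancel_left1)
  qed
  have \<rho>1_m: "\<rho>1 n \<in> borel_measurable borel" if "n \<ge> N" for n
    by (rule wl2_measurable[OF sob_wl2[OF \<rho>1_sob[OF that]]])
  have diff: "ae_eq (\<lambda>x. \<sigma> x - \<rho>1 n x) (\<lambda>x. - \<xi> n x)" for n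
    using \<sigma>s by eventually_elim (simp add: \<rho>1_def)
  have diff_m: "(\<lambda>x. \<sigma> x - \<rho>1 n x) \<in> borel_measurable borel" if "n \<ge> N" for n
    using \<rho>1_m[OF that] by simp
  have \<rho>2_sob: "sob \<beta> 2 (D / real n) (\<rho>2 n)" if n: "n \<ge> N" for n
  proof -
    have "sob \<beta> 2 (L * (K0 + C1)) (\<lambda>x. F (\<rho>1 n x))"
      using L(2)[OF sob_zero[OF Ku] \<rho>1_sob[OF n]] F(3) by simp
    from sob_scale[OF sob_Tn[OF b0 this n0(1)[OF n]], of "- (1 / c\<^sup>2)" "1 / c\<^sup>2"] c
    show ?thesis by (simp add: \<rho>2_def rho2_def D_def)
  qed
  have near: "wave_near V \<mu> c \<beta> \<sigma> C n (\<rho>1 n) (\<rho>2 n)" if n: "n \<ge> N" for n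
  proof -
    have \<rho>2_m: "\<rho>2 n \<in> borel_measurable borel" by (rule wl2_measurable[OF sob_wl2[OF \<rho>2_sob[OF n]]])
    have 1: "\<rho>1 n \<in> Hw_space 2 \<beta>" using A1(2)[OF \<rho>1_m[OF n] _ \<rho>1_sob[OF n]] by simp
    have 2: "\<rho>2 n \<in> Hw_space 2 \<beta>" "Hw_norm 2 \<beta> (\<rho>2 n) \<le> A1 * (D / real n)"
      using A1(2)[OF \<rho>2_m _ \<rho>2_sob[OF n]] by auto
    have 3: "Hw_norm 2 \<beta> (\<lambda>x. \<sigma> x - \<rho>1 n x) \<le> A1 * (C1 / real n)"
      using A1(2)[OF diff_m[OF n] diff sob_minus[OF \<xi>(1)[OF n]]] by simp
    have "slv (Psi n (\<lambda>x. \<rho>1 n x - s x)) (\<lambda>x. \<rho>1 n x - s x)" using \<xi>(2)[OF n] by (simp add: \<rho>1_def)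
    then have 4: "travelling_wave V \<mu> c (kappa \<mu> c n) (\<rho>1 n) (\<rho>2 n)"
      unfolding \<rho>2_def
      by (rule travelling_wave_of_fixed_point[OF VF \<nu>_def n0(1)[OF n] \<rho>1_even[OF n] \<rho>1_sob[OF n]])
    have 5: "even_ae (\<rho>1 n)" by (simp add: even_ae_def \<rho>1_even[OF n])
    have 6: "odd_ae (\<rho>2 n)"
      by (simp add: odd_ae_def \<rho>2_def rho2_def Tn_odd \<rho>1_even[OF n])
    have "A1 * (C1 / real n) + A1 * (D / real n) = C / real n" by (simp add: C_def add_divide_distrib)
    with 1 2 3 4 5 6 show ?thesis by (simp add: wave_near_def)
  qed
  have unique: "ae_eq r1 (\<rho>1 n) \<and> ae_eq r2 (\<rho>2 n)" if n: "n \<ge> N" and w: "wave_near V \<mu> c \<beta> \<sigma> C n r1 r2" for n r1 r2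
  proof -
    have r: "r1 \<in> Hw_space (real 2) \<beta>" "r2 \<in> Hw_space (real 2) \<beta>" "even_ae r1"
      and tw: "travelling_wave V \<mu> c (kappa \<mu> c n) r1 r2"
      and le: "Hw_norm 2 \<beta> (\<lambda>x. \<sigma> x - r1 x) + Hw_norm 2 \<beta> r2 \<le> C / real n"
      using w by (auto simp: wave_near_def)
    note [measurable] = Hw_space_measurable[OF r(1)] Hw_space_measurable[OF r(2)]
    obtain u L1 where u: "ae_eq r1 u" "sob \<beta> 2 L1 u" by (rule Hw_space_rep[OF b0 r(1)])
    obtain v L2 where v: "ae_eq r2 v" "sob \<beta> 2 L2 v" by (rule Hw_space_rep[OF b0 r(2)])
    have cont: "continuous_on UNIV f" if "sob \<beta> 2 K f" for f K
      using that ac_continuous by (auto elim: sob_2E)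
    have ue: "u (-x) = u x" for x
      by (rule even_ae_continuous[OF r(3) _ u(1) cont[OF u(2)]]) simp
    note sol = fixed_point_of_travelling_wave[OF VF \<nu>_def n0(1)[OF n] tw _ u(1) ue u(2) _ v]
    have su: "ae_eq (\<lambda>x. \<sigma> x - r1 x) (\<lambda>x. s x - u x)" using \<sigma>s u(1) by eventually_elim simp
    have ss: "sob \<beta> 2 (K0 + L1) (\<lambda>x. s x - u x)" by (rule sob_diff[OF s(2) u(2)])
    have "(\<lambda>x. \<sigma> x - r1 x) \<in> Hw_space 2 \<beta>" using A1(2)[OF _ su ss] by simp
    moreover have "Hw_norm 2 \<beta> (\<lambda>x. \<sigma> x - r1 x) \<le> C / real n" using le Hw_norm_nonneg[of \<beta> r2] by simp
    moreover have "0 < C / real n" using C n0[OF n] by simp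
    ultimately obtain w where w: "ae_eq (\<lambda>x. \<sigma> x - r1 x) w" "sob \<beta> 2 (A2 * (C / real n)) w"
      using A2(2) by blast
    have "ae_eq w (\<lambda>x. s x - u x)" using w(1) su by eventually_elim simp
    then have "w = (\<lambda>x. s x - u x)" by (rule continuous_AE_eq_imp_eq[OF cont[OF w(2)] cont[OF ss]])
    then have "sob \<beta> 2 (A2 * (C / real n)) (\<lambda>x. u x - s x)" using sob_minus[OF w(2)] by simp
    then have "sob \<beta> 2 (C3 / real n) (\<lambda>x. u x - s x)"
      by (rule sob_mono) (use C3(2) in \<open>simp add: divide_right_mono\<close>)
    moreover have "sob \<beta> 2 (C3 / real n) (\<xi> n)"
      by (rule sob_mono[OF \<xi>(1)[OF n]]) (use C3(3) in \<open>simp add: divide_right_mono\<close>)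
    ultimately have "(\<lambda>x. u x - s x) = \<xi> n"
      using N3(2)[of n "\<lambda>x. u x - s x" "\<xi> n"] N(2)[OF n] sol(1) \<xi>(2)[OF n] by simp
    then have "u x = \<rho>1 n x" for x by (simp add: \<rho>1_def fun_eq_iff algebra_simps)
    then have "u = \<rho>1 n" by blast
    with sol(2) u(1) v(1) show ?thesis by (simp add: \<rho>2_def)
  qed
  have smooth_part: "(\<forall>n\<ge>N. smooth (\<rho>1 n) \<and> smooth (\<rho>2 n)) \<and>
        (\<forall>r\<ge>0. \<exists>C'>0. \<forall>n\<ge>N.
           (\<lambda>x. \<sigma> x - \<rho>1 n x) \<in> Hw_space r \<beta> \<and> \<rho>2 n \<in> Hw_space r \<beta> \<and>
           Hw_norm r \<beta> (\<lambda>x. \<sigma> x - \<rho>1 n x) + Hw_norm r \<beta> (\<rho>2 n) \<le> C' / (real n)\<^sup>2)" if V: "smooth V"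
  proof -
    have smF: "Cd k F" for k
      using V C_k_Suc[of k V] by (simp add: smooth_def F_def flip: C_k_iff_Cd)
    note qd = quadratic_decay[OF smF C1 N(1) CK \<xi>]
    have q2: "\<exists>K>0. \<forall>n\<ge>N. sob \<beta> m (K / (real n)\<^sup>2) (\<rho>2 n)" for m
    proof -
      obtain K where K: "0 < K" "\<And>n. n \<ge> N \<Longrightarrow> sob \<beta> m (K / (real n)\<^sup>2) (Tn n (\<lambda>x. F (s x + \<xi> n x)))"
        using qd(2) by blast
      have "sob \<beta> m ((1 / c\<^sup>2 * K) / (real n)\<^sup>2) (\<rho>2 n)" if n: "n \<ge> N" for n
        using sob_scale[OF K(2)[OF n], of "- (1 / c\<^sup>2)" "1 / c\<^sup>2"] c
        by (simp add: \<rho>2_def rho2_def \<rho>1_def)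
      then show ?thesis using K(1) c by (intro exI[of _ "1 / c\<^sup>2 * K"]) auto
    qed
    have "smooth (\<rho>1 n)" if "n \<ge> N" for n
    proof (rule sob_all_smooth)
      show "\<exists>K. sob \<beta> m K (\<rho>1 n)" for m
        using uniform_regularity[OF smF C1 N(1) \<xi>, of m] that unfolding \<rho>1_def by blast
    qed
    moreover have "smooth (\<rho>2 n)" if "n \<ge> N" for n
      by (rule sob_all_smooth) (use q2 that in blast)
    moreover have "\<exists>C'>0. \<forall>n\<ge>N. (\<lambda>x. \<sigma> x - \<rho>1 n x) \<in> Hw_space r \<beta> \<and> \<rho>2 n \<in> Hw_space r \<beta> \<and>
           Hw_norm r \<beta> (\<lambda>x. \<sigma> x - \<rho>1 n x) + Hw_norm r \<beta> (\<rho>2 n) \<le> C' / (real n)\<^sup>2" if r: "0 \<le> r" for r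
    proof -
      obtain m B where B: "B > 0" "\<And>f u K. f \<in> borel_measurable borel \<Longrightarrow> ae_eq f u \<Longrightarrow> sob \<beta> m K u \<Longrightarrow>
        f \<in> Hw_space r \<beta> \<and> Hw_norm r \<beta> f \<le> B * K"
        using sob_Hw_space_real[OF r b0] by blast
      obtain K where K: "0 < K" "\<And>n. n \<ge> N \<Longrightarrow> sob \<beta> m (K / (real n)\<^sup>2) (\<xi> n)" using qd(1) by blast
      obtain K' where K': "0 < K'" "\<And>n. n \<ge> N \<Longrightarrow> sob \<beta> m (K' / (real n)\<^sup>2) (\<rho>2 n)" using q2 by blast
      have "(\<lambda>x. \<sigma> x - \<rho>1 n x) \<in> Hw_space r \<beta> \<and> \<rho>2 n \<in> Hw_space r \<beta> \<and>
           Hw_norm r \<beta> (\<lambda>x. \<sigma> x - \<rho>1 n x) + Hw_norm r \<beta> (\<rho>2 n) \<le> (B * K + B * K') / (real n)\<^sup>2" if n: "n \<ge> N" for n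
        using B(2)[OF diff_m[OF n] diff sob_minus[OF K(2)[OF n]]]
          B(2)[OF wl2_measurable[OF sob_wl2[OF K'(2)[OF n]]] _ K'(2)[OF n]]
        by (simp add: add_divide_distrib)
      moreover have "0 < B * K + B * K'" using B(1) K(1) K'(1) by (simp add: add_pos_pos)
      ultimately show ?thesis by blast
    qed
    ultimately show ?thesis by blast
  qed
  show ?thesis
    by (rule exI[of _ C], rule conjI[OF C], rule exI[of _ N], rule conjI[OF N(1)], rule exI[of _ \<rho>1], rule exI[of _ \<rho>2])
       (use near unique smooth_part in blast)
qed

end
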